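(* Let $\mathcal{C}$ be a semisimple ribbon category, $A$ a simple object of $\mathcal{C}$, $X$ a simple invertible object of $\mathcal{C}$ (that is, $X\otimes X^*\cong \mathbf{1}$), and $L$ a link with $\#L$ components. Then $$\mathcal{J}_{\mathcal{C},A\otimes X}(L)=\mathcal{J}_{\mathcal{C},A}(L)\,\mathcal{J}_{\mathcal{C},X}(L)=(\dim X)^{\#L}\,\mathcal{J}_{\mathcal{C},A}(L).$$
   Context: Ribbon categories are linear over $\mathbb{C}$ with $\mathrm{End}(\mathbf{1})=\mathbb{C}$ (and $\mathrm{End}(V)=\mathbb{C}$ for simple $V$). For an object $V$ of a ribbon category $\mathcal{C}$ and a framed oriented link $L$, $\tilde{\mathcal{J}}_{\mathcal{C},V}(L)\in\mathrm{End}(\mathbf{1})=\mathbb{C}$ is the Reshetikhin–Turaev invariant of $L$ with every component labelled by $V$. For simple $V$ with twist factor $\theta_V$ (a positive kink in a strand labelled $V$ equals $\theta_V$ times the straight strand), the framing-independent invariant of oriented links is $\mathcal{J}_{\mathcal{C},V}(L)=\theta_V^{-w(L)}\tilde{\mathcal{J}}_{\mathcal{C},V}(L)$, with $w(L)$ the writhe (so the unknot has value $\dim V$). The object $A\otimes X$ is automatically simple. *)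

theory Defs
  imports Complex_Main
begin

section \<open>Complex-linear ribbon categories\<close>

text \<open>
  A category is given by a type of objects and a type of arrows, every arrow having a source and a
  target; operations on arrows are only constrained on composable (or parallel) arguments.
  Composition is written in the usual order: \<open>g \<cdot> f\<close> is \<open>f\<close> followed by \<open>g\<close>. The categories need
  not be strict monoidal.
\<close>

record ('o, 'm) ribbon_data =
  src    :: "'m \<Rightarrow> 'o"
  tgt    :: "'m \<Rightarrow> 'o"
  idm    :: "'o \<Rightarrow> 'm"
  comp   :: "'m \<Rightarrow> 'm \<Rightarrow> 'm"        (infixr "\<cdot>\<index>" 60)
  zero   :: "'o \<Rightarrow> 'o \<Rightarrow> 'm"
  add    :: "'m \<Rightarrow> 'm \<Rightarrow> 'm"        (infixl "\<oplus>\<index>" 55)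
  scale  :: "complex \<Rightarrow> 'm \<Rightarrow> 'm"   (infixr "\<odot>\<index>" 65)
  unit   :: "'o"                     ("\<one>\<index>")
  tensor :: "'o \<Rightarrow> 'o \<Rightarrow> 'o"        (infixr "\<otimes>\<index>" 75)
  tensor_arr :: "'m \<Rightarrow> 'm \<Rightarrow> 'm"    (infixr "\<boxtimes>\<index>" 75)
  assoc  :: "'o \<Rightarrow> 'o \<Rightarrow> 'o \<Rightarrow> 'm"
  lunit  :: "'o \<Rightarrow> 'm"
  runit  :: "'o \<Rightarrow> 'm"
  braid  :: "'o \<Rightarrow> 'o \<Rightarrow> 'm"
  dual   :: "'o \<Rightarrow> 'o"
  ev     :: "'o \<Rightarrow> 'm"
  coev   :: "'o \<Rightarrow> 'm"
  twist  :: "'o \<Rightarrow> 'm"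

context
  fixes C :: "('o, 'm) ribbon_data" (structure)
begin

definition hom :: "'o \<Rightarrow> 'o \<Rightarrow> 'm set" where
  "hom a b = {f. src C f = a \<and> tgt C f = b}"

definition inverse_arrows :: "'m \<Rightarrow> 'm \<Rightarrow> bool" where
  "inverse_arrows f g \<longleftrightarrow> g \<in> hom (tgt C f) (src C f) \<and>
     g \<cdot> f = idm C (src C f) \<and> f \<cdot> g = idm C (tgt C f)"

definition is_iso :: "'m \<Rightarrow> bool" where
  "is_iso f \<longleftrightarrow> (\<exists>g. inverse_arrows f g)"

definition inv_arr :: "'m \<Rightarrow> 'm" where
  "inv_arr f = (THE g. inverse_arrows f g)"

definition isomorphic :: "'o \<Rightarrow> 'o \<Rightarrow> bool" where
  "isomorphic a b \<longleftrightarrow> (\<exists>f \<in> hom a b. is_iso f)"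

definition is_mono :: "'m \<Rightarrow> bool" where
  "is_mono f \<longleftrightarrow> (\<forall>c. \<forall>g \<in> hom c (src C f). \<forall>h \<in> hom c (src C f). f \<cdot> g = f \<cdot> h \<longrightarrow> g = h)"

definition is_epi :: "'m \<Rightarrow> bool" where
  "is_epi f \<longleftrightarrow> (\<forall>c. \<forall>g \<in> hom (tgt C f) c. \<forall>h \<in> hom (tgt C f) c. g \<cdot> f = h \<cdot> f \<longrightarrow> g = h)"

definition zero_object :: "'o \<Rightarrow> bool" where
  "zero_object a \<longleftrightarrow> idm C a = zero C a a"

definition simple :: "'o \<Rightarrow> bool" where
  "simple a \<longleftrightarrow> \<not> zero_object a \<and>
     (\<forall>b. \<forall>f \<in> hom b a. is_mono f \<longrightarrow> f = zero C b a \<or> is_iso f)"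

text \<open>\<open>End(a) = \<complex>\<close>: the map \<open>c \<mapsto> c id\<close> is a bijection of \<open>\<complex>\<close> onto \<open>End(a)\<close>, with inverse
  \<open>scalar_of a\<close>.\<close>

definition scalar_endos :: "'o \<Rightarrow> bool" where
  "scalar_endos a \<longleftrightarrow> (\<forall>f \<in> hom a a. \<exists>!c. f = c \<odot> idm C a)"

definition scalar_of :: "'o \<Rightarrow> 'm \<Rightarrow> complex" where
  "scalar_of a f = (THE c. f = c \<odot> idm C a)"

definition invertible :: "'o \<Rightarrow> bool" where
  "invertible a \<longleftrightarrow> isomorphic (a \<otimes> dual C a) \<one>"

definition is_biproduct :: "'o \<Rightarrow> 'o \<Rightarrow> 'o \<Rightarrow> bool" where
  "is_biproduct s a b \<longleftrightarrow>
     (\<exists>i \<in> hom a s. \<exists>j \<in> hom b s. \<exists>p \<in> hom s a. \<exists>q \<in> hom s b.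
        p \<cdot> i = idm C a \<and> q \<cdot> j = idm C b \<and> p \<cdot> j = zero C b a \<and> q \<cdot> i = zero C a b \<and>
        (i \<cdot> p) \<oplus> (j \<cdot> q) = idm C s)"

inductive sum_of_simples :: "'o \<Rightarrow> bool" where
  "zero_object a \<Longrightarrow> sum_of_simples a"
| "simple a \<Longrightarrow> sum_of_simples b \<Longrightarrow> is_biproduct s a b \<Longrightarrow> sum_of_simples s"

definition is_kernel :: "'m \<Rightarrow> 'm \<Rightarrow> bool" where
  "is_kernel k f \<longleftrightarrow> tgt C k = src C f \<and> f \<cdot> k = zero C (src C k) (tgt C f) \<and>
     (\<forall>c. \<forall>h \<in> hom c (src C f). f \<cdot> h = zero C c (tgt C f) \<longrightarrow>
        (\<exists>!u. u \<in> hom c (src C k) \<and> k \<cdot> u = h))"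

definition is_cokernel :: "'m \<Rightarrow> 'm \<Rightarrow> bool" where
  "is_cokernel q f \<longleftrightarrow> src C q = tgt C f \<and> q \<cdot> f = zero C (src C f) (tgt C q) \<and>
     (\<forall>c. \<forall>h \<in> hom (tgt C f) c. h \<cdot> f = zero C (src C f) c \<longrightarrow>
        (\<exists>!u. u \<in> hom (tgt C q) c \<and> u \<cdot> q = h))"

end

locale linear_category =
  fixes C :: "('o, 'm) ribbon_data" (structure)
  assumes id_hom: "idm C a \<in> hom C a a"
    and comp_hom: "\<lbrakk>f \<in> hom C a b; g \<in> hom C b c\<rbrakk> \<Longrightarrow> g \<cdot> f \<in> hom C a c"
    and id_comp: "f \<in> hom C a b \<Longrightarrow> idm C b \<cdot> f = f"
    and comp_id: "f \<in> hom C a b \<Longrightarrow> f \<cdot> idm C a = f"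
    and comp_assoc: "\<lbrakk>f \<in> hom C a b; g \<in> hom C b c; h \<in> hom C c d\<rbrakk>
          \<Longrightarrow> (h \<cdot> g) \<cdot> f = h \<cdot> (g \<cdot> f)"
    and zero_hom: "zero C a b \<in> hom C a b"
    and add_hom: "\<lbrakk>f \<in> hom C a b; g \<in> hom C a b\<rbrakk> \<Longrightarrow> f \<oplus> g \<in> hom C a b"
    and scale_hom: "f \<in> hom C a b \<Longrightarrow> x \<odot> f \<in> hom C a b"
    and add_assoc: "\<lbrakk>f \<in> hom C a b; g \<in> hom C a b; h \<in> hom C a b\<rbrakk>
          \<Longrightarrow> (f \<oplus> g) \<oplus> h = f \<oplus> (g \<oplus> h)"
    and add_commute: "\<lbrakk>f \<in> hom C a b; g \<in> hom C a b\<rbrakk> \<Longrightarrow> f \<oplus> g = g \<oplus> f"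
    and zero_add: "f \<in> hom C a b \<Longrightarrow> zero C a b \<oplus> f = f"
    and add_minus: "f \<in> hom C a b \<Longrightarrow> f \<oplus> ((-1) \<odot> f) = zero C a b"
    and scale_add: "\<lbrakk>f \<in> hom C a b; g \<in> hom C a b\<rbrakk> \<Longrightarrow> x \<odot> (f \<oplus> g) = (x \<odot> f) \<oplus> (x \<odot> g)"
    and add_scale: "f \<in> hom C a b \<Longrightarrow> (x + y) \<odot> f = (x \<odot> f) \<oplus> (y \<odot> f)"
    and scale_scale: "f \<in> hom C a b \<Longrightarrow> x \<odot> y \<odot> f = (x * y) \<odot> f"
    and one_scale: "f \<in> hom C a b \<Longrightarrow> 1 \<odot> f = f"
    and comp_add_left: "\<lbrakk>f \<in> hom C a b; g \<in> hom C b c; h \<in> hom C b c\<rbrakk>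
          \<Longrightarrow> (g \<oplus> h) \<cdot> f = (g \<cdot> f) \<oplus> (h \<cdot> f)"
    and comp_add_right: "\<lbrakk>f \<in> hom C a b; g \<in> hom C a b; h \<in> hom C b c\<rbrakk>
          \<Longrightarrow> h \<cdot> (f \<oplus> g) = (h \<cdot> f) \<oplus> (h \<cdot> g)"
    and comp_scale_left: "\<lbrakk>f \<in> hom C a b; g \<in> hom C b c\<rbrakk> \<Longrightarrow> (x \<odot> g) \<cdot> f = x \<odot> (g \<cdot> f)"
    and comp_scale_right: "\<lbrakk>f \<in> hom C a b; g \<in> hom C b c\<rbrakk> \<Longrightarrow> g \<cdot> (x \<odot> f) = x \<odot> (g \<cdot> f)"

locale linear_monoidal_category = linear_category C for C :: "('o, 'm) ribbon_data" (structure) +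
  assumes tensor_hom: "\<lbrakk>f \<in> hom C a a'; g \<in> hom C b b'\<rbrakk> \<Longrightarrow> f \<boxtimes> g \<in> hom C (a \<otimes> b) (a' \<otimes> b')"
    and tensor_id: "idm C a \<boxtimes> idm C b = idm C (a \<otimes> b)"
    and interchange: "\<lbrakk>f \<in> hom C a a'; f' \<in> hom C a' a''; g \<in> hom C b b'; g' \<in> hom C b' b''\<rbrakk>
          \<Longrightarrow> (f' \<boxtimes> g') \<cdot> (f \<boxtimes> g) = (f' \<cdot> f) \<boxtimes> (g' \<cdot> g)"
    and tensor_add_left: "\<lbrakk>f \<in> hom C a a'; f' \<in> hom C a a'; g \<in> hom C b b'\<rbrakk>
          \<Longrightarrow> (f \<oplus> f') \<boxtimes> g = (f \<boxtimes> g) \<oplus> (f' \<boxtimes> g)"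
    and tensor_add_right: "\<lbrakk>f \<in> hom C a a'; g \<in> hom C b b'; g' \<in> hom C b b'\<rbrakk>
          \<Longrightarrow> f \<boxtimes> (g \<oplus> g') = (f \<boxtimes> g) \<oplus> (f \<boxtimes> g')"
    and tensor_scale_left: "\<lbrakk>f \<in> hom C a a'; g \<in> hom C b b'\<rbrakk> \<Longrightarrow> (x \<odot> f) \<boxtimes> g = x \<odot> (f \<boxtimes> g)"
    and tensor_scale_right: "\<lbrakk>f \<in> hom C a a'; g \<in> hom C b b'\<rbrakk> \<Longrightarrow> f \<boxtimes> (x \<odot> g) = x \<odot> (f \<boxtimes> g)"
    and assoc_hom: "assoc C a b c \<in> hom C ((a \<otimes> b) \<otimes> c) (a \<otimes> (b \<otimes> c))"
    and assoc_iso: "is_iso C (assoc C a b c)"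
    and assoc_natural: "\<lbrakk>f \<in> hom C a a'; g \<in> hom C b b'; h \<in> hom C c c'\<rbrakk>
          \<Longrightarrow> assoc C a' b' c' \<cdot> ((f \<boxtimes> g) \<boxtimes> h) = (f \<boxtimes> (g \<boxtimes> h)) \<cdot> assoc C a b c"
    and lunit_hom: "lunit C a \<in> hom C (\<one> \<otimes> a) a"
    and lunit_iso: "is_iso C (lunit C a)"
    and lunit_natural: "f \<in> hom C a b \<Longrightarrow> lunit C b \<cdot> (idm C \<one> \<boxtimes> f) = f \<cdot> lunit C a"
    and runit_hom: "runit C a \<in> hom C (a \<otimes> \<one>) a"
    and runit_iso: "is_iso C (runit C a)"
    and runit_natural: "f \<in> hom C a b \<Longrightarrow> runit C b \<cdot> (f \<boxtimes> idm C \<one>) = f \<cdot> runit C a"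
    and pentagon: "assoc C a b (c \<otimes> d) \<cdot> assoc C (a \<otimes> b) c d
          = (idm C a \<boxtimes> assoc C b c d) \<cdot> assoc C a (b \<otimes> c) d \<cdot> (assoc C a b c \<boxtimes> idm C d)"
    and triangle: "(idm C a \<boxtimes> lunit C b) \<cdot> assoc C a \<one> b = runit C a \<boxtimes> idm C b"

locale linear_braided_category = linear_monoidal_category C
    for C :: "('o, 'm) ribbon_data" (structure) +
  assumes braid_hom: "braid C a b \<in> hom C (a \<otimes> b) (b \<otimes> a)"
    and braid_iso: "is_iso C (braid C a b)"
    and braid_natural: "\<lbrakk>f \<in> hom C a a'; g \<in> hom C b b'\<rbrakk>
          \<Longrightarrow> braid C a' b' \<cdot> (f \<boxtimes> g) = (g \<boxtimes> f) \<cdot> braid C a b"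
    and hexagon1: "assoc C b c a \<cdot> braid C a (b \<otimes> c) \<cdot> assoc C a b c
          = (idm C b \<boxtimes> braid C a c) \<cdot> assoc C b a c \<cdot> (braid C a b \<boxtimes> idm C c)"
    and hexagon2: "inv_arr C (assoc C c a b) \<cdot> braid C (a \<otimes> b) c \<cdot> inv_arr C (assoc C a b c)
          = (braid C a c \<boxtimes> idm C b) \<cdot> inv_arr C (assoc C a c b) \<cdot> (idm C a \<boxtimes> braid C b c)"

text \<open>The last two axioms are the standing conventions \<open>End(\<one>) = \<complex>\<close> and \<open>End(a) = \<complex>\<close> for
  simple \<open>a\<close>.\<close>

locale ribbon_category = linear_braided_category C
    for C :: "('o, 'm) ribbon_data" (structure) +
  assumes ev_hom: "ev C a \<in> hom C (dual C a \<otimes> a) \<one>"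
    and coev_hom: "coev C a \<in> hom C \<one> (a \<otimes> dual C a)"
    and zigzag1: "runit C a \<cdot> (idm C a \<boxtimes> ev C a) \<cdot> assoc C a (dual C a) a
          \<cdot> (coev C a \<boxtimes> idm C a) \<cdot> inv_arr C (lunit C a) = idm C a"
    and zigzag2: "lunit C (dual C a) \<cdot> (ev C a \<boxtimes> idm C (dual C a))
          \<cdot> inv_arr C (assoc C (dual C a) a (dual C a))
          \<cdot> (idm C (dual C a) \<boxtimes> coev C a) \<cdot> inv_arr C (runit C (dual C a)) = idm C (dual C a)"
    and twist_hom: "twist C a \<in> hom C a a"
    and twist_iso: "is_iso C (twist C a)"
    and twist_natural: "f \<in> hom C a b \<Longrightarrow> twist C b \<cdot> f = f \<cdot> twist C a"
    and twist_tensor: "twist C (a \<otimes> b) = braid C b a \<cdot> braid C a b \<cdot> (twist C a \<boxtimes> twist C b)"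
    and twist_dual: "(twist C a \<boxtimes> idm C (dual C a)) \<cdot> coev C a
          = (idm C a \<boxtimes> twist C (dual C a)) \<cdot> coev C a"
    and unit_endos: "scalar_endos C \<one>"
    and simple_endos: "simple C a \<Longrightarrow> scalar_endos C a"

text \<open>Semisimple: abelian, and every object is a finite direct sum of simple objects.\<close>

locale semisimple_ribbon_category = ribbon_category C
    for C :: "('o, 'm) ribbon_data" (structure) +
  assumes ex_zero_object: "\<exists>z. zero_object C z"
    and ex_biproduct: "\<exists>s. is_biproduct C s a b"
    and ex_kernel: "\<exists>k. is_kernel C k f"
    and ex_cokernel: "\<exists>q. is_cokernel C q f"
    and mono_normal: "is_mono C m \<Longrightarrow> \<exists>f. is_kernel C m f"
    and epi_normal: "is_epi C e \<Longrightarrow> \<exists>f. is_cokernel C e f"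
    and semisimple: "sum_of_simples C a"


section \<open>Oriented link diagrams\<close>

text \<open>
  An oriented tangle diagram in general position is read upwards as a stack of slices, each
  consisting of one elementary piece \<open>g\<close> between vertical strands \<open>u\<close> on its left and \<open>v\<close> on its
  right. A strand crossing a horizontal level is \<open>Fwd\<close> if it is oriented in the reading direction
  and \<open>Bwd\<close> otherwise.

  \<open>Cup s\<close> and \<open>Cap s\<close> are a minimum and a maximum whose left leg is oriented as \<open>s\<close>.
  \<open>Cross True s t\<close> is a crossing entered at the bottom by strands oriented \<open>s\<close> (left) and \<open>t\<close>
  (right), in which the strand running from bottom left to top right passes over the other one;
  in \<open>Cross False s t\<close> it passes under. With both strands oriented in the same direction the
  former is a positive crossing, and reversing one strand changes the sign.

  A link is represented by an arbitrary closed diagram. As a framed link it carries the blackboard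
  framing, whose total framing number (including linking) is the writhe of the diagram.
\<close>

datatype orient = Fwd | Bwd

fun flip :: "orient \<Rightarrow> orient" where
  "flip Fwd = Bwd"
| "flip Bwd = Fwd"

datatype piece = Cup orient | Cap orient | Cross bool orient orient

fun bottom_word :: "piece \<Rightarrow> orient list" where
  "bottom_word (Cup s) = []"
| "bottom_word (Cap s) = [s, flip s]"
| "bottom_word (Cross over s t) = [s, t]"

fun top_word :: "piece \<Rightarrow> orient list" where
  "top_word (Cup s) = [s, flip s]"
| "top_word (Cap s) = []"
| "top_word (Cross over s t) = [t, s]"

type_synonym slice = "orient list \<times> piece \<times> orient list"

fun slice_bottom :: "slice \<Rightarrow> orient list" where
  "slice_bottom (u, g, v) = u @ bottom_word g @ v"

fun slice_top :: "slice \<Rightarrow> orient list" where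
  "slice_top (u, g, v) = u @ top_word g @ v"

fun tangle_diagram :: "orient list \<Rightarrow> slice list \<Rightarrow> orient list \<Rightarrow> bool" where
  "tangle_diagram w [] w' \<longleftrightarrow> w = w'"
| "tangle_diagram w (x # xs) w' \<longleftrightarrow> slice_bottom x = w \<and> tangle_diagram (slice_top x) xs w'"

definition link_diagram :: "slice list \<Rightarrow> bool" where
  "link_diagram L \<longleftrightarrow> tangle_diagram [] L []"

fun crossing_sign :: "piece \<Rightarrow> int" where
  "crossing_sign (Cross over s t) = (if over = (s = t) then 1 else -1)"
| "crossing_sign _ = 0"

definition writhe :: "slice list \<Rightarrow> int" where
  "writhe L = (\<Sum>(u, g, v) \<leftarrow> L. crossing_sign g)"

text \<open>
  \<open>(i, k)\<close> is the \<open>k\<close>-th point, counted from the left, of the link on the level below slice \<open>i\<close>.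
  The arcs inside the slices join these points; a component of the link is a class of points
  connected by arcs. (Every closed component passes through at least one of these levels.)
\<close>

definition points :: "slice list \<Rightarrow> (nat \<times> nat) set" where
  "points L = {(i, k). i < length L \<and> k < length (slice_bottom (L ! i))}"

fun piece_arcs :: "nat \<Rightarrow> nat \<Rightarrow> piece \<Rightarrow> ((nat \<times> nat) \<times> (nat \<times> nat)) set" where
  "piece_arcs i k (Cup s) = {((Suc i, k), (Suc i, Suc k))}"
| "piece_arcs i k (Cap s) = {((i, k), (i, Suc k))}"
| "piece_arcs i k (Cross over s t) = {((i, k), (Suc i, Suc k)), ((i, Suc k), (Suc i, k))}"

fun slice_arcs :: "nat \<Rightarrow> slice \<Rightarrow> ((nat \<times> nat) \<times> (nat \<times> nat)) set" where
  "slice_arcs i (u, g, v) =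
     {((i, k), (Suc i, k)) | k. k < length u}
     \<union> piece_arcs i (length u) g
     \<union> {((i, length u + length (bottom_word g) + k), (Suc i, length u + length (top_word g) + k)) | k.
          k < length v}"

definition arcs :: "slice list \<Rightarrow> ((nat \<times> nat) \<times> (nat \<times> nat)) set" where
  "arcs L = (\<Union>i < length L. slice_arcs i (L ! i))"

definition num_components :: "slice list \<Rightarrow> nat" where
  "num_components L = card (points L // (arcs L \<union> (arcs L)\<inverse>)\<^sup>*)"


section \<open>The Reshetikhin--Turaev invariant\<close>

context
  fixes C :: "('o, 'm) ribbon_data" (structure)
begin

text \<open>The evaluation and coevaluation exhibiting the dual as a dual on the other side.\<close>

definition ev' :: "'o \<Rightarrow> 'm" where
  "ev' V = ev C V \<cdot> braid C V (dual C V) \<cdot> (twist C V \<boxtimes> idm C (dual C V))"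

definition coev' :: "'o \<Rightarrow> 'm" where
  "coev' V = (idm C (dual C V) \<boxtimes> twist C V) \<cdot> braid C V (dual C V) \<cdot> coev C V"

definition qdim :: "'o \<Rightarrow> complex" where
  "qdim V = scalar_of C \<one> (ev' V \<cdot> coev C V)"

definition twist_factor :: "'o \<Rightarrow> complex" where
  "twist_factor V = scalar_of C V (twist C V)"

fun label :: "'o \<Rightarrow> orient \<Rightarrow> 'o" where
  "label V Fwd = V"
| "label V Bwd = dual C V"

text \<open>A word of orientations is sent to the tensor product of its labels, bracketed to the right
  and ending in the unit object.\<close>

fun word_obj :: "'o \<Rightarrow> orient list \<Rightarrow> 'o" where
  "word_obj V [] = \<one>"
| "word_obj V (s # w) = label V s \<otimes> word_obj V w"

fun cup_arr :: "'o \<Rightarrow> orient \<Rightarrow> 'm" where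
  "cup_arr V Fwd = coev C V"
| "cup_arr V Bwd = coev' V"

fun cap_arr :: "'o \<Rightarrow> orient \<Rightarrow> 'm" where
  "cap_arr V Fwd = ev' V"
| "cap_arr V Bwd = ev C V"

definition cross_arr :: "'o \<Rightarrow> bool \<Rightarrow> orient \<Rightarrow> orient \<Rightarrow> 'm" where
  "cross_arr V over s t = (if over then braid C (label V s) (label V t)
                           else inv_arr C (braid C (label V t) (label V s)))"

text \<open>\<open>piece_arr V g v\<close> is the arrow of the piece \<open>g\<close> tensored with the identity of the strands \<open>v\<close>
  on its right, reassociated to fit the bracketing of \<open>word_obj\<close>.\<close>

fun piece_arr :: "'o \<Rightarrow> piece \<Rightarrow> orient list \<Rightarrow> 'm" where
  "piece_arr V (Cup s) v =
     assoc C (label V s) (label V (flip s)) (word_obj V v)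
     \<cdot> (cup_arr V s \<boxtimes> idm C (word_obj V v)) \<cdot> inv_arr C (lunit C (word_obj V v))"
| "piece_arr V (Cap s) v =
     lunit C (word_obj V v) \<cdot> (cap_arr V s \<boxtimes> idm C (word_obj V v))
     \<cdot> inv_arr C (assoc C (label V s) (label V (flip s)) (word_obj V v))"
| "piece_arr V (Cross over s t) v =
     assoc C (label V t) (label V s) (word_obj V v)
     \<cdot> (cross_arr V over s t \<boxtimes> idm C (word_obj V v))
     \<cdot> inv_arr C (assoc C (label V s) (label V t) (word_obj V v))"

fun slice_arr :: "'o \<Rightarrow> slice \<Rightarrow> 'm" where
  "slice_arr V ([], g, v) = piece_arr V g v"
| "slice_arr V (s # u, g, v) = idm C (label V s) \<boxtimes> slice_arr V (u, g, v)"

fun tangle_arr :: "'o \<Rightarrow> orient list \<Rightarrow> slice list \<Rightarrow> 'm" where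
  "tangle_arr V w [] = idm C (word_obj V w)"
| "tangle_arr V w (x # xs) = tangle_arr V (slice_top x) xs \<cdot> slice_arr V x"

definition RT_framed :: "'o \<Rightarrow> slice list \<Rightarrow> complex" where
  "RT_framed V L = scalar_of C \<one> (tangle_arr V [] L)"

definition RT_invariant :: "'o \<Rightarrow> slice list \<Rightarrow> complex" where
  "RT_invariant V L = twist_factor V powi (- writhe L) * RT_framed V L"

end

end

theory Submission
  imports Defs
begin

text \<open>
  Strands coloured by \<open>A \<otimes> X\<close> are doubled into a strand coloured by \<open>A\<close> and one coloured by \<open>X\<close>.
  Since \<open>End(A \<otimes> X) = \<complex>\<close>, the double braiding of \<open>A\<close> and \<open>X\<close> is a scalar \<open>\<mu>\<close>, and lifting the \<open>X\<close>-cable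
  off the \<open>A\<close>-cable costs \<open>\<mu>\<close> to the writhe; \<open>\<theta>(A \<otimes> X) = \<mu> \<theta>(A) \<theta>(X)\<close> absorbs this factor. Likewise
  \<open>X \<otimes> X\<close> has only scalar endomorphisms, its braiding is \<open>\<theta>(X) / dim X\<close> with \<open>(dim X)\<^sup>2 = 1\<close>, and reducing
  every word in \<open>X\<close> and its dual to a power of \<open>X\<close> evaluates the invariant as \<open>dim X\<close> to the number of
  crossings and of caps and cups involving the twist. That number has the parity of the number of
  components: both compute the sign of the permutation sending each point of the diagram to the next
  one along the link.

  The category is replaced by a strict one whose objects are words and whose arrows
  \<open>u \<rightarrow> v\<close> are the arrows between the tensor products of \<open>u\<close> and \<open>v\<close>, bracketed to the right.
\<close>

section \<open>Monoidal categories\<close>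

text \<open>What shapes the comparison with the doubled strand is the dual:
  \<open>dual C (A \<otimes> X)\<close> is a chosen object with no prescribed relation to the duals
  of \<open>A\<close> and \<open>X\<close>, so the comparison on downward strands has to be
  constructed. Upward and downward strands are doubled in the same left-to-right order; therefore
  the cups and caps of the doubled strand contain a mixed crossing. In all mixed crossings that are
  introduced, \<open>X\<close> passes over \<open>A\<close>. A crossing of doubled strands contains
  two mixed crossings: one already has \<open>X\<close> above, and correcting the other costs a
  double braiding. This is the origin of \<open>\<mu>\<close> to the power of the sign.

  For \<open>X\<close> alone, the exponent of \<open>dim X\<close> has the parity of the number of
  crossings plus the rotation number of the diagram. Whitney's congruence for plane curves relates
  this to the number of components. The sign of a permutation replaces the topology, because its
  inversions, in suitable orders, are sums over slices.\<close>

lemma hom_iff: "f \<in> hom C a b \<longleftrightarrow> src C f = a \<and> tgt C f = b"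
  by (simp add: hom_def)

context linear_category
begin

lemma idm_ends [simp]: "src C (idm C a) = a" "tgt C (idm C a) = a"
  using id_hom[of a] by (simp_all add: hom_iff)

lemma comp_ends [simp]:
  assumes "src C g = tgt C f"
  shows "src C (g \<cdot> f) = src C f" "tgt C (g \<cdot> f) = tgt C g"
  using comp_hom[of f "src C f" "tgt C f" g "tgt C g"] assms by (simp_all add: hom_iff)

lemma scale_ends [simp]: "src C (x \<odot> f) = src C f" "tgt C (x \<odot> f) = tgt C f"
  using scale_hom[of f "src C f" "tgt C f" x] by (simp_all add: hom_iff)

lemma idm_comp [simp]: "tgt C f = b \<Longrightarrow> idm C b \<cdot> f = f"
  using id_comp[of f "src C f" b] by (simp add: hom_iff)

lemma comp_idm [simp]: "src C f = a \<Longrightarrow> f \<cdot> idm C a = f"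
  using comp_id[of f a "tgt C f"] by (simp add: hom_iff)

lemma comp_assoc_ends:
  "src C g = tgt C f \<Longrightarrow> src C h = tgt C g \<Longrightarrow> (h \<cdot> g) \<cdot> f = h \<cdot> (g \<cdot> f)"
  using comp_assoc[of f "src C f" "tgt C f" g "tgt C g" h "tgt C h"] by (simp add: hom_iff)

lemma scale_comp [simp]:
  assumes "src C g = tgt C f"
  shows "(x \<odot> g) \<cdot> f = x \<odot> (g \<cdot> f)" "g \<cdot> (x \<odot> f) = x \<odot> (g \<cdot> f)"
  using comp_scale_left[of f "src C f" "tgt C f" g "tgt C g"]
    comp_scale_right[of f "src C f" "tgt C f" g "tgt C g"] assms by (simp_all add: hom_iff)

lemma scale_simps [simp]: "x \<odot> y \<odot> f = (x * y) \<odot> f" "1 \<odot> f = f"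
  using scale_scale[of f "src C f" "tgt C f"] one_scale[of f "src C f" "tgt C f"]
  by (simp_all add: hom_iff)

lemma inverse_arrows_unique:
  assumes "inverse_arrows C f g" "inverse_arrows C f h"
  shows "g = h"
proof -
  have "g = g \<cdot> (f \<cdot> h)" using assms by (simp add: inverse_arrows_def hom_iff)
  also have "\<dots> = (g \<cdot> f) \<cdot> h"
    using assms by (subst comp_assoc_ends) (simp_all add: inverse_arrows_def hom_iff)
  also have "\<dots> = h" using assms by (simp add: inverse_arrows_def hom_iff)
  finally show ?thesis .
qed

lemma inv_arr_eqI: "inverse_arrows C f g \<Longrightarrow> inv_arr C f = g"
  unfolding inv_arr_def by (rule the_equality) (use inverse_arrows_unique in blast)+

lemma inverse_arrows_inv: "is_iso C f \<Longrightarrow> inverse_arrows C f (inv_arr C f)"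
  by (metis inv_arr_eqI is_iso_def)

lemma inv_arr_simps [simp]:
  assumes "is_iso C f"
  shows "src C (inv_arr C f) = tgt C f" "tgt C (inv_arr C f) = src C f"
    "inv_arr C f \<cdot> f = idm C (src C f)" "f \<cdot> inv_arr C f = idm C (tgt C f)"
  using inverse_arrows_inv[OF assms] by (simp_all add: inverse_arrows_def hom_iff)

lemma inv_arr_cancel [simp]:
  assumes "is_iso C f"
  shows "src C f = tgt C h \<Longrightarrow> inv_arr C f \<cdot> (f \<cdot> h) = h"
    "tgt C f = tgt C h \<Longrightarrow> f \<cdot> (inv_arr C f \<cdot> h) = h"
  using assms comp_assoc_ends[of f h "inv_arr C f"] comp_assoc_ends[of "inv_arr C f" h f] by simp_all

lemma is_isoI:
  "src C g = tgt C f \<Longrightarrow> tgt C g = src C f \<Longrightarrow> g \<cdot> f = idm C (src C f)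
    \<Longrightarrow> f \<cdot> g = idm C (tgt C f) \<Longrightarrow> is_iso C f"
  unfolding is_iso_def inverse_arrows_def hom_iff by auto

lemma is_iso_idm [simp]: "is_iso C (idm C a)"
  by (rule is_isoI[of "idm C a"]) simp_all

lemma is_iso_comp [simp]:
  assumes "is_iso C f" "is_iso C g" "src C g = tgt C f"
  shows "is_iso C (g \<cdot> f)"
  by (rule is_isoI[of "inv_arr C f \<cdot> inv_arr C g"]) (simp_all add: assms comp_assoc_ends)

lemma is_iso_inv [simp]: "is_iso C f \<Longrightarrow> is_iso C (inv_arr C f)"
  by (rule is_isoI[of f]) simp_all

lemma inv_arr_comp:
  assumes "is_iso C f" "is_iso C g" "src C g = tgt C f"
  shows "inv_arr C (g \<cdot> f) = inv_arr C f \<cdot> inv_arr C g"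
  by (rule inv_arr_eqI) (simp add: assms comp_assoc_ends inverse_arrows_def hom_iff)

lemma inv_arr_idm [simp]: "inv_arr C (idm C a) = idm C a"
  by (rule inv_arr_eqI) (simp add: inverse_arrows_def hom_iff)

lemma inv_arr_inv [simp]: "is_iso C f \<Longrightarrow> inv_arr C (inv_arr C f) = f"
  by (rule inv_arr_eqI) (simp add: inverse_arrows_def hom_iff)

lemma iso_cancel_right:
  assumes "is_iso C f" "g \<cdot> f = h \<cdot> f" "src C g = tgt C f" "src C h = tgt C f"
  shows "g = h"
proof -
  have "(g \<cdot> f) \<cdot> inv_arr C f = (h \<cdot> f) \<cdot> inv_arr C f" by (simp only: assms)
  then show ?thesis using assms(1,3,4) by (simp add: comp_assoc_ends)
qed

lemma iso_cancel_left:
  assumes "is_iso C f" "f \<cdot> g = f \<cdot> h" "src C f = tgt C g" "src C f = tgt C h"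
  shows "g = h"
  using assms by (metis inv_arr_cancel(1))

end

section \<open>Tensor products of arrows and the unit constraints\<close>

context linear_monoidal_category
begin

lemma tensor_ends [simp]:
  "src C (f \<boxtimes> g) = src C f \<otimes> src C g" "tgt C (f \<boxtimes> g) = tgt C f \<otimes> tgt C g"
  using tensor_hom[of f "src C f" "tgt C f" g "src C g" "tgt C g"] by (simp_all add: hom_iff)

lemma assoc_ends [simp]:
  "src C (assoc C a b c) = (a \<otimes> b) \<otimes> c" "tgt C (assoc C a b c) = a \<otimes> b \<otimes> c"
  "src C (lunit C a) = \<one> \<otimes> a" "tgt C (lunit C a) = a"
  "src C (runit C a) = a \<otimes> \<one>" "tgt C (runit C a) = a"
  using assoc_hom[of a b c] lunit_hom[of a] runit_hom[of a] by (simp_all add: hom_iff)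

declare assoc_iso [simp] lunit_iso [simp] runit_iso [simp] tensor_id [simp]

lemma interchange_ends:
  "src C f' = tgt C f \<Longrightarrow> src C g' = tgt C g \<Longrightarrow> (f' \<boxtimes> g') \<cdot> (f \<boxtimes> g) = (f' \<cdot> f) \<boxtimes> (g' \<cdot> g)"
  using interchange[of f "src C f" "tgt C f" f' "tgt C f'" g "src C g" "tgt C g" g' "tgt C g'"]
  by (simp add: hom_iff)

lemma scale_tensor [simp]:
  "(x \<odot> f) \<boxtimes> g = x \<odot> (f \<boxtimes> g)" "f \<boxtimes> (x \<odot> g) = x \<odot> (f \<boxtimes> g)"
  using tensor_scale_left[of f "src C f" "tgt C f" g "src C g" "tgt C g"]
    tensor_scale_right[of f "src C f" "tgt C f" g "src C g" "tgt C g"]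
  by (simp_all add: hom_iff)

lemma is_iso_tensor [simp]:
  "is_iso C f \<Longrightarrow> is_iso C g \<Longrightarrow> is_iso C (f \<boxtimes> g)"
  by (rule is_isoI[of "inv_arr C f \<boxtimes> inv_arr C g"]) (simp_all add: interchange_ends)

lemma inv_arr_tensor:
  "is_iso C f \<Longrightarrow> is_iso C g \<Longrightarrow> inv_arr C (f \<boxtimes> g) = inv_arr C f \<boxtimes> inv_arr C g"
  by (rule inv_arr_eqI) (simp add: interchange_ends inverse_arrows_def hom_iff)

lemma assoc_nat: "assoc C (tgt C f) (tgt C g) (tgt C h) \<cdot> ((f \<boxtimes> g) \<boxtimes> h)
    = (f \<boxtimes> (g \<boxtimes> h)) \<cdot> assoc C (src C f) (src C g) (src C h)"
  by (rule assoc_natural) (simp_all add: hom_iff)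

lemma lunit_nat: "lunit C (tgt C f) \<cdot> (idm C \<one> \<boxtimes> f) = f \<cdot> lunit C (src C f)"
  by (rule lunit_natural) (simp_all add: hom_iff)

lemma runit_nat: "runit C (tgt C f) \<cdot> (f \<boxtimes> idm C \<one>) = f \<cdot> runit C (src C f)"
  by (rule runit_natural) (simp_all add: hom_iff)

text \<open>Naturality of \<open>lunit\<close> conjugates \<open>idm C \<one> \<boxtimes> f\<close>
  into \<open>f\<close>. Identities between unit constraints can thus be proved after adding a unit,
  where pentagon and triangle apply.\<close>

lemma unit_tensor_cancel:
  assumes "idm C \<one> \<boxtimes> f = idm C \<one> \<boxtimes> g"
    and "src C f = src C g" "tgt C f = tgt C g"
  shows "f = g"
  by (rule iso_cancel_right[of "lunit C (src C f)"])
     (use assms lunit_nat[of f] lunit_nat[of g] in simp_all)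

lemma tensor_unit_cancel:
  assumes "f \<boxtimes> idm C \<one> = g \<boxtimes> idm C \<one>"
    and "src C f = src C g" "tgt C f = tgt C g"
  shows "f = g"
  by (rule iso_cancel_right[of "runit C (src C f)"])
     (use assms runit_nat[of f] runit_nat[of g] in simp_all)

text \<open>Kelly's argument: with one more unit on the left, the pentagon for
  \<open>\<one>, \<one>, a, b\<close> reduces the claim to two instances of \<open>triangle\<close>;
  \<open>?i\<close> is the invertible arrow to be cancelled.\<close>

lemma lunit_tensor: "lunit C (a \<otimes> b) \<cdot> assoc C \<one> a b = lunit C a \<boxtimes> idm C b"
proof -
  let ?i = "assoc C \<one> (\<one> \<otimes> a) b \<cdot> (assoc C \<one> \<one> a \<boxtimes> idm C b)"
  have "(idm C \<one> \<boxtimes> (lunit C (a \<otimes> b) \<cdot> assoc C \<one> a b)) \<cdot> ?i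
      = (idm C \<one> \<boxtimes> lunit C (a \<otimes> b)) \<cdot> (idm C \<one> \<boxtimes> assoc C \<one> a b) \<cdot> ?i"
    by (subst comp_assoc_ends[symmetric]) (simp_all add: interchange_ends)
  also have "\<dots> = ((idm C \<one> \<boxtimes> lunit C (a \<otimes> b)) \<cdot> assoc C \<one> \<one> (a \<otimes> b)) \<cdot> assoc C (\<one> \<otimes> \<one>) a b"
    by (simp add: pentagon[symmetric] comp_assoc_ends)
  also have "\<dots> = assoc C \<one> a b \<cdot> ((runit C \<one> \<boxtimes> idm C a) \<boxtimes> idm C b)"
    using assoc_nat[of "runit C \<one>" "idm C a" "idm C b"] by (simp add: triangle)
  also have "\<dots> = assoc C \<one> a b \<cdot> ((idm C \<one> \<boxtimes> lunit C a) \<boxtimes> idm C b) \<cdot> (assoc C \<one> \<one> a \<boxtimes> idm C b)"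
    by (simp add: interchange_ends triangle)
  also have "\<dots> = (assoc C \<one> a b \<cdot> ((idm C \<one> \<boxtimes> lunit C a) \<boxtimes> idm C b)) \<cdot> (assoc C \<one> \<one> a \<boxtimes> idm C b)"
    by (simp add: comp_assoc_ends)
  also have "\<dots> = (idm C \<one> \<boxtimes> (lunit C a \<boxtimes> idm C b)) \<cdot> ?i"
    using assoc_nat[of "idm C \<one>" "lunit C a" "idm C b"] by (simp add: comp_assoc_ends)
  finally have "idm C \<one> \<boxtimes> (lunit C (a \<otimes> b) \<cdot> assoc C \<one> a b) = idm C \<one> \<boxtimes> (lunit C a \<boxtimes> idm C b)"
    by (rule iso_cancel_right[rotated]) simp_all
  then show ?thesis by (rule unit_tensor_cancel) simp_all
qed

text \<open>The mirror image, from the pentagon for \<open>a, b, \<one>, \<one>\<close>.\<close>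

lemma runit_tensor: "(idm C a \<boxtimes> runit C b) \<cdot> assoc C a b \<one> = runit C (a \<otimes> b)"
proof -
  let ?i = "assoc C a (b \<otimes> \<one>) \<one> \<cdot> (assoc C a b \<one> \<boxtimes> idm C \<one>)"
  have "assoc C a b \<one> \<cdot> (runit C (a \<otimes> b) \<boxtimes> idm C \<one>)
      = (assoc C a b \<one> \<cdot> ((idm C a \<boxtimes> idm C b) \<boxtimes> lunit C \<one>)) \<cdot> assoc C (a \<otimes> b) \<one> \<one>"
    by (simp add: triangle[symmetric] comp_assoc_ends)
  also have "\<dots> = (idm C a \<boxtimes> (idm C b \<boxtimes> lunit C \<one>)) \<cdot> assoc C a b (\<one> \<otimes> \<one>) \<cdot> assoc C (a \<otimes> b) \<one> \<one>"
    using assoc_nat[of "idm C a" "idm C b" "lunit C \<one>"] by (simp add: comp_assoc_ends)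
  also have "\<dots> = ((idm C a \<boxtimes> (idm C b \<boxtimes> lunit C \<one>)) \<cdot> (idm C a \<boxtimes> assoc C b \<one> \<one>)) \<cdot> ?i"
    by (simp add: pentagon comp_assoc_ends)
  also have "\<dots> = (idm C a \<boxtimes> (runit C b \<boxtimes> idm C \<one>)) \<cdot> ?i"
    by (simp add: interchange_ends triangle)
  also have "\<dots> = ((idm C a \<boxtimes> (runit C b \<boxtimes> idm C \<one>)) \<cdot> assoc C a (b \<otimes> \<one>) \<one>) \<cdot> (assoc C a b \<one> \<boxtimes> idm C \<one>)"
    by (simp add: comp_assoc_ends)
  also have "\<dots> = assoc C a b \<one> \<cdot> (((idm C a \<boxtimes> runit C b) \<cdot> assoc C a b \<one>) \<boxtimes> idm C \<one>)"
    using assoc_nat[of "idm C a" "runit C b" "idm C \<one>", symmetric]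
    by (simp add: comp_assoc_ends interchange_ends)
  finally have "runit C (a \<otimes> b) \<boxtimes> idm C \<one> = ((idm C a \<boxtimes> runit C b) \<cdot> assoc C a b \<one>) \<boxtimes> idm C \<one>"
    by (rule iso_cancel_left[rotated]) simp_all
  then show ?thesis by (rule tensor_unit_cancel[symmetric]) simp_all
qed

lemma lunit_unit: "lunit C \<one> = runit C \<one>"
proof -
  have "runit C \<one> \<boxtimes> idm C \<one> = runit C (\<one> \<otimes> \<one>)"
    by (rule iso_cancel_left[of "runit C \<one>", OF runit_iso]) (use runit_nat[of "runit C \<one>"] in simp_all)
  then have "(idm C \<one> \<boxtimes> lunit C \<one>) \<cdot> assoc C \<one> \<one> \<one> = (idm C \<one> \<boxtimes> runit C \<one>) \<cdot> assoc C \<one> \<one> \<one>"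
    by (simp add: triangle runit_tensor)
  then have "idm C \<one> \<boxtimes> lunit C \<one> = idm C \<one> \<boxtimes> runit C \<one>"
    by (rule iso_cancel_right[rotated]) simp_all
  then show ?thesis by (rule unit_tensor_cancel) simp_all
qed

end

section \<open>Strictification\<close>

text \<open>An atom may itself be a tensor product: \<open>BAtom (a \<otimes> b)\<close> and
  \<open>BTensor (BAtom a) (BAtom b)\<close> denote the same object but flatten to words of
  different length. This is how a strand coloured by \<open>A \<otimes> X\<close> is told from its
  doubling.\<close>

datatype 'o bracketing = BUnit | BAtom 'o | BTensor "'o bracketing" "'o bracketing"

fun flat :: "'o bracketing \<Rightarrow> 'o list" where
  "flat BUnit = []"
| "flat (BAtom a) = [a]"
| "flat (BTensor S T) = flat S @ flat T"

fun word_bracketing :: "'o list \<Rightarrow> 'o bracketing" where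
  "word_bracketing [] = BUnit"
| "word_bracketing (a # w) = BTensor (BAtom a) (word_bracketing w)"

lemma flat_word_bracketing [simp]: "flat (word_bracketing w) = w"
  by (induction w) auto

section \<open>The strict category of words\<close>

context linear_monoidal_category
begin

fun list_obj :: "'o list \<Rightarrow> 'o" where
  "list_obj [] = \<one>"
| "list_obj (a # w) = a \<otimes> list_obj w"

fun glue :: "'o list \<Rightarrow> 'o list \<Rightarrow> 'm" where
  "glue [] v = lunit C (list_obj v)"
| "glue (a # u) v = (idm C a \<boxtimes> glue u v) \<cdot> assoc C a (list_obj u) (list_obj v)"

lemma glue_ends [simp]:
  "src C (glue u v) = list_obj u \<otimes> list_obj v" "tgt C (glue u v) = list_obj (u @ v)"
  by (induction u) auto

lemma glue_iso [simp]: "is_iso C (glue u v)"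
  by (induction u) auto

lemma glue_nil: "glue u [] = runit C (list_obj u)"
  by (induction u) (auto simp: lunit_unit runit_tensor)

text \<open>Peeling off the first letter is an instance of the pentagon, and the empty word is
  \<open>lunit_tensor\<close>. This makes \<open>s_tns\<close> associative on the nose.\<close>

lemma glue_assoc: "glue (u @ v) w \<cdot> (glue u v \<boxtimes> idm C (list_obj w))
    = glue u (v @ w) \<cdot> (idm C (list_obj u) \<boxtimes> glue v w) \<cdot> assoc C (list_obj u) (list_obj v) (list_obj w)"
proof (induction u)
  case Nil
  show ?case
    using lunit_nat[of "glue v w"]
    by (simp add: lunit_tensor[symmetric] comp_assoc_ends[symmetric])
next
  case (Cons a u)
  let ?u = "list_obj u" and ?v = "list_obj v" and ?w = "list_obj w"
  let ?k = "assoc C a (?u \<otimes> ?v) ?w \<cdot> (assoc C a ?u ?v \<boxtimes> idm C ?w)"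
  have "glue ((a # u) @ v) w \<cdot> (glue (a # u) v \<boxtimes> idm C ?w)
      = (idm C a \<boxtimes> glue (u @ v) w) \<cdot> assoc C a (list_obj (u @ v)) ?w
        \<cdot> ((idm C a \<boxtimes> glue u v) \<boxtimes> idm C ?w) \<cdot> (assoc C a ?u ?v \<boxtimes> idm C ?w)"
    by (simp add: interchange_ends comp_assoc_ends)
  also have "\<dots> = (idm C a \<boxtimes> glue (u @ v) w) \<cdot> (assoc C a (list_obj (u @ v)) ?w
        \<cdot> ((idm C a \<boxtimes> glue u v) \<boxtimes> idm C ?w)) \<cdot> (assoc C a ?u ?v \<boxtimes> idm C ?w)"
    by (simp add: comp_assoc_ends)
  also have "\<dots> = ((idm C a \<boxtimes> glue (u @ v) w) \<cdot> (idm C a \<boxtimes> (glue u v \<boxtimes> idm C ?w))) \<cdot> ?k"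
    using assoc_nat[of "idm C a" "glue u v" "idm C ?w"] by (simp add: comp_assoc_ends)
  also have "\<dots> = (idm C a \<boxtimes> (glue u (v @ w) \<cdot> (idm C ?u \<boxtimes> glue v w) \<cdot> assoc C ?u ?v ?w)) \<cdot> ?k"
    by (simp add: interchange_ends Cons.IH)
  also have "\<dots> = (idm C a \<boxtimes> glue u (v @ w)) \<cdot> (idm C a \<boxtimes> (idm C ?u \<boxtimes> glue v w))
        \<cdot> (idm C a \<boxtimes> assoc C ?u ?v ?w) \<cdot> ?k"
    by (simp add: interchange_ends comp_assoc_ends[symmetric])
  also have "\<dots> = (idm C a \<boxtimes> glue u (v @ w)) \<cdot> ((idm C a \<boxtimes> (idm C ?u \<boxtimes> glue v w))
        \<cdot> assoc C a ?u (?v \<otimes> ?w)) \<cdot> assoc C (a \<otimes> ?u) ?v ?w"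
    by (simp add: pentagon[symmetric] comp_assoc_ends)
  also have "\<dots> = (idm C a \<boxtimes> glue u (v @ w)) \<cdot> (assoc C a ?u (list_obj (v @ w))
        \<cdot> (idm C (a \<otimes> ?u) \<boxtimes> glue v w)) \<cdot> assoc C (a \<otimes> ?u) ?v ?w"
    using assoc_nat[of "idm C a" "idm C ?u" "glue v w"] by simp
  also have "\<dots> = glue (a # u) (v @ w) \<cdot> (idm C (list_obj (a # u)) \<boxtimes> glue v w)
        \<cdot> assoc C (list_obj (a # u)) ?v ?w"
    by (simp add: comp_assoc_ends)
  finally show ?case .
qed

text \<open>The words are stored beside the arrow, since different words can have the same tensor
  product and are not determined by \<open>src\<close> and \<open>tgt\<close>.\<close>

definition s_arr :: "'o list \<times> 'm \<times> 'o list \<Rightarrow> bool" where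
  "s_arr t \<longleftrightarrow> src C (fst (snd t)) = list_obj (fst t) \<and> tgt C (fst (snd t)) = list_obj (snd (snd t))"

definition s_dm :: "'o list \<times> 'm \<times> 'o list \<Rightarrow> 'o list" where "s_dm t = fst t"
definition s_cd :: "'o list \<times> 'm \<times> 'o list \<Rightarrow> 'o list" where "s_cd t = snd (snd t)"

definition s_one :: "'o list \<Rightarrow> 'o list \<times> 'm \<times> 'o list" where
  "s_one u = (u, idm C (list_obj u), u)"

definition s_cmp :: "'o list \<times> 'm \<times> 'o list \<Rightarrow> 'o list \<times> 'm \<times> 'o list \<Rightarrow> 'o list \<times> 'm \<times> 'o list" where
  "s_cmp t s = (fst s, fst (snd t) \<cdot> fst (snd s), snd (snd t))"

definition s_tns :: "'o list \<times> 'm \<times> 'o list \<Rightarrow> 'o list \<times> 'm \<times> 'o list \<Rightarrow> 'o list \<times> 'm \<times> 'o list" where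
  "s_tns t s = (fst t @ fst s,
     glue (snd (snd t)) (snd (snd s)) \<cdot> (fst (snd t) \<boxtimes> fst (snd s)) \<cdot> inv_arr C (glue (fst t) (fst s)),
     snd (snd t) @ snd (snd s))"

definition s_sc :: "complex \<Rightarrow> 'o list \<times> 'm \<times> 'o list \<Rightarrow> 'o list \<times> 'm \<times> 'o list" where
  "s_sc c t = (fst t, c \<odot> fst (snd t), snd (snd t))"

lemmas s_defs = s_arr_def s_dm_def s_cd_def s_one_def s_cmp_def s_tns_def s_sc_def

lemma tensor_comp_assoc: "src C f' = tgt C f \<Longrightarrow> src C g' = tgt C g \<Longrightarrow> tgt C h = src C f \<otimes> src C g
   \<Longrightarrow> (f' \<boxtimes> g') \<cdot> (f \<boxtimes> g) \<cdot> h = ((f' \<cdot> f) \<boxtimes> (g' \<cdot> g)) \<cdot> h"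
  by (simp add: comp_assoc_ends[symmetric] interchange_ends)

lemma s_interchange: "s_arr f \<Longrightarrow> s_arr g \<Longrightarrow> s_arr f' \<Longrightarrow> s_arr g' \<Longrightarrow> s_dm f' = s_cd f \<Longrightarrow> s_dm g' = s_cd g
   \<Longrightarrow> s_cmp (s_tns f' g') (s_tns f g) = s_tns (s_cmp f' f) (s_cmp g' g)"
  by (simp add: s_defs comp_assoc_ends tensor_comp_assoc)

lemma s_tns_one: "s_tns (s_one u) (s_one v) = s_one (u @ v)"
  by (simp add: s_defs)

lemma s_nil_tns: "s_arr f \<Longrightarrow> s_tns (s_one []) f = f"
  using lunit_nat[of "fst (snd f)"]
  by (simp add: s_defs comp_assoc_ends[symmetric]) (simp add: comp_assoc_ends prod_eq_iff)

lemma s_tns_nil: "s_arr f \<Longrightarrow> s_tns f (s_one []) = f"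
  using runit_nat[of "fst (snd f)"]
  by (simp add: s_defs comp_assoc_ends[symmetric] glue_nil) (simp add: comp_assoc_ends prod_eq_iff)

text \<open>After precomposition with \<open>?j\<close>, both sides reduce to naturality of the
  associator between two instances of \<open>glue_assoc\<close>.\<close>

lemma glue_conjugate_assoc:
  assumes "src C f = list_obj u" "tgt C f = list_obj u'" "src C g = list_obj v" "tgt C g = list_obj v'"
    "src C h = list_obj w" "tgt C h = list_obj w'"
  shows "glue (u' @ v') w' \<cdot> ((glue u' v' \<cdot> (f \<boxtimes> g) \<cdot> inv_arr C (glue u v)) \<boxtimes> h) \<cdot> inv_arr C (glue (u @ v) w)
     = glue u' (v' @ w') \<cdot> (f \<boxtimes> (glue v' w' \<cdot> (g \<boxtimes> h) \<cdot> inv_arr C (glue v w))) \<cdot> inv_arr C (glue u (v @ w))"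
    (is "?l = ?r")
proof (rule iso_cancel_right)
  let ?j = "glue (u @ v) w \<cdot> (glue u v \<boxtimes> idm C (list_obj w))"
  show "is_iso C ?j" by simp
  have "?l \<cdot> ?j = (glue (u' @ v') w' \<cdot> (glue u' v' \<boxtimes> idm C (list_obj w'))) \<cdot> ((f \<boxtimes> g) \<boxtimes> h)"
    by (simp add: assms comp_assoc_ends interchange_ends)
  also have "\<dots> = glue u' (v' @ w') \<cdot> (idm C (list_obj u') \<boxtimes> glue v' w')
      \<cdot> (assoc C (list_obj u') (list_obj v') (list_obj w') \<cdot> ((f \<boxtimes> g) \<boxtimes> h))"
    by (simp add: glue_assoc assms comp_assoc_ends)
  also have "\<dots> = glue u' (v' @ w') \<cdot> (idm C (list_obj u') \<boxtimes> glue v' w') \<cdot> (f \<boxtimes> (g \<boxtimes> h))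
      \<cdot> assoc C (list_obj u) (list_obj v) (list_obj w)"
    using assoc_nat[of f g h] by (simp add: assms)
  also have "\<dots> = ?r \<cdot> ?j"
    by (simp add: glue_assoc assms comp_assoc_ends tensor_comp_assoc)
  finally show "?l \<cdot> ?j = ?r \<cdot> ?j" .
qed (simp_all add: assms)

lemma s_tns_assoc: "s_arr f \<Longrightarrow> s_arr g \<Longrightarrow> s_arr h \<Longrightarrow> s_tns (s_tns f g) h = s_tns f (s_tns g h)"
  by (simp add: s_defs glue_conjugate_assoc)

section \<open>Transport of arrows from bracketed products to words\<close>

fun tree_obj :: "'o bracketing \<Rightarrow> 'o" where
  "tree_obj BUnit = \<one>"
| "tree_obj (BAtom a) = a"
| "tree_obj (BTensor S T) = tree_obj S \<otimes> tree_obj T"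

text \<open>\<open>list_obj [a]\<close> is \<open>a \<otimes> \<one>\<close>, so even an atom is
  moved: the inverse of \<open>runit\<close> supplies the closing unit.\<close>

fun canonical :: "'o bracketing \<Rightarrow> 'm" where
  "canonical BUnit = idm C \<one>"
| "canonical (BAtom a) = inv_arr C (runit C a)"
| "canonical (BTensor S T) = glue (flat S) (flat T) \<cdot> (canonical S \<boxtimes> canonical T)"

lemma canonical_ends [simp]: "src C (canonical T) = tree_obj T" "tgt C (canonical T) = list_obj (flat T)"
  by (induction T) auto

lemma canonical_iso [simp]: "is_iso C (canonical T)"
  by (induction T) auto

lemma tree_obj_word [simp]: "tree_obj (word_bracketing w) = list_obj w"
  by (induction w) auto

text \<open>
  The bracketing of \<open>word_obj\<close> has the identity as its canonical isomorphism: the arrow of a slice is,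
  up to its source and target words, its own strictification.
\<close>

lemma canonical_word [simp]: "canonical (word_bracketing w) = idm C (list_obj w)"
  by (induction w) (simp_all add: comp_assoc_ends[symmetric] triangle interchange_ends)

definition strictify :: "'o bracketing \<Rightarrow> 'o bracketing \<Rightarrow> 'm \<Rightarrow> 'o list \<times> 'm \<times> 'o list" where
  "strictify S T f = (flat S, canonical T \<cdot> f \<cdot> inv_arr C (canonical S), flat T)"

lemma strictify_ends [simp]: "s_dm (strictify S T f) = flat S" "s_cd (strictify S T f) = flat T"
  by (simp_all add: s_defs strictify_def)

lemma strictify_arr [simp]: "src C f = tree_obj S \<Longrightarrow> tgt C f = tree_obj T \<Longrightarrow> s_arr (strictify S T f)"
  by (simp_all add: s_defs strictify_def)

lemma strictify_id: "strictify T T (idm C (tree_obj T)) = s_one (flat T)"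
  by (simp add: s_defs strictify_def)

lemma strictify_comp:
  "src C f = tree_obj R \<Longrightarrow> tgt C f = tree_obj S \<Longrightarrow> src C g = tree_obj S \<Longrightarrow> tgt C g = tree_obj T
   \<Longrightarrow> strictify R T (g \<cdot> f) = s_cmp (strictify S T g) (strictify R S f)"
  by (simp add: s_defs strictify_def comp_assoc_ends)

lemma strictify_tensor:
  "src C f = tree_obj R \<Longrightarrow> tgt C f = tree_obj R' \<Longrightarrow> src C g = tree_obj S \<Longrightarrow> tgt C g = tree_obj S'
   \<Longrightarrow> strictify (BTensor R S) (BTensor R' S') (f \<boxtimes> g) = s_tns (strictify R R' f) (strictify S S' g)"
  by (simp add: s_defs strictify_def comp_assoc_ends inv_arr_comp inv_arr_tensor tensor_comp_assoc)

lemma strictify_scale: "src C f = tree_obj S \<Longrightarrow> tgt C f = tree_obj T \<Longrightarrow>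
    strictify S T (c \<odot> f) = s_sc c (strictify S T f)"
  by (simp add: s_defs strictify_def)

text \<open>Naturality pulls the associator past the three canonical isomorphisms, where
  \<open>glue_assoc\<close> absorbs it. Hence associators drop out of every strictified
  formula.\<close>

lemma strictify_assoc: "strictify (BTensor (BTensor R S) T) (BTensor R (BTensor S T))
     (assoc C (tree_obj R) (tree_obj S) (tree_obj T)) = s_one (flat R @ flat S @ flat T)"
proof -
  let ?x = "canonical (BTensor (BTensor R S) T)" and ?y = "canonical (BTensor R (BTensor S T))"
  have "?y \<cdot> assoc C (tree_obj R) (tree_obj S) (tree_obj T)
      = glue (flat R) (flat S @ flat T) \<cdot> (idm C (list_obj (flat R)) \<boxtimes> glue (flat S) (flat T))
        \<cdot> ((canonical R \<boxtimes> (canonical S \<boxtimes> canonical T)) \<cdot> assoc C (tree_obj R) (tree_obj S) (tree_obj T))"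
    by (simp add: comp_assoc_ends tensor_comp_assoc)
  also have "\<dots> = (glue (flat R) (flat S @ flat T) \<cdot> (idm C (list_obj (flat R)) \<boxtimes> glue (flat S) (flat T))
        \<cdot> assoc C (list_obj (flat R)) (list_obj (flat S)) (list_obj (flat T))) \<cdot> ((canonical R \<boxtimes> canonical S) \<boxtimes> canonical T)"
    using assoc_nat[of "canonical R" "canonical S" "canonical T"] by (simp add: comp_assoc_ends)
  also have "\<dots> = ?x"
    by (simp add: glue_assoc[symmetric] comp_assoc_ends interchange_ends)
  finally have "?y \<cdot> assoc C (tree_obj R) (tree_obj S) (tree_obj T) = ?x" .
  then have "(?y \<cdot> assoc C (tree_obj R) (tree_obj S) (tree_obj T)) \<cdot> inv_arr C ?x
      = idm C (list_obj (flat R @ flat S @ flat T))"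
    using inv_arr_simps(4)[OF canonical_iso, of "BTensor (BTensor R S) T"] by simp
  then show ?thesis by (simp add: strictify_def s_one_def comp_assoc_ends del: canonical.simps)
qed

lemma strictify_lunit: "strictify (BTensor BUnit T) T (lunit C (tree_obj T)) = s_one (flat T)"
  using lunit_nat[of "canonical T", symmetric]
  by (simp add: strictify_def s_one_def comp_assoc_ends[symmetric])

lemma strictify_runit: "strictify (BTensor T BUnit) T (runit C (tree_obj T)) = s_one (flat T)"
  using runit_nat[of "canonical T", symmetric]
  by (simp add: strictify_def s_one_def comp_assoc_ends[symmetric])
     (simp add: inv_arr_comp inv_arr_tensor comp_assoc_ends tensor_comp_assoc glue_nil)

lemma strictify_inv:
  assumes "is_iso C f" "src C f = tree_obj S" "tgt C f = tree_obj T" "strictify S T f = s_one (flat S)"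
  shows "strictify T S (inv_arr C f) = s_one (flat S)"
proof -
  have T: "flat T = flat S" using assms(4) by (simp add: strictify_def s_one_def)
  have "canonical T \<cdot> f \<cdot> inv_arr C (canonical S) = idm C (list_obj (flat S))"
    using assms(4) by (simp add: strictify_def s_one_def)
  then have "inv_arr C (canonical T \<cdot> f \<cdot> inv_arr C (canonical S)) = idm C (list_obj (flat S))" by simp
  then show ?thesis using T assms(1-3)
    by (simp add: strictify_def s_one_def inv_arr_comp comp_assoc_ends)
qed

end

section \<open>The braiding of words\<close>

context linear_braided_category
begin

lemma braid_ends [simp]: "src C (braid C a b) = a \<otimes> b" "tgt C (braid C a b) = b \<otimes> a"
  using braid_hom[of a b] by (simp_all add: hom_iff)

declare braid_iso [simp]

lemma braid_nat: "braid C (tgt C f) (tgt C g) \<cdot> (f \<boxtimes> g) = (g \<boxtimes> f) \<cdot> braid C (src C f) (src C g)"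
  by (rule braid_natural) (simp_all add: hom_iff)

definition s_br :: "'o list \<Rightarrow> 'o list \<Rightarrow> 'o list \<times> 'm \<times> 'o list" where
  "s_br u v = (u @ v, glue v u \<cdot> braid C (list_obj u) (list_obj v) \<cdot> inv_arr C (glue u v), v @ u)"

definition s_bri :: "'o list \<Rightarrow> 'o list \<Rightarrow> 'o list \<times> 'm \<times> 'o list" where
  "s_bri u v = (v @ u, glue u v \<cdot> inv_arr C (braid C (list_obj u) (list_obj v)) \<cdot> inv_arr C (glue v u), u @ v)"

lemma strictify_braid: "strictify (BTensor S T) (BTensor T S) (braid C (tree_obj S) (tree_obj T))
    = s_br (flat S) (flat T)"
proof -
  have "canonical (BTensor T S) \<cdot> braid C (tree_obj S) (tree_obj T)
     = glue (flat T) (flat S) \<cdot> braid C (list_obj (flat S)) (list_obj (flat T)) \<cdot> (canonical S \<boxtimes> canonical T)"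
    using braid_nat[of "canonical S" "canonical T"] by (simp add: comp_assoc_ends)
  then have "(canonical (BTensor T S) \<cdot> braid C (tree_obj S) (tree_obj T)) \<cdot> inv_arr C (canonical (BTensor S T))
     = (glue (flat T) (flat S) \<cdot> braid C (list_obj (flat S)) (list_obj (flat T)) \<cdot> (canonical S \<boxtimes> canonical T))
       \<cdot> inv_arr C (canonical (BTensor S T))" by simp
  then show ?thesis
    by (simp add: strictify_def s_br_def comp_assoc_ends inv_arr_comp inv_arr_tensor tensor_comp_assoc)
qed

lemma strictify_inv_braid: "strictify (BTensor T S) (BTensor S T) (inv_arr C (braid C (tree_obj S) (tree_obj T)))
    = s_bri (flat S) (flat T)"
proof -
  have "fst (snd (strictify (BTensor S T) (BTensor T S) (braid C (tree_obj S) (tree_obj T))))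
    = fst (snd (s_br (flat S) (flat T)))" by (simp only: strictify_braid)
  then have "inv_arr C (canonical (BTensor T S) \<cdot> braid C (tree_obj S) (tree_obj T) \<cdot> inv_arr C (canonical (BTensor S T)))
    = inv_arr C (glue (flat T) (flat S) \<cdot> braid C (list_obj (flat S)) (list_obj (flat T)) \<cdot> inv_arr C (glue (flat S) (flat T)))"
    by (simp only: strictify_def s_br_def fst_conv snd_conv)
  then show ?thesis
    by (simp add: strictify_def s_bri_def comp_assoc_ends inv_arr_comp inv_arr_tensor tensor_comp_assoc)
qed

lemma s_br_arr: "s_arr (s_br u v)" "s_dm (s_br u v) = u @ v" "s_cd (s_br u v) = v @ u"
    "s_arr (s_bri u v)" "s_dm (s_bri u v) = v @ u" "s_cd (s_bri u v) = u @ v"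
  by (simp_all add: s_defs s_br_def s_bri_def)

lemma s_br_inverse: "s_cmp (s_bri u v) (s_br u v) = s_one (u @ v)" "s_cmp (s_br u v) (s_bri u v) = s_one (v @ u)"
  by (simp_all add: s_defs s_br_def s_bri_def comp_assoc_ends)

lemma s_br_nat: "s_arr f \<Longrightarrow> s_arr g \<Longrightarrow>
    s_cmp (s_br (s_cd f) (s_cd g)) (s_tns f g) = s_cmp (s_tns g f) (s_br (s_dm f) (s_dm g))"
  using braid_nat[of "fst (snd f)" "fst (snd g)"]
  by (simp add: s_defs s_br_def comp_assoc_ends) (simp add: comp_assoc_ends[symmetric])

text \<open>The hexagon axiom, transported along the standard bracketings of the three words; its
  associators become identities and disappear in the last line.\<close>

lemma s_hexagon1: "s_br u (v @ w) = s_cmp (s_tns (s_one v) (s_br u w)) (s_tns (s_br u v) (s_one w))"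
proof -
  let ?U = "word_bracketing u" and ?V = "word_bracketing v" and ?W = "word_bracketing w"
  let ?u = "list_obj u" and ?v = "list_obj v" and ?w = "list_obj w"
  have "strictify (BTensor (BTensor ?U ?V) ?W) (BTensor ?V (BTensor ?W ?U))
       (assoc C ?v ?w ?u \<cdot> braid C ?u (?v \<otimes> ?w) \<cdot> assoc C ?u ?v ?w)
     = s_cmp (s_one (v @ w @ u)) (s_cmp (s_br u (v @ w)) (s_one (u @ v @ w)))"
    using strictify_assoc[of ?U ?V ?W] strictify_assoc[of ?V ?W ?U] strictify_braid[of ?U "BTensor ?V ?W"]
    by (subst strictify_comp[of _ _ "BTensor (BTensor ?V ?W) ?U"], simp_all)
       (subst strictify_comp[of _ _ "BTensor ?U (BTensor ?V ?W)"], simp_all)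
  moreover have "strictify (BTensor (BTensor ?U ?V) ?W) (BTensor ?V (BTensor ?W ?U))
       ((idm C ?v \<boxtimes> braid C ?u ?w) \<cdot> assoc C ?v ?u ?w \<cdot> (braid C ?u ?v \<boxtimes> idm C ?w))
     = s_cmp (s_tns (s_one v) (s_br u w)) (s_cmp (s_one (v @ u @ w)) (s_tns (s_br u v) (s_one w)))"
    using strictify_assoc[of ?V ?U ?W] strictify_braid[of ?U ?W] strictify_braid[of ?U ?V]
      strictify_id[of ?V] strictify_id[of ?W]
    by (subst strictify_comp[of _ _ "BTensor ?V (BTensor ?U ?W)"], simp_all)
       (subst strictify_comp[of _ _ "BTensor (BTensor ?V ?U) ?W"], simp_all add: strictify_tensor)
  ultimately have "s_cmp (s_one (v @ w @ u)) (s_cmp (s_br u (v @ w)) (s_one (u @ v @ w)))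
     = s_cmp (s_tns (s_one v) (s_br u w)) (s_cmp (s_one (v @ u @ w)) (s_tns (s_br u v) (s_one w)))"
    by (simp only: hexagon1)
  then show ?thesis by (simp add: s_defs s_br_def comp_assoc_ends)
qed

lemma s_hexagon2: "s_br (u @ v) w = s_cmp (s_tns (s_br u w) (s_one v)) (s_tns (s_one u) (s_br v w))"
proof -
  let ?U = "word_bracketing u" and ?V = "word_bracketing v" and ?W = "word_bracketing w"
  let ?u = "list_obj u" and ?v = "list_obj v" and ?w = "list_obj w"
  have inv: "strictify (BTensor R (BTensor S T)) (BTensor (BTensor R S) T)
     (inv_arr C (assoc C (tree_obj R) (tree_obj S) (tree_obj T))) = s_one (flat R @ flat S @ flat T)" for R S T
    by (subst strictify_inv) (simp_all add: strictify_assoc)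
  have "strictify (BTensor ?U (BTensor ?V ?W)) (BTensor (BTensor ?W ?U) ?V)
       (inv_arr C (assoc C ?w ?u ?v) \<cdot> braid C (?u \<otimes> ?v) ?w \<cdot> inv_arr C (assoc C ?u ?v ?w))
     = s_cmp (s_one (w @ u @ v)) (s_cmp (s_br (u @ v) w) (s_one (u @ v @ w)))"
    using inv[of ?U ?V ?W] inv[of ?W ?U ?V] strictify_braid[of "BTensor ?U ?V" ?W]
    by (subst strictify_comp[of _ _ "BTensor ?W (BTensor ?U ?V)"], simp_all)
       (subst strictify_comp[of _ _ "BTensor (BTensor ?U ?V) ?W"], simp_all)
  moreover have "strictify (BTensor ?U (BTensor ?V ?W)) (BTensor (BTensor ?W ?U) ?V)
       ((braid C ?u ?w \<boxtimes> idm C ?v) \<cdot> inv_arr C (assoc C ?u ?w ?v) \<cdot> (idm C ?u \<boxtimes> braid C ?v ?w))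
     = s_cmp (s_tns (s_br u w) (s_one v)) (s_cmp (s_one (u @ w @ v)) (s_tns (s_one u) (s_br v w)))"
    using inv[of ?U ?W ?V] strictify_braid[of ?U ?W] strictify_braid[of ?V ?W]
      strictify_id[of ?V] strictify_id[of ?U]
    by (subst strictify_comp[of _ _ "BTensor (BTensor ?U ?W) ?V"], simp_all)
       (subst strictify_comp[of _ _ "BTensor ?U (BTensor ?W ?V)"], simp_all add: strictify_tensor)
  ultimately have "s_cmp (s_one (w @ u @ v)) (s_cmp (s_br (u @ v) w) (s_one (u @ v @ w)))
     = s_cmp (s_tns (s_br u w) (s_one v)) (s_cmp (s_one (u @ w @ v)) (s_tns (s_one u) (s_br v w)))"
    by (simp only: hexagon2)
  then show ?thesis by (simp add: s_defs s_br_def comp_assoc_ends)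
qed

end

section \<open>Strict braided categories\<close>

text \<open>The calculus of strands, freed from bracketings. The ends of composites and products are
  given unconditionally, so that composability is checked by comparing words. Duals and twists enter
  later, as \<open>dual_pair\<close> and as scalars.\<close>

locale strict_braided =
  fixes arr :: "'a \<Rightarrow> bool" and dm cd :: "'a \<Rightarrow> 'o list" and one :: "'o list \<Rightarrow> 'a"
    and cmp :: "'a \<Rightarrow> 'a \<Rightarrow> 'a" (infixr "\<bullet>" 60)
    and tns :: "'a \<Rightarrow> 'a \<Rightarrow> 'a" (infixr "\<parallel>" 75)
    and sc :: "complex \<Rightarrow> 'a \<Rightarrow> 'a" (infixr "\<star>" 65)
    and br bri :: "'o list \<Rightarrow> 'o list \<Rightarrow> 'a"
  assumes arr_one [simp]: "arr (one u)" "dm (one u) = u" "cd (one u) = u"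
    and arr_cmp [simp]: "arr f \<Longrightarrow> arr g \<Longrightarrow> dm g = cd f \<Longrightarrow> arr (g \<bullet> f)"
      "dm (g \<bullet> f) = dm f" "cd (g \<bullet> f) = cd g"
    and arr_tns [simp]: "arr f \<Longrightarrow> arr g \<Longrightarrow> arr (f \<parallel> g)" "dm (f \<parallel> g) = dm f @ dm g" "cd (f \<parallel> g) = cd f @ cd g"
    and arr_sc [simp]: "arr f \<Longrightarrow> arr (c \<star> f)" "dm (c \<star> f) = dm f" "cd (c \<star> f) = cd f"
    and arr_br [simp]: "arr (br u v)" "dm (br u v) = u @ v" "cd (br u v) = v @ u"
      "arr (bri u v)" "dm (bri u v) = v @ u" "cd (bri u v) = u @ v"
    and one_cmp [simp]: "arr f \<Longrightarrow> cd f = u \<Longrightarrow> one u \<bullet> f = f"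
    and cmp_one [simp]: "arr f \<Longrightarrow> dm f = u \<Longrightarrow> f \<bullet> one u = f"
    and cmp_assoc [simp]: "arr f \<Longrightarrow> arr g \<Longrightarrow> arr h \<Longrightarrow> dm g = cd f \<Longrightarrow> dm h = cd g
        \<Longrightarrow> (h \<bullet> g) \<bullet> f = h \<bullet> (g \<bullet> f)"
    and tns_one [simp]: "one u \<parallel> one v = one (u @ v)"
    and interchange: "arr f \<Longrightarrow> arr g \<Longrightarrow> arr f' \<Longrightarrow> arr g' \<Longrightarrow> dm f' = cd f \<Longrightarrow> dm g' = cd g
        \<Longrightarrow> (f' \<parallel> g') \<bullet> (f \<parallel> g) = (f' \<bullet> f) \<parallel> (g' \<bullet> g)"
    and tns_assoc [simp]: "arr f \<Longrightarrow> arr g \<Longrightarrow> arr h \<Longrightarrow> (f \<parallel> g) \<parallel> h = f \<parallel> (g \<parallel> h)"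
    and nil_tns [simp]: "arr f \<Longrightarrow> one [] \<parallel> f = f"
    and tns_nil [simp]: "arr f \<Longrightarrow> f \<parallel> one [] = f"
    and sc_sc [simp]: "arr f \<Longrightarrow> x \<star> y \<star> f = (x * y) \<star> f"
    and sc_1 [simp]: "arr f \<Longrightarrow> 1 \<star> f = f"
    and sc_cmp [simp]: "arr f \<Longrightarrow> arr g \<Longrightarrow> dm g = cd f \<Longrightarrow> (x \<star> g) \<bullet> f = x \<star> (g \<bullet> f)"
      "arr f \<Longrightarrow> arr g \<Longrightarrow> dm g = cd f \<Longrightarrow> g \<bullet> (x \<star> f) = x \<star> (g \<bullet> f)"
    and sc_tns [simp]: "arr f \<Longrightarrow> arr g \<Longrightarrow> (x \<star> f) \<parallel> g = x \<star> (f \<parallel> g)"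
      "arr f \<Longrightarrow> arr g \<Longrightarrow> f \<parallel> (x \<star> g) = x \<star> (f \<parallel> g)"
    and bri_br [simp]: "bri u v \<bullet> br u v = one (u @ v)"
    and br_bri [simp]: "br u v \<bullet> bri u v = one (v @ u)"
    and br_nat: "arr f \<Longrightarrow> arr g \<Longrightarrow> br (cd f) (cd g) \<bullet> (f \<parallel> g) = (g \<parallel> f) \<bullet> br (dm f) (dm g)"
    and hexagon1: "br u (v @ w) = (one v \<parallel> br u w) \<bullet> (br u v \<parallel> one w)"
    and hexagon2: "br (u @ v) w = (br u w \<parallel> one v) \<bullet> (one u \<parallel> br v w)"
begin

lemma one_one_tns [simp]: "arr f \<Longrightarrow> one u \<parallel> one v \<parallel> f = one (u @ v) \<parallel> f"
  using tns_assoc[of "one u" "one v" f] by simp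

lemma whisker:
  "arr f \<Longrightarrow> arr g \<Longrightarrow> dm g = cd f \<Longrightarrow> one u \<parallel> (g \<bullet> f) = (one u \<parallel> g) \<bullet> (one u \<parallel> f)"
  "arr f \<Longrightarrow> arr g \<Longrightarrow> dm g = cd f \<Longrightarrow> (g \<bullet> f) \<parallel> one u = (g \<parallel> one u) \<bullet> (f \<parallel> one u)"
  by (simp_all add: interchange)

lemma interchange3:
  assumes "arr f" "arr g" "arr h" "arr f'" "arr g'" "arr h'" "dm f' = cd f" "dm g' = cd g" "dm h' = cd h"
  shows "(f' \<parallel> g' \<parallel> h') \<bullet> (f \<parallel> g \<parallel> h) = (f' \<bullet> f) \<parallel> (g' \<bullet> g) \<parallel> (h' \<bullet> h)"
  using assms interchange[of f "g \<parallel> h" f' "g' \<parallel> h'"] by (simp add: interchange)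

lemma cmp_tail: "g \<bullet> f = h \<Longrightarrow> arr f \<Longrightarrow> arr g \<Longrightarrow> arr k \<Longrightarrow> dm g = cd f \<Longrightarrow> dm f = cd k \<Longrightarrow> g \<bullet> f \<bullet> k = h \<bullet> k"
  using cmp_assoc[of k f g] by simp

lemma bri_br_cancel [simp]: "arr f \<Longrightarrow> cd f = u @ v \<Longrightarrow> bri u v \<bullet> br u v \<bullet> f = f"
  "arr f \<Longrightarrow> cd f = v @ u \<Longrightarrow> br u v \<bullet> bri u v \<bullet> f = f"
  by (simp_all add: cmp_tail[OF bri_br] cmp_tail[OF br_bri])

text \<open>Together with \<open>slices2\<close>: pieces on disjoint strands may exchange
  heights.\<close>

lemma slices1: "arr f \<Longrightarrow> arr g \<Longrightarrow> (f \<parallel> one (cd g)) \<bullet> (one (dm f) \<parallel> g) = f \<parallel> g"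
  by (simp add: interchange)

lemma slices2: "arr f \<Longrightarrow> arr g \<Longrightarrow> (one (cd f) \<parallel> g) \<bullet> (f \<parallel> one (dm g)) = f \<parallel> g"
  by (simp add: interchange)

text \<open>The hexagons with empty words make these braidings idempotent; being invertible, they
  are identities.\<close>

lemma br_nil [simp]: "br u [] = one u" "br [] u = one u"
proof -
  have "bri u [] \<bullet> br u [] = bri u [] \<bullet> br u [] \<bullet> br u []" using hexagon1[of u "[]" "[]"] by simp
  then show "br u [] = one u" by simp
  have "bri [] u \<bullet> br [] u = bri [] u \<bullet> br [] u \<bullet> br [] u" using hexagon2[of "[]" "[]" u] by simp
  then show "br [] u = one u" by simp
qed

lemma br_nat_left: "arr f \<Longrightarrow> br (cd f) w \<bullet> (f \<parallel> one w) = (one w \<parallel> f) \<bullet> br (dm f) w"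
  using br_nat[of f "one w"] by simp

lemma br_nat_right: "arr f \<Longrightarrow> br w (cd f) \<bullet> (one w \<parallel> f) = (f \<parallel> one w) \<bullet> br w (dm f)"
  using br_nat[of "one w" f] by simp

text \<open>Conjugation by \<open>br a x\<close> exchanges the two double braidings and fixes
  scalars.\<close>

lemma monodromy_swap:
  assumes "br x a \<bullet> br a x = m \<star> one (a @ x)"
  shows "br a x \<bullet> br x a = m \<star> one (x @ a)"
proof -
  have "br a x \<bullet> br x a = br a x \<bullet> (br x a \<bullet> br a x) \<bullet> bri a x" by simp
  also have "\<dots> = m \<star> one (x @ a)" unfolding assms by simp
  finally show ?thesis .
qed

section \<open>Duals and their double braidings\<close>

definition dual_pair :: "'o list \<Rightarrow> 'o list \<Rightarrow> 'a \<Rightarrow> 'a \<Rightarrow> bool" where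
  "dual_pair x x' n e \<longleftrightarrow> arr n \<and> dm n = [] \<and> cd n = x @ x' \<and> arr e \<and> dm e = x' @ x \<and> cd e = [] \<and>
    (one x \<parallel> e) \<bullet> (n \<parallel> one x) = one x \<and> (e \<parallel> one x') \<bullet> (one x' \<parallel> n) = one x'"

lemma dual_pairD:
  assumes "dual_pair x x' n e"
  shows "arr n" "dm n = []" "cd n = x @ x'" "arr e" "dm e = x' @ x" "cd e = []"
    "(one x \<parallel> e) \<bullet> (n \<parallel> one x) = one x" "(e \<parallel> one x') \<bullet> (one x' \<parallel> n) = one x'"
  using assms by (auto simp: dual_pair_def)

text \<open>The strand \<open>x'\<close> at the foot of \<open>f\<close> is bent up to a strand
  \<open>x\<close> and back; once \<open>e\<close> has been slid below \<open>f\<close>, the second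
  zigzag straightens it.\<close>

lemma dual_transpose:
  assumes d: "dual_pair x x' n e" and f: "arr f" "dm f = x' @ a"
  shows "(e \<parallel> one (cd f)) \<bullet> (one x' \<parallel> ((one x \<parallel> f) \<bullet> (n \<parallel> one a))) = f"
proof -
  note [simp] = dual_pairD(1-6)[OF d] f
  have "(e \<parallel> one (cd f)) \<bullet> (one x' \<parallel> ((one x \<parallel> f) \<bullet> (n \<parallel> one a)))
     = ((e \<parallel> one (cd f)) \<bullet> (one (x' @ x) \<parallel> f)) \<bullet> (one x' \<parallel> n \<parallel> one a)"
    by (simp add: whisker)
  also have "\<dots> = f \<bullet> (e \<parallel> one (x' @ a)) \<bullet> (one x' \<parallel> n \<parallel> one a)"
    using slices1[of e f] cmp_tail[OF slices2[of e f], of "one x' \<parallel> n \<parallel> one a"] by simp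
  also have "(e \<parallel> one (x' @ a)) \<bullet> (one x' \<parallel> n \<parallel> one a) = ((e \<parallel> one x') \<bullet> (one x' \<parallel> n)) \<parallel> one a"
    by (simp add: whisker)
  also have "\<dots> = one (x' @ a)" by (simp add: dual_pairD(8)[OF d])
  finally show ?thesis by simp
qed

text \<open>Arrows out of \<open>x' @ a\<close> are compared through their mates; this reduces
  braidings of a dual to those of \<open>x\<close>.\<close>

lemma dual_cancel:
  assumes d: "dual_pair x x' n e" and f: "arr f" "dm f = x' @ a" and g: "arr g" "dm g = x' @ a" "cd g = cd f"
    and eq: "(one x \<parallel> f) \<bullet> (n \<parallel> one a) = (one x \<parallel> g) \<bullet> (n \<parallel> one a)"
  shows "f = g"
  using dual_transpose[OF d f] dual_transpose[OF d g(1,2)] g(3) eq by simp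

text \<open>Naturality of the braiding at a cup: the strand \<open>a\<close> passes over both legs
  at once. In \<open>br_coev_left\<close> it passes under them.\<close>

lemma br_coev_right:
  assumes "arr n" "dm n = []" "cd n = x @ x'"
  shows "(one x \<parallel> br a x') \<bullet> (br a x \<parallel> one x') \<bullet> (one a \<parallel> n) = n \<parallel> one a"
  using br_nat_right[of n a] assms by (simp add: hexagon1)

lemma br_coev_left:
  assumes "arr n" "dm n = []" "cd n = x @ x'"
  shows "(br x a \<parallel> one x') \<bullet> (one x \<parallel> br x' a) \<bullet> (n \<parallel> one a) = one a \<parallel> n"
  using br_nat_left[of n a] assms by (simp add: hexagon2)

lemma dual_monodromy:
  assumes d: "dual_pair x x' n e" and m: "br x a \<bullet> br a x = m \<star> one (a @ x)" "m \<noteq> 0"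
  shows "br x' a \<bullet> br a x' = inverse m \<star> one (a @ x')"
proof -
  note [simp] = dual_pairD(1-6)[OF d]
  have "(one x \<parallel> (m \<star> (br a x' \<bullet> br x' a))) \<bullet> (n \<parallel> one a)
      = (one x \<parallel> br a x') \<bullet> ((m \<star> one (x @ a)) \<parallel> one x') \<bullet> (one x \<parallel> br x' a) \<bullet> (n \<parallel> one a)"
    by (simp add: whisker)
  \<comment> \<open>The scalar \<open>m\<close> is opened up into the double braiding of
    \<open>x\<close> and \<open>a\<close>, which provides one crossing for each of two cup
    slides.\<close>
  also have "\<dots> = (one x \<parallel> br a x') \<bullet> (br a x \<parallel> one x') \<bullet> ((br x a \<parallel> one x') \<bullet> (one x \<parallel> br x' a) \<bullet> (n \<parallel> one a))"
    by (simp add: monodromy_swap[OF m(1), symmetric] whisker)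
  also have "\<dots> = n \<parallel> one a"
    by (simp add: br_coev_left br_coev_right)
  finally have "(one x \<parallel> (m \<star> (br a x' \<bullet> br x' a))) \<bullet> (n \<parallel> one a) = (one x \<parallel> one (x' @ a)) \<bullet> (n \<parallel> one a)"
    by simp
  then have "m \<star> (br a x' \<bullet> br x' a) = one (x' @ a)"
    by (rule dual_cancel[OF d, rotated -1]) simp_all
  then have "inverse m \<star> (m \<star> (br a x' \<bullet> br x' a)) = inverse m \<star> one (x' @ a)" by simp
  then have "br a x' \<bullet> br x' a = inverse m \<star> one (x' @ a)" using m(2) by simp
  then show ?thesis by (rule monodromy_swap)
qed

definition mid :: "'o list \<Rightarrow> 'o list \<Rightarrow> 'o list \<Rightarrow> 'o list \<Rightarrow> 'a" where
  "mid a x b y = one a \<parallel> br x b \<parallel> one y"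

lemma mid_arr [simp]: "arr (mid a x b y)" "dm (mid a x b y) = a @ x @ b @ y" "cd (mid a x b y) = a @ b @ x @ y"
  by (simp_all add: mid_def)

lemma mid_nat:
  assumes "arr f" "arr g" "arr h" "arr k"
  shows "mid (cd f) (cd g) (cd h) (cd k) \<bullet> (f \<parallel> g \<parallel> h \<parallel> k)
       = (f \<parallel> h \<parallel> g \<parallel> k) \<bullet> mid (dm f) (dm g) (dm h) (dm k)"
proof -
  have "mid (cd f) (cd g) (cd h) (cd k) \<bullet> (f \<parallel> (g \<parallel> h) \<parallel> k) = f \<parallel> (br (cd g) (cd h) \<bullet> (g \<parallel> h)) \<parallel> k"
    unfolding mid_def using assms by (subst interchange3) simp_all
  also have "\<dots> = f \<parallel> ((h \<parallel> g) \<bullet> br (dm g) (dm h)) \<parallel> k" using assms by (simp add: br_nat)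
  also have "\<dots> = (f \<parallel> (h \<parallel> g) \<parallel> k) \<bullet> mid (dm f) (dm g) (dm h) (dm k)"
    unfolding mid_def using assms by (subst interchange3) simp_all
  finally show ?thesis using assms by simp
qed

text \<open>Both sides sort \<open>a1 x1 a2 x2 b y\<close> into \<open>a1 a2 b x1 x2 y\<close>. They
  differ only in the order of the crossings of \<open>x1\<close> with \<open>a2\<close> and of
  \<open>x2\<close> with \<open>b\<close>, which lie on disjoint strands.\<close>

lemma mid_assoc: "mid a1 x1 (a2 @ b) (x2 @ y) \<bullet> (one (a1 @ x1) \<parallel> mid a2 x2 b y)
    = mid (a1 @ a2) (x1 @ x2) b y \<bullet> (mid a1 x1 a2 x2 \<parallel> one (b @ y))"
proof -
  have "mid a1 x1 (a2 @ b) (x2 @ y) \<bullet> (one (a1 @ x1) \<parallel> mid a2 x2 b y)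
     = (one (a1 @ a2) \<parallel> br x1 b \<parallel> one (x2 @ y)) \<bullet> (one a1 \<parallel> ((br x1 a2 \<parallel> one (b @ x2)) \<bullet> (one (x1 @ a2) \<parallel> br x2 b)) \<parallel> one y)"
    by (simp add: mid_def hexagon1 whisker)
  also have "(br x1 a2 \<parallel> one (b @ x2)) \<bullet> (one (x1 @ a2) \<parallel> br x2 b) = (one (a2 @ x1) \<parallel> br x2 b) \<bullet> (br x1 a2 \<parallel> one (x2 @ b))"
    using slices1[of "br x1 a2" "br x2 b"] slices2[of "br x1 a2" "br x2 b"] by simp
  also have "(one (a1 @ a2) \<parallel> br x1 b \<parallel> one (x2 @ y)) \<bullet> (one a1 \<parallel> ((one (a2 @ x1) \<parallel> br x2 b) \<bullet> (br x1 a2 \<parallel> one (x2 @ b))) \<parallel> one y)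
     = mid (a1 @ a2) (x1 @ x2) b y \<bullet> (mid a1 x1 a2 x2 \<parallel> one (b @ y))"
    by (simp add: mid_def hexagon2 whisker)
  finally show ?thesis .
qed

end

section \<open>Link invariants of a tensor product\<close>

context strict_braided
begin

section \<open>Evaluation of diagrams in a strict braided category\<close>

definition word :: "(orient \<Rightarrow> 'o list) \<Rightarrow> orient list \<Rightarrow> 'o list" where
  "word ob w = concat (map ob w)"

lemma word_simps [simp]: "word ob [] = []" "word ob (s # w) = ob s @ word ob w"
    "word ob (u @ v) = word ob u @ word ob v"
  by (simp_all add: word_def)

fun piece_map :: "(orient \<Rightarrow> 'o list) \<Rightarrow> (orient \<Rightarrow> 'a) \<Rightarrow> (orient \<Rightarrow> 'a) \<Rightarrow> piece \<Rightarrow> 'a" where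
  "piece_map ob cu ca (Cup s) = cu s"
| "piece_map ob cu ca (Cap s) = ca s"
| "piece_map ob cu ca (Cross over s t) = (if over then br (ob s) (ob t) else bri (ob t) (ob s))"

fun slice_map :: "(orient \<Rightarrow> 'o list) \<Rightarrow> (orient \<Rightarrow> 'a) \<Rightarrow> (orient \<Rightarrow> 'a) \<Rightarrow> slice \<Rightarrow> 'a" where
  "slice_map ob cu ca (u, g, v) = one (word ob u) \<parallel> piece_map ob cu ca g \<parallel> one (word ob v)"

fun tangle_map :: "(orient \<Rightarrow> 'o list) \<Rightarrow> (orient \<Rightarrow> 'a) \<Rightarrow> (orient \<Rightarrow> 'a) \<Rightarrow> orient list \<Rightarrow> slice list \<Rightarrow> 'a" where
  "tangle_map ob cu ca w [] = one (word ob w)"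
| "tangle_map ob cu ca w (x # xs) = tangle_map ob cu ca (slice_top x) xs \<bullet> slice_map ob cu ca x"

text \<open>The shape of \<open>coev'\<close> and \<open>ev'\<close> when the twist is the scalar
  \<open>t\<close>: two turns form a dual pair, and the other two are obtained from them by a
  braiding.\<close>

definition colouring :: "(orient \<Rightarrow> 'o list) \<Rightarrow> (orient \<Rightarrow> 'a) \<Rightarrow> (orient \<Rightarrow> 'a) \<Rightarrow> complex \<Rightarrow> bool" where
  "colouring ob cu ca t \<longleftrightarrow> t \<noteq> 0 \<and> dual_pair (ob Fwd) (ob Bwd) (cu Fwd) (ca Bwd) \<and>
     cu Bwd = t \<star> (br (ob Fwd) (ob Bwd) \<bullet> cu Fwd) \<and> ca Fwd = t \<star> (ca Bwd \<bullet> br (ob Fwd) (ob Bwd))"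

lemma colouringD:
  assumes "colouring ob cu ca t"
  shows "t \<noteq> 0" "dual_pair (ob Fwd) (ob Bwd) (cu Fwd) (ca Bwd)"
     "cu Bwd = t \<star> (br (ob Fwd) (ob Bwd) \<bullet> cu Fwd)" "ca Fwd = t \<star> (ca Bwd \<bullet> br (ob Fwd) (ob Bwd))"
  using assms by (auto simp: colouring_def)

lemma colouring_arr:
  assumes "colouring ob cu ca t"
  shows "arr (cu s)" "dm (cu s) = []" "cd (cu s) = ob s @ ob (flip s)"
    "arr (ca s)" "dm (ca s) = ob s @ ob (flip s)" "cd (ca s) = []"
  using dual_pairD(1-6)[OF colouringD(2)[OF assms]] colouringD(3,4)[OF assms]
  by (cases s; simp)+

lemma piece_map_arr:
  assumes "colouring ob cu ca t"
  shows "arr (piece_map ob cu ca g)" "dm (piece_map ob cu ca g) = word ob (bottom_word g)"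
    "cd (piece_map ob cu ca g) = word ob (top_word g)"
  by (cases g; simp add: colouring_arr[OF assms])+

lemma slice_map_arr:
  assumes "colouring ob cu ca t"
  shows "arr (slice_map ob cu ca x)" "dm (slice_map ob cu ca x) = word ob (slice_bottom x)"
    "cd (slice_map ob cu ca x) = word ob (slice_top x)"
  by (cases x; simp add: piece_map_arr[OF assms])+

lemma tangle_map_arr:
  assumes "colouring ob cu ca t" "tangle_diagram w L w'"
  shows "arr (tangle_map ob cu ca w L) \<and> dm (tangle_map ob cu ca w L) = word ob w \<and>
    cd (tangle_map ob cu ca w L) = word ob w'"
  using assms(2)
proof (induction L arbitrary: w)
  case (Cons x L)
  then show ?case using Cons.IH[of "slice_top x"] by (simp add: slice_map_arr[OF assms(1)])
qed auto

text \<open>Bending the leg \<open>v\<close> of \<open>k\<close> and bending it back restores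
  \<open>k\<close>: \<open>n\<close> and \<open>k\<close>, both with empty source, exchange heights,
  and the first zigzag applies.\<close>

lemma scalar_slide:
  assumes "arr k" "dm k = []" "cd k = v @ q" and d: "dual_pair v v' n e"
  shows "(one v \<parallel> ((e \<parallel> one q) \<bullet> (one v' \<parallel> k))) \<bullet> n = k"
proof -
  note [simp] = dual_pairD(1-6)[OF d] assms(1-3)
  have "(one v \<parallel> ((e \<parallel> one q) \<bullet> (one v' \<parallel> k))) \<bullet> n = (one v \<parallel> e \<parallel> one q) \<bullet> ((one (v @ v') \<parallel> k) \<bullet> n)"
    by (simp add: whisker)
  also have "(one (v @ v') \<parallel> k) \<bullet> n = (n \<parallel> one (v @ q)) \<bullet> k"
    using slices1[of n k] slices2[of n k] by simp
  also have "(one v \<parallel> e \<parallel> one q) \<bullet> (n \<parallel> one (v @ q)) \<bullet> k = (((one v \<parallel> e) \<bullet> (n \<parallel> one v)) \<parallel> one q) \<bullet> k"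
    by (simp add: whisker)
  also have "\<dots> = k" by (simp add: dual_pairD(7)[OF d])
  finally show ?thesis .
qed

text \<open>
  The strand of \<open>x\<close> passes over that of \<open>a\<close> at both crossings, so the cap on \<open>a\<close> canonical be pulled down
  below the cup on \<open>x\<close>.
\<close>

lemma over_cup_cap:
  assumes A: "dual_pair a a' nA eA" and X: "dual_pair x x' nX eX"
  shows "(one x \<parallel> eA \<parallel> one x') \<bullet> (one (x @ a') \<parallel> br x' a) \<bullet> (bri x a' \<parallel> one (x' @ a)) \<bullet> (one a' \<parallel> nX \<parallel> one a)
     = nX \<bullet> eA"
proof -
  note [simp] = dual_pairD(1-6)[OF A] dual_pairD(1-6)[OF X]
  have "(bri x a' \<parallel> one x') \<bullet> (one a' \<parallel> nX)
      = ((bri x a' \<bullet> br x a') \<parallel> one x') \<bullet> (one x \<parallel> br x' a') \<bullet> (nX \<parallel> one a')"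
    by (simp add: br_coev_left[of nX x x' a', symmetric] whisker del: bri_br)
  then have 1: "(bri x a' \<parallel> one x') \<bullet> (one a' \<parallel> nX) = (one x \<parallel> br x' a') \<bullet> (nX \<parallel> one a')" by simp
  have "(bri x a' \<parallel> one (x' @ a)) \<bullet> (one a' \<parallel> nX \<parallel> one a) = ((bri x a' \<parallel> one x') \<bullet> (one a' \<parallel> nX)) \<parallel> one a"
    by (simp add: whisker)
  also have "\<dots> = (one x \<parallel> br x' a' \<parallel> one a) \<bullet> (nX \<parallel> one (a' @ a))"
    unfolding 1 by (simp add: whisker)
  finally have "(one x \<parallel> eA \<parallel> one x') \<bullet> (one (x @ a') \<parallel> br x' a) \<bullet> (bri x a' \<parallel> one (x' @ a)) \<bullet> (one a' \<parallel> nX \<parallel> one a)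
     = (one x \<parallel> ((eA \<parallel> one x') \<bullet> br x' (a' @ a))) \<bullet> (nX \<parallel> one (a' @ a))"
    by (simp add: whisker hexagon1)
  also have "(eA \<parallel> one x') \<bullet> br x' (a' @ a) = one x' \<parallel> eA"
    using br_nat_right[of eA x'] by simp
  also have "(one x \<parallel> one x' \<parallel> eA) \<bullet> (nX \<parallel> one (a' @ a)) = nX \<bullet> eA"
    using slices1[of nX eA] slices2[of nX eA] by simp
  finally show ?thesis .
qed

end

text \<open>Only the upward strand of \<open>V\<close> is identified with a pair of strands, by
  \<open>p\<close> and its inverse \<open>pi\<close>; nothing relates the dual of \<open>V\<close>
  to the other duals. The last assumption is the balancing axiom of the twist, read on
  scalars.\<close>

locale cable = strict_braided +
  fixes obA obX obV :: "orient \<Rightarrow> 'b list" and cuA cuX cuV caA caX caV :: "orient \<Rightarrow> 'a"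
    and tA tX tV :: complex and p pi :: 'a and m :: complex
  assumes A: "colouring obA cuA caA tA" and X: "colouring obX cuX caX tX" and V: "colouring obV cuV caV tV"
    and p [simp]: "arr p" "dm p = obV Fwd" "cd p = obA Fwd @ obX Fwd"
    and pi [simp]: "arr pi" "dm pi = obA Fwd @ obX Fwd" "cd pi = obV Fwd"
      "pi \<bullet> p = one (obV Fwd)" "p \<bullet> pi = one (obA Fwd @ obX Fwd)"
    and monodromy: "br (obX Fwd) (obA Fwd) \<bullet> br (obA Fwd) (obX Fwd) = m \<star> one (obA Fwd @ obX Fwd)"
    and twist: "tV = m * tA * tX"
begin

lemmas arrs [simp] = colouring_arr[OF A] colouring_arr[OF X] colouring_arr[OF V]

lemma m_nz: "m \<noteq> 0"
  using colouringD(1)[OF V] twist by auto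

definition mono :: "orient \<Rightarrow> orient \<Rightarrow> complex" where
  "mono s t = (if s = t then m else inverse m)"

lemma monodromies: "br (obX t) (obA s) \<bullet> br (obA s) (obX t) = mono s t \<star> one (obA s @ obX t)"
proof -
  note dA = colouringD(2)[OF A] and dX = colouringD(2)[OF X]
  have FB: "br (obX Bwd) (obA Fwd) \<bullet> br (obA Fwd) (obX Bwd) = inverse m \<star> one (obA Fwd @ obX Bwd)"
    by (rule dual_monodromy[OF dX monodromy m_nz])
  \<comment> \<open>\<open>dual_monodromy\<close> dualises its first strand \<open>x\<close>; to
    dualise \<open>A\<close>, the two strands change roles before and after.\<close>
  have BF: "br (obX Fwd) (obA Bwd) \<bullet> br (obA Bwd) (obX Fwd) = inverse m \<star> one (obA Bwd @ obX Fwd)"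
    by (rule monodromy_swap[OF dual_monodromy[OF dA monodromy_swap[OF monodromy] m_nz]])
  have BB: "br (obX Bwd) (obA Bwd) \<bullet> br (obA Bwd) (obX Bwd) = m \<star> one (obA Bwd @ obX Bwd)"
    using dual_monodromy[OF dX BF] m_nz by simp
  show ?thesis using monodromy FB BF BB by (cases s; cases t) (simp_all add: mono_def)
qed

text \<open>Two cups side by side give the order \<open>A\<close>, dual of \<open>A\<close>,
  \<open>X\<close>, dual of \<open>X\<close>; the crossing exchanges the middle two. It is an
  inverse braiding, so that \<open>X\<close> is on top and \<open>mid\<close> undoes it.\<close>

definition tensor_coev :: 'a where
  "tensor_coev = (one (obA Fwd) \<parallel> bri (obX Fwd) (obA Bwd) \<parallel> one (obX Bwd)) \<bullet> (cuA Fwd \<parallel> cuX Fwd)"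

definition tensor_ev :: 'a where
  "tensor_ev = (caA Bwd \<parallel> caX Bwd) \<bullet> mid (obA Bwd) (obX Bwd) (obA Fwd) (obX Fwd)"

lemma tensor_coev_arr [simp]: "arr tensor_coev" "dm tensor_coev = []" "cd tensor_coev = obA Fwd @ obX Fwd @ obA Bwd @ obX Bwd"
  by (simp_all add: tensor_coev_def)

lemma tensor_ev_arr [simp]: "arr tensor_ev" "dm tensor_ev = obA Bwd @ obX Bwd @ obA Fwd @ obX Fwd" "cd tensor_ev = []"
  by (simp_all add: tensor_ev_def)

lemma mid_tensor_coev: "mid (obA Fwd) (obX Fwd) (obA Bwd) (obX Bwd) \<bullet> tensor_coev = cuA Fwd \<parallel> cuX Fwd"
proof -
  have "mid (obA Fwd) (obX Fwd) (obA Bwd) (obX Bwd) \<bullet> tensor_coev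
    = (one (obA Fwd) \<parallel> (br (obX Fwd) (obA Bwd) \<bullet> bri (obX Fwd) (obA Bwd)) \<parallel> one (obX Bwd)) \<bullet> (cuA Fwd \<parallel> cuX Fwd)"
    by (simp add: mid_def tensor_coev_def whisker del: br_bri)
  then show ?thesis by simp
qed

lemma tensor_zigzag: "(one (obA Fwd @ obX Fwd) \<parallel> tensor_ev) \<bullet> (tensor_coev \<parallel> one (obA Fwd @ obX Fwd)) = one (obA Fwd @ obX Fwd)"
proof -
  let ?a = "obA Fwd" and ?a' = "obA Bwd" and ?x = "obX Fwd" and ?x' = "obX Bwd"
  \<comment> \<open>The region where the cup of \<open>X\<close> meets the cap of \<open>A\<close>.
    Once \<open>over_cup_cap\<close> has separated them, the zigzags of \<open>A\<close> and
    \<open>X\<close> stand side by side.\<close>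
  let ?T = "(one ?x \<parallel> caA Bwd \<parallel> one ?x') \<bullet> (one (?x @ ?a') \<parallel> br ?x' ?a)
    \<bullet> (bri ?x ?a' \<parallel> one (?x' @ ?a)) \<bullet> (one ?a' \<parallel> cuX Fwd \<parallel> one ?a)"
  have T: "?T = cuX Fwd \<bullet> caA Bwd"
    by (rule over_cup_cap[OF colouringD(2)[OF A] colouringD(2)[OF X]])
  have e: "tensor_ev = caX Bwd \<bullet> (caA Bwd \<parallel> one (?x' @ ?x)) \<bullet> mid ?a' ?x' ?a ?x"
    unfolding tensor_ev_def using slices2[of "caA Bwd" "caX Bwd", symmetric] by simp
  have n: "tensor_coev = (one ?a \<parallel> bri ?x ?a' \<parallel> one ?x') \<bullet> (one (?a @ ?a') \<parallel> cuX Fwd) \<bullet> cuA Fwd"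
    unfolding tensor_coev_def using slices2[of "cuA Fwd" "cuX Fwd", symmetric] by simp
  have "(one (?a @ ?x) \<parallel> tensor_ev) \<bullet> (tensor_coev \<parallel> one (?a @ ?x))
     = (one (?a @ ?x) \<parallel> caX Bwd) \<bullet> (one ?a \<parallel> ?T \<parallel> one ?x) \<bullet> (cuA Fwd \<parallel> one (?a @ ?x))"
    unfolding e n mid_def by (simp add: whisker)
  also have "\<dots> = (one ?a \<parallel> ((one ?x \<parallel> caX Bwd) \<bullet> (cuX Fwd \<parallel> one ?x)))
       \<bullet> (((one ?a \<parallel> caA Bwd) \<bullet> (cuA Fwd \<parallel> one ?a)) \<parallel> one ?x)"
    unfolding T by (simp add: whisker)
  also have "\<dots> = one (?a @ ?x)"
    using dual_pairD(7)[OF colouringD(2)[OF A]] dual_pairD(7)[OF colouringD(2)[OF X]] by simp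
  finally show ?thesis .
qed

text \<open>
  On the dual the comparison is the mate of \<open>pi\<close>, so that it carries the coevaluation of \<open>V\<close> to
  \<open>tensor_coev\<close>. Its invertibility is not needed, since only closed diagrams are compared in the end.
\<close>

fun comparison :: "orient \<Rightarrow> 'a" where
  "comparison Fwd = p"
| "comparison Bwd = (caV Bwd \<parallel> one (obA Bwd @ obX Bwd)) \<bullet> (one (obV Bwd) \<parallel> ((pi \<parallel> one (obA Bwd @ obX Bwd)) \<bullet> tensor_coev))"

lemma comparison_arr [simp]: "arr (comparison s)" "dm (comparison s) = obV s" "cd (comparison s) = obA s @ obX s"
  by (cases s; simp)+

lemma cup_comparison: "(one (obV Fwd) \<parallel> comparison Bwd) \<bullet> cuV Fwd = (pi \<parallel> one (obA Bwd @ obX Bwd)) \<bullet> tensor_coev"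
  using scalar_slide[OF _ _ _ colouringD(2)[OF V], of "(pi \<parallel> one (obA Bwd @ obX Bwd)) \<bullet> tensor_coev"] by simp

text \<open>\<open>tensor_ev\<close> slides down past \<open>caV Bwd\<close> and \<open>pi\<close>
  until it meets \<open>tensor_coev\<close>; their zigzag leaves
  \<open>pi \<bullet> p\<close>.\<close>

lemma cap_comparison: "tensor_ev \<bullet> (comparison Bwd \<parallel> p) = caV Bwd"
proof -
  let ?a = "obA Fwd" and ?a' = "obA Bwd" and ?x = "obX Fwd" and ?x' = "obX Bwd"
  let ?k = "one (obV Bwd) \<parallel> tensor_coev \<parallel> p"
  have "comparison Bwd \<parallel> p = (caV Bwd \<parallel> one (?a' @ ?x' @ ?a @ ?x)) \<bullet> (one (obV Bwd) \<parallel> pi \<parallel> one (?a' @ ?x' @ ?a @ ?x)) \<bullet> ?k"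
    using interchange[of "one (obV Bwd) \<parallel> ((pi \<parallel> one (?a' @ ?x')) \<bullet> tensor_coev)" p "caV Bwd \<parallel> one (?a' @ ?x')" "one (?a @ ?x)"]
      interchange3[of "one (obV Bwd)" tensor_coev p "one (obV Bwd)" "pi \<parallel> one (?a' @ ?x')" "one (?a @ ?x)"]
    by simp
  then have "tensor_ev \<bullet> (comparison Bwd \<parallel> p) = tensor_ev \<bullet> (caV Bwd \<parallel> one (dm tensor_ev)) \<bullet> (one (obV Bwd) \<parallel> pi \<parallel> one (dm tensor_ev)) \<bullet> ?k" by simp
  also have "\<dots> = caV Bwd \<bullet> (one (obV Bwd @ obV Fwd) \<parallel> tensor_ev) \<bullet> (one (obV Bwd) \<parallel> pi \<parallel> one (dm tensor_ev)) \<bullet> ?k"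
    using slices1[of "caV Bwd" tensor_ev] cmp_tail[OF slices2[of "caV Bwd" tensor_ev], of "(one (obV Bwd) \<parallel> pi \<parallel> one (dm tensor_ev)) \<bullet> ?k"]
      cmp_tail[OF slices1[of "caV Bwd" tensor_ev], of "(one (obV Bwd) \<parallel> pi \<parallel> one (dm tensor_ev)) \<bullet> ?k"] by simp
  also have "(one (obV Bwd @ obV Fwd) \<parallel> tensor_ev) \<bullet> (one (obV Bwd) \<parallel> pi \<parallel> one (dm tensor_ev)) \<bullet> ?k
     = (one (obV Bwd) \<parallel> pi) \<bullet> (one (obV Bwd) \<parallel> one (?a @ ?x) \<parallel> tensor_ev) \<bullet> ?k"
    using cmp_tail[OF slices2[of "one (obV Bwd) \<parallel> pi" tensor_ev], of ?k]
      cmp_tail[OF slices1[of "one (obV Bwd) \<parallel> pi" tensor_ev], of ?k] by simp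
  also have "?k = (one (obV Bwd) \<parallel> tensor_coev \<parallel> one (?a @ ?x)) \<bullet> (one (obV Bwd) \<parallel> p)"
    using slices1[of "one (obV Bwd) \<parallel> tensor_coev" p] by simp
  also have "(one (obV Bwd) \<parallel> pi) \<bullet> (one (obV Bwd) \<parallel> one (?a @ ?x) \<parallel> tensor_ev) \<bullet> (one (obV Bwd) \<parallel> tensor_coev \<parallel> one (?a @ ?x)) \<bullet> (one (obV Bwd) \<parallel> p)
     = one (obV Bwd) \<parallel> (pi \<bullet> ((one (?a @ ?x) \<parallel> tensor_ev) \<bullet> (tensor_coev \<parallel> one (?a @ ?x))) \<bullet> p)"
    by (simp add: whisker)
  also have "\<dots> = one (obV Bwd @ obV Fwd)" unfolding tensor_zigzag by simp
  finally show ?thesis by simp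
qed

text \<open>Pulls all strands coloured by \<open>X\<close> over and to the right of those coloured by \<open>A\<close>.\<close>

fun split :: "orient list \<Rightarrow> 'a" where
  "split [] = one []"
| "split (s # w) = mid (obA s) (obX s) (word obA w) (word obX w) \<bullet> (comparison s \<parallel> split w)"

lemma split_arr [simp]: "arr (split w)" "dm (split w) = word obV w" "cd (split w) = word obA w @ word obX w"
proof -
  have "arr (split w) \<and> dm (split w) = word obV w \<and> cd (split w) = word obA w @ word obX w"
    by (induction w) simp_all
  then show "arr (split w)" "dm (split w) = word obV w" "cd (split w) = word obA w @ word obX w" by auto
qed

lemma mid_nil [simp]: "mid a x [] [] = one (a @ x)" "mid [] [] a x = one (a @ x)"
  by (simp_all add: mid_def)

text \<open>Compatibility with juxtaposition, which reduces the comparison of a slice to that of its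
  piece. The inductive step is \<open>mid_assoc\<close>.\<close>

lemma split_append: "split (u @ v) = mid (word obA u) (word obX u) (word obA v) (word obX v) \<bullet> (split u \<parallel> split v)"
proof (induction u)
  case (Cons s u)
  let ?A = "word obA" and ?X = "word obX"
  have "split ((s # u) @ v) = mid (obA s) (obX s) (?A u @ ?A v) (?X u @ ?X v) \<bullet>
      (comparison s \<parallel> (mid (?A u) (?X u) (?A v) (?X v) \<bullet> (split u \<parallel> split v)))"
    by (simp add: Cons.IH)
  also have "\<dots> = (mid (obA s) (obX s) (?A u @ ?A v) (?X u @ ?X v) \<bullet>
      (one (obA s @ obX s) \<parallel> mid (?A u) (?X u) (?A v) (?X v))) \<bullet> (comparison s \<parallel> split u \<parallel> split v)"
    using interchange[of "comparison s" "split u \<parallel> split v" "one (obA s @ obX s)" "mid (?A u) (?X u) (?A v) (?X v)"] by simp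
  also have "\<dots> = mid (?A (s # u)) (?X (s # u)) (?A v) (?X v) \<bullet>
      ((mid (obA s) (obX s) (?A u) (?X u) \<parallel> one (?A v @ ?X v)) \<bullet> ((comparison s \<parallel> split u) \<parallel> split v))"
    unfolding mid_assoc by simp
  also have "\<dots> = mid (?A (s # u)) (?X (s # u)) (?A v) (?X v) \<bullet> (split (s # u) \<parallel> split v)"
    by (subst interchange) simp_all
  finally show ?case .
qed simp

text \<open>Naturality of \<open>split\<close> up to the scalar \<open>c\<close>, for the values
  \<open>f\<close>, \<open>g\<close>, \<open>h\<close> of one tangle coloured by \<open>V\<close>,
  \<open>A\<close>, \<open>X\<close>. The ends are part of the relation so that instances can be
  stacked.\<close>

definition splits :: "orient list \<Rightarrow> orient list \<Rightarrow> complex \<Rightarrow> 'a \<Rightarrow> 'a \<Rightarrow> 'a \<Rightarrow> bool" where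
  "splits w w' c f g h \<longleftrightarrow> arr f \<and> dm f = word obV w \<and> cd f = word obV w' \<and>
     arr g \<and> dm g = word obA w \<and> cd g = word obA w' \<and> arr h \<and> dm h = word obX w \<and> cd h = word obX w' \<and>
     split w' \<bullet> f = c \<star> ((g \<parallel> h) \<bullet> split w)"

lemma splitsD:
  assumes "splits w w' c f g h"
  shows "arr f" "dm f = word obV w" "cd f = word obV w'" "arr g" "dm g = word obA w" "cd g = word obA w'"
    "arr h" "dm h = word obX w" "cd h = word obX w'"
    "split w' \<bullet> f = c \<star> ((g \<parallel> h) \<bullet> split w)"
  using assms by (auto simp: splits_def)

lemma splits_one: "splits w w 1 (one (word obV w)) (one (word obA w)) (one (word obX w))"
  by (simp add: splits_def)

lemma splits_cmp:
  assumes "splits w w' c f g h" "splits w' w'' c' f' g' h'"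
  shows "splits w w'' (c' * c) (f' \<bullet> f) (g' \<bullet> g) (h' \<bullet> h)"
proof -
  note [simp] = splitsD(1-9)[OF assms(1)] splitsD(1-9)[OF assms(2)]
  have "split w'' \<bullet> f' \<bullet> f = (split w'' \<bullet> f') \<bullet> f" by simp
  also have "\<dots> = (c' \<star> ((g' \<parallel> h') \<bullet> split w')) \<bullet> f" by (simp add: splitsD(10)[OF assms(2)])
  also have "\<dots> = c' \<star> ((g' \<parallel> h') \<bullet> (split w' \<bullet> f))" by simp
  also have "split w' \<bullet> f = c \<star> ((g \<parallel> h) \<bullet> split w)" by (rule splitsD(10)[OF assms(1)])
  also have "c' \<star> ((g' \<parallel> h') \<bullet> (c \<star> ((g \<parallel> h) \<bullet> split w))) = (c' * c) \<star> (((g' \<parallel> h') \<bullet> (g \<parallel> h)) \<bullet> split w)"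
    by simp
  also have "(g' \<parallel> h') \<bullet> (g \<parallel> h) = (g' \<bullet> g) \<parallel> (h' \<bullet> h)" by (rule interchange) simp_all
  finally have "split w'' \<bullet> f' \<bullet> f = (c' * c) \<star> (((g' \<bullet> g) \<parallel> (h' \<bullet> h)) \<bullet> split w)".
  then show ?thesis unfolding splits_def by simp
qed

lemma splits_tns:
  assumes "splits w w' c f g h" "splits z z' c' f' g' h'"
  shows "splits (w @ z) (w' @ z') (c * c') (f \<parallel> f') (g \<parallel> g') (h \<parallel> h')"
proof -
  note [simp] = splitsD(1-9)[OF assms(1)] splitsD(1-9)[OF assms(2)]
  let ?m = "mid (word obA w') (word obX w') (word obA z') (word obX z')"
  have "split (w' @ z') \<bullet> (f \<parallel> f') = ?m \<bullet> ((split w' \<bullet> f) \<parallel> (split z' \<bullet> f'))"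
    by (simp add: split_append interchange)
  also have "(split w' \<bullet> f) \<parallel> (split z' \<bullet> f') = (c \<star> ((g \<parallel> h) \<bullet> split w)) \<parallel> (c' \<star> ((g' \<parallel> h') \<bullet> split z))"
    by (simp only: splitsD(10)[OF assms(1)] splitsD(10)[OF assms(2)])
  also have "?m \<bullet> \<dots> = (c * c') \<star> ((?m \<bullet> (g \<parallel> h \<parallel> g' \<parallel> h')) \<bullet> (split w \<parallel> split z))"
    by (simp add: interchange[of "split w" "split z" "g \<parallel> h" "g' \<parallel> h'", symmetric] mult.commute)
  also have "?m \<bullet> (g \<parallel> h \<parallel> g' \<parallel> h') = (g \<parallel> g' \<parallel> h \<parallel> h') \<bullet> mid (word obA w) (word obX w) (word obA z) (word obX z)"
    using mid_nat[of g h g' h'] by simp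
  also have "(c * c') \<star> (((g \<parallel> g' \<parallel> h \<parallel> h') \<bullet> mid (word obA w) (word obX w) (word obA z) (word obX z)) \<bullet> (split w \<parallel> split z))
     = (c * c') \<star> (((g \<parallel> g') \<parallel> (h \<parallel> h')) \<bullet> split (w @ z))"
    by (simp add: split_append)
  finally show ?thesis unfolding splits_def by simp
qed

lemma splits_scale:
  assumes "splits w w' c f g h" "x * y \<noteq> 0"
  shows "splits w w' (k * c / (x * y)) (k \<star> f) (x \<star> g) (y \<star> h)"
  using assms unfolding splits_def by (auto simp: field_simps)

text \<open>The four crossings of two doubled strands are listed in \<open>c\<close>. The only one
  out of place has \<open>A\<close> of the first strand above \<open>X\<close> of the second; with
  the shuffle on top it forms a double braiding, whence \<open>mono s t\<close>.\<close>

lemma splits_over: "splits [s, t] [t, s] (mono s t) (br (obV s) (obV t)) (br (obA s) (obA t)) (br (obX s) (obX t))"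
proof -
  let ?a = "obA s" and ?b = "obA t" and ?x = "obX s" and ?y = "obX t"
  have two: "split [s, t] = mid (obA s) (obX s) (obA t) (obX t) \<bullet> (comparison s \<parallel> comparison t)" for s t by simp
  have c: "br (?a @ ?x) (?b @ ?y) = (one ?b \<parallel> br ?a ?y \<parallel> one ?x) \<bullet> (br ?a ?b \<parallel> br ?x ?y) \<bullet> mid ?a ?x ?b ?y"
    by (simp add: mid_def hexagon1 hexagon2 whisker cmp_tail[OF slices2[of "br ?a ?b" "br ?x ?y", simplified]])
  have "split [t, s] \<bullet> br (obV s) (obV t) = mid ?b ?y ?a ?x \<bullet> br (?a @ ?x) (?b @ ?y) \<bullet> (comparison s \<parallel> comparison t)"
    unfolding two using br_nat[of "comparison s" "comparison t"] by simp
  also have "\<dots> = (one ?b \<parallel> (br ?y ?a \<bullet> br ?a ?y) \<parallel> one ?x) \<bullet> (br ?a ?b \<parallel> br ?x ?y) \<bullet> split [s, t]"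
    unfolding two c by (simp add: mid_def whisker)
  also have "\<dots> = mono s t \<star> ((br ?a ?b \<parallel> br ?x ?y) \<bullet> split [s, t])"
    unfolding monodromies by simp
  finally show ?thesis unfolding splits_def by simp
qed

text \<open>The inverse of the over-crossing with the strands exchanged, whence
  \<open>mono t s\<close>.\<close>

lemma splits_under: "splits [s, t] [t, s] (inverse (mono t s)) (bri (obV t) (obV s)) (bri (obA t) (obA s)) (bri (obX t) (obX s))"
proof -
  have nz: "mono t s \<noteq> 0" using m_nz by (simp add: mono_def)
  have o: "split [s, t] \<bullet> br (obV t) (obV s) = mono t s \<star> ((br (obA t) (obA s) \<parallel> br (obX t) (obX s)) \<bullet> split [t, s])"
    using splits_over[of t s] unfolding splits_def by blast
  have "(bri (obA t) (obA s) \<parallel> bri (obX t) (obX s)) \<bullet> split [s, t]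
     = (bri (obA t) (obA s) \<parallel> bri (obX t) (obX s)) \<bullet> (split [s, t] \<bullet> br (obV t) (obV s)) \<bullet> bri (obV t) (obV s)"
    by (simp del: split.simps)
  also have "\<dots> = mono t s \<star> (((bri (obA t) (obA s) \<parallel> bri (obX t) (obX s)) \<bullet> (br (obA t) (obA s) \<parallel> br (obX t) (obX s)))
       \<bullet> split [t, s] \<bullet> bri (obV t) (obV s))"
    unfolding o by (simp del: split.simps)
  also have "\<dots> = mono t s \<star> (split [t, s] \<bullet> bri (obV t) (obV s))"
    by (subst interchange) (simp_all del: split.simps)
  finally show ?thesis unfolding splits_def using nz by (simp del: split.simps)
qed

lemma splits_cup_Fwd: "splits [] [Fwd, Bwd] 1 (cuV Fwd) (cuA Fwd) (cuX Fwd)"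
proof -
  have "split [Fwd, Bwd] \<bullet> cuV Fwd = mid (obA Fwd) (obX Fwd) (obA Bwd) (obX Bwd) \<bullet> (p \<parallel> comparison Bwd) \<bullet> cuV Fwd"
    by (simp del: comparison.simps(2))
  also have "p \<parallel> comparison Bwd = (p \<parallel> one (obA Bwd @ obX Bwd)) \<bullet> (one (obV Fwd) \<parallel> comparison Bwd)"
    using slices1[of p "comparison Bwd"] by (simp del: comparison.simps(2))
  also have "(\<dots>) \<bullet> cuV Fwd = ((p \<bullet> pi) \<parallel> one (obA Bwd @ obX Bwd)) \<bullet> tensor_coev"
    by (simp add: cup_comparison whisker del: comparison.simps(2) pi(4,5))
  also have "mid (obA Fwd) (obX Fwd) (obA Bwd) (obX Bwd) \<bullet> \<dots> = cuA Fwd \<parallel> cuX Fwd"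
    by (simp add: mid_tensor_coev)
  finally show ?thesis unfolding splits_def by (simp del: split.simps)  simp
qed

lemma splits_cap_Bwd: "splits [Bwd, Fwd] [] 1 (caV Bwd) (caA Bwd) (caX Bwd)"
  using cap_comparison by (simp add: splits_def tensor_ev_def del: comparison.simps(2))

text \<open>This turn is the cup \<open>Fwd\<close> followed by an antiparallel crossing. The
  crossing costs \<open>inverse m\<close>, and the twists contribute
  \<open>tV / (tA * tX) = m\<close>, so turns are free.\<close>

lemma splits_cup_Bwd: "splits [] [Bwd, Fwd] 1 (cuV Bwd) (cuA Bwd) (cuX Bwd)"
  using splits_scale[OF splits_cmp[OF splits_cup_Fwd splits_over[of Fwd Bwd]], of tA tX tV]
    colouringD(1,3)[OF A] colouringD(1,3)[OF X] colouringD(1,3)[OF V] m_nz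
  by (simp add: mono_def twist)

lemma splits_cap_Fwd: "splits [Fwd, Bwd] [] 1 (caV Fwd) (caA Fwd) (caX Fwd)"
  using splits_scale[OF splits_cmp[OF splits_over[of Fwd Bwd] splits_cap_Bwd], of tA tX tV]
    colouringD(1,4)[OF A] colouringD(1,4)[OF X] colouringD(1,4)[OF V] m_nz
  by (simp add: mono_def twist)

lemma splits_piece: "splits (bottom_word g) (top_word g) (m powi crossing_sign g)
    (piece_map obV cuV caV g) (piece_map obA cuA caA g) (piece_map obX cuX caX g)"
proof (cases g)
  case (Cup s)
  then show ?thesis using splits_cup_Fwd splits_cup_Bwd by (cases s) simp_all
next
  case (Cap s)
  then show ?thesis using splits_cap_Fwd splits_cap_Bwd by (cases s) simp_all
next
  case (Cross over s t)
  then show ?thesis using splits_over[of s t] splits_under[of s t]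
    by (auto simp: mono_def power_int_minus split: if_splits)
qed

lemma splits_slice: "splits (slice_bottom (u, g, v)) (slice_top (u, g, v)) (m powi crossing_sign g)
    (slice_map obV cuV caV (u, g, v)) (slice_map obA cuA caA (u, g, v)) (slice_map obX cuX caX (u, g, v))"
  using splits_tns[OF splits_one[of u] splits_tns[OF splits_piece[of g] splits_one[of v]]] by simp

lemma splits_tangle: "tangle_diagram w L w' \<Longrightarrow> splits w w' (m powi writhe L)
    (tangle_map obV cuV caV w L) (tangle_map obA cuA caA w L) (tangle_map obX cuX caX w L)"
proof (induction L arbitrary: w)
  case Nil
  then show ?case by (simp add: writhe_def splits_one)
next
  case (Cons x L)
  obtain u g v where x: "x = (u, g, v)" by (cases x)
  have "splits (slice_top x) w' (m powi writhe L) (tangle_map obV cuV caV (slice_top x) L)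
     (tangle_map obA cuA caA (slice_top x) L) (tangle_map obX cuX caX (slice_top x) L)"
    using Cons by simp
  from splits_cmp[OF splits_slice[of u g v, folded x] this] show ?case
    using Cons.prems m_nz by (simp add: x writhe_def power_int_add mult.commute)
qed

text \<open>\<open>split []\<close> is the identity, so on closed diagrams naturality is an equation
  between values.\<close>

theorem cable_link: "link_diagram L \<Longrightarrow> tangle_map obV cuV caV [] L
    = m powi writhe L \<star> (tangle_map obA cuA caA [] L \<parallel> tangle_map obX cuX caX [] L)"
  using splits_tangle[of "[]" L "[]"] unfolding link_diagram_def splits_def by auto

end

section \<open>Link invariants of an invertible object\<close>

text \<open>
  The exponent of \<open>dim X\<close> contributed by a piece: one for each of the two turns built from the twist,
  and one for each crossing because the scalar of the self-braiding is \<open>\<theta> / dim X\<close>.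
\<close>

fun turn_or_crossing :: "piece \<Rightarrow> nat" where
  "turn_or_crossing (Cup s) = (if s = Bwd then 1 else 0)"
| "turn_or_crossing (Cap s) = (if s = Fwd then 1 else 0)"
| "turn_or_crossing (Cross over s t) = 1"

fun sense :: "orient \<Rightarrow> int" where
  "sense Fwd = 1"
| "sense Bwd = -1"

text \<open>\<open>ni\<close> inverts the coevaluation and is not taken from the ribbon structure;
  \<open>loop\<close> measures its difference from the cap \<open>ca Fwd\<close>.\<close>

locale line = strict_braided +
  fixes ob :: "orient \<Rightarrow> 'b list" and cu ca :: "orient \<Rightarrow> 'a" and t :: complex and ni :: 'a and k :: complex
  assumes C: "colouring ob cu ca t"
    and ni [simp]: "arr ni" "dm ni = ob Fwd @ ob Bwd" "cd ni = []"
      "ni \<bullet> cu Fwd = one []" "cu Fwd \<bullet> ni = one (ob Fwd @ ob Bwd)"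
    and self_braiding: "br (ob Fwd) (ob Fwd) = k \<star> one (ob Fwd @ ob Fwd)" and k_nz: "k \<noteq> 0"
begin

lemmas arrs [simp] = colouring_arr[OF C]
lemmas dual = colouringD(2)[OF C]

abbreviation x :: "'b list" where "x \<equiv> ob Fwd"
abbreviation x' :: "'b list" where "x' \<equiv> ob Bwd"
abbreviation n :: 'a where "n \<equiv> cu Fwd"
abbreviation e :: 'a where "e \<equiv> ca Bwd"

lemma e_n_loop: "k \<star> (e \<bullet> br x x' \<bullet> n) = one []"
proof -
  define g where "g = k \<star> (e \<bullet> br x x' \<bullet> n)"
  have g [simp]: "arr g" "dm g = []" "cd g = []" by (simp_all add: g_def)
  \<comment> \<open>\<open>k\<close> is traded for the self-braiding of \<open>x\<close>; the added
    strand then passes over the whole cup and the loop becomes a zigzag.\<close>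
  have "one x \<parallel> g = (one x \<parallel> e) \<bullet> ((one x \<parallel> br x x') \<bullet> (br x x \<parallel> one x') \<bullet> (one x \<parallel> n))"
    unfolding self_braiding g_def by (simp add: whisker)
  also have "\<dots> = one x"
    using dual_pairD(7)[OF dual] by (simp add: br_coev_right)
  \<comment> \<open>An endomorphism of the empty word slides through \<open>x\<close>. Tensored with
    \<open>x'\<close>, it meets \<open>n\<close>, which \<open>ni\<close> can cancel.\<close>
  finally have "g \<parallel> one x = one x" using br_nat_left[of g x] by simp
  moreover have "g \<parallel> one (x @ x') = (g \<parallel> one x) \<parallel> one x'" by simp
  ultimately have "g \<parallel> one (x @ x') = one (x @ x')" by simp
  then have "n \<bullet> g = n" using slices1[of g n] slices2[of g n] by simp
  then have "ni \<bullet> n \<bullet> g = ni \<bullet> n" by simp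
  then have "(ni \<bullet> n) \<bullet> g = one []" by (simp del: ni(4)) simp
  then show ?thesis by (simp add: g_def)
qed

text \<open>Since \<open>ni\<close> inverts \<open>n\<close>, an arrow from \<open>x @ x'\<close> to
  the empty word is determined by its value on \<open>n\<close>, which is
  \<open>e_n_loop\<close>.\<close>

lemma e_br: "e \<bullet> br x x' = inverse k \<star> ni"
proof -
  have "e \<bullet> br x x' = (inverse k \<star> (k \<star> (e \<bullet> br x x' \<bullet> n))) \<bullet> ni" using k_nz by simp
  then show ?thesis unfolding e_n_loop by simp
qed

lemma mono_x_x': "br x' x \<bullet> br x x' = inverse (k * k) \<star> one (x @ x')"
  by (rule dual_monodromy[OF dual]) (simp_all add: self_braiding k_nz)

lemma ni_br: "ni \<bullet> br x' x = inverse k \<star> e"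
proof -
  have "ni \<bullet> br x' x = (k \<star> (inverse k \<star> ni)) \<bullet> br x' x" using k_nz by simp
  also have "\<dots> = k \<star> (e \<bullet> (br x x' \<bullet> br x' x))" unfolding e_br[symmetric] by simp
  also have "\<dots> = inverse k \<star> e" unfolding monodromy_swap[OF mono_x_x'] using k_nz by (simp add: field_simps)
  finally show ?thesis .
qed

text \<open>The twist computes the same arrow in \<open>twist_coev\<close>; comparison of the two
  will give \<open>t * t = k * k\<close>.\<close>

lemma balance: "(br x' x \<bullet> br x x' \<bullet> n) = inverse (k * k) \<star> n"
proof -
  have "br x' x \<bullet> br x x' \<bullet> n = (br x' x \<bullet> br x x') \<bullet> n" by simp
  then show ?thesis unfolding mono_x_x' by simp
qed

lemma bri_x_x': "bri x x' = k \<star> (n \<bullet> e)"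
proof -
  have "k \<star> (n \<bullet> e) = (k \<star> (n \<bullet> (e \<bullet> br x x'))) \<bullet> bri x x'" by simp
  also have "\<dots> = bri x x'" unfolding e_br using k_nz by simp
  finally show ?thesis ..
qed

text \<open>With the first \<open>x'\<close> bent up, the crossing becomes the inverse crossing of
  \<open>x\<close> and \<open>x'\<close>, which \<open>bri_x_x'\<close> cuts open; a zigzag leaves
  \<open>k\<close>.\<close>

lemma br_x'_x': "br x' x' = k \<star> one (x' @ x')"
proof (rule dual_cancel[OF dual, rotated -1])
  have "(one x \<parallel> br x' x') \<bullet> (n \<parallel> one x')
      = (bri x x' \<parallel> one x') \<bullet> ((br x x' \<parallel> one x') \<bullet> (one x \<parallel> br x' x') \<bullet> (n \<parallel> one x'))"
    using cmp_tail[OF whisker(2)[of "br x x'" "bri x x'" x', symmetric], of "(one x \<parallel> br x' x') \<bullet> (n \<parallel> one x')"] by simp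
  also have "\<dots> = (bri x x' \<parallel> one x') \<bullet> (one x' \<parallel> n)" by (simp add: br_coev_left)
  also have "\<dots> = k \<star> ((n \<parallel> one x') \<bullet> ((e \<parallel> one x') \<bullet> (one x' \<parallel> n)))"
    unfolding bri_x_x' by (simp add: whisker)
  also have "\<dots> = (one x \<parallel> (k \<star> one (x' @ x'))) \<bullet> (n \<parallel> one x')"
    using dual_pairD(8)[OF dual] by simp
  finally show "(one x \<parallel> br x' x') \<bullet> (n \<parallel> one x') = (one x \<parallel> (k \<star> one (x' @ x'))) \<bullet> (n \<parallel> one x')" .
qed simp_all

text \<open>By the zigzag, \<open>one x \<parallel> e\<close> is a left inverse of
  \<open>n \<parallel> one x\<close>, whose inverse is \<open>ni \<parallel> one x\<close>. So the
  middle letter of \<open>x x' x\<close> cancels equally well with either neighbour.\<close>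

lemma x_e: "one x \<parallel> e = ni \<parallel> one x"
proof -
  have "one x \<parallel> e = (one x \<parallel> e) \<bullet> ((n \<bullet> ni) \<parallel> one x)" by simp
  also have "\<dots> = ((one x \<parallel> e) \<bullet> (n \<parallel> one x)) \<bullet> (ni \<parallel> one x)" by (simp add: whisker del: ni(5))
  finally show ?thesis using dual_pairD(7)[OF dual] by simp
qed

lemma x'_ni: "one x' \<parallel> ni = e \<parallel> one x'"
proof -
  have "e \<parallel> one x' = (e \<parallel> one x') \<bullet> (one x' \<parallel> (n \<bullet> ni))" by simp
  also have "\<dots> = ((e \<parallel> one x') \<bullet> (one x' \<parallel> n)) \<bullet> (one x' \<parallel> ni)" by (simp add: whisker del: ni(5))
  finally show ?thesis using dual_pairD(8)[OF dual] by simp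
qed

section \<open>Reduction of words to powers of one letter\<close>

definition pow :: "int \<Rightarrow> 'b list" where
  "pow i = concat (replicate (nat i) x) @ concat (replicate (nat (- i)) x')"

lemma pow_0 [simp]: "pow 0 = []" by (simp add: pow_def)

lemma pow_Suc: "i \<ge> 0 \<Longrightarrow> pow (i + 1) = x @ pow i"
  by (simp add: pow_def nat_add_distrib)

lemma pow_Suc': "i > 0 \<Longrightarrow> pow i = x @ pow (i - 1)"
  using pow_Suc[of "i - 1"] by simp

lemma pow_pred: "i \<le> 0 \<Longrightarrow> pow (i - 1) = x' @ pow i"
proof -
  assume "i \<le> 0"
  then have "nat (- (i - 1)) = Suc (nat (- i))" by simp
  with \<open>i \<le> 0\<close> show ?thesis by (simp add: pow_def)
qed

lemma pow_pred': "i < 0 \<Longrightarrow> pow i = x' @ pow (i + 1)"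
  using pow_pred[of "i + 1"] by simp

text \<open>
  \<open>absorb\<close> multiplies a power of \<open>x\<close> by \<open>x\<close> or \<open>x'\<close>, cancelling with \<open>ni\<close> or \<open>e\<close> where possible; by the
  zigzag identities an adjacent pair \<open>x x'\<close> or \<open>x' x\<close> is absorbed in the same way next to every power.
\<close>

fun absorb :: "orient \<Rightarrow> int \<Rightarrow> 'a" where
  "absorb Fwd i = (if i \<ge> 0 then one (pow (i + 1)) else ni \<parallel> one (pow (i + 1)))"
| "absorb Bwd i = (if i \<le> 0 then one (pow (i - 1)) else e \<parallel> one (pow (i - 1)))"

lemma absorb_arr [simp]: "arr (absorb s i)" "dm (absorb s i) = ob s @ pow i" "cd (absorb s i) = pow (i + sense s)"
  by (cases s; simp add: pow_Suc pow_Suc' pow_pred pow_pred')+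

definition absorb2 :: "orient \<Rightarrow> orient \<Rightarrow> int \<Rightarrow> 'a" where
  "absorb2 s r i = absorb s (i + sense r) \<bullet> (one (ob s) \<parallel> absorb r i)"

lemma absorb2_arr [simp]: "arr (absorb2 s r i)" "dm (absorb2 s r i) = ob s @ ob r @ pow i"
    "cd (absorb2 s r i) = pow (i + sense r + sense s)"
  by (simp_all add: absorb2_def)

lemma absorb2_FB: "absorb2 Fwd Bwd i = ni \<parallel> one (pow i)"
proof (cases "i \<le> 0")
  case True
  then show ?thesis by (simp add: absorb2_def pow_pred)
next
  case False
  then show ?thesis
    using tns_assoc[of "one x" e "one (pow (i - 1))"] by (simp add: absorb2_def x_e pow_Suc' [of i])
qed

lemma absorb2_BF: "absorb2 Bwd Fwd i = e \<parallel> one (pow i)"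
proof (cases "i \<ge> 0")
  case True
  then show ?thesis by (simp add: absorb2_def pow_Suc)
next
  case False
  then show ?thesis
    using tns_assoc[of "one x'" ni "one (pow (i + 1))"] by (simp add: absorb2_def x'_ni pow_pred' [of i])
qed

text \<open>An antiparallel crossing changes the word and is not itself a scalar; it becomes one
  because both words are absorbed into the same power.\<close>

lemma absorb2_over: "absorb2 r s i \<bullet> (br (ob s) (ob r) \<parallel> one (pow i)) = (if s = r then k else inverse k) \<star> absorb2 s r i"
proof (cases s)
  case Fwd
  then show ?thesis
  proof (cases r)
    case r: Fwd
    show ?thesis unfolding Fwd r self_braiding by simp
  next
    case r: Bwd
    have "absorb2 Bwd Fwd i \<bullet> (br x x' \<parallel> one (pow i)) = (e \<bullet> br x x') \<parallel> one (pow i)"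
      by (simp add: absorb2_BF whisker)
    then show ?thesis unfolding Fwd r e_br by (simp add: absorb2_FB)
  qed
next
  case Bwd
  then show ?thesis
  proof (cases r)
    case r: Bwd
    show ?thesis unfolding Bwd r br_x'_x' by simp
  next
    case r: Fwd
    have "absorb2 Fwd Bwd i \<bullet> (br x' x \<parallel> one (pow i)) = (ni \<bullet> br x' x) \<parallel> one (pow i)"
      by (simp add: absorb2_FB whisker)
    then show ?thesis unfolding Bwd r ni_br by (simp add: absorb2_BF)
  qed
qed

lemma absorb2_under: "absorb2 r s i \<bullet> (bri (ob r) (ob s) \<parallel> one (pow i)) = (if s = r then inverse k else k) \<star> absorb2 s r i"
proof -
  let ?c = "if s = r then k else inverse k"
  have "absorb2 s r i = absorb2 s r i \<bullet> ((br (ob r) (ob s) \<bullet> bri (ob r) (ob s)) \<parallel> one (pow i))" by simp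
  also have "\<dots> = (absorb2 s r i \<bullet> (br (ob r) (ob s) \<parallel> one (pow i))) \<bullet> (bri (ob r) (ob s) \<parallel> one (pow i))"
    by (simp add: whisker del: br_bri)
  also have "\<dots> = ?c \<star> (absorb2 r s i \<bullet> (bri (ob r) (ob s) \<parallel> one (pow i)))"
    unfolding absorb2_over by (auto split: if_splits)
  finally have "inverse ?c \<star> absorb2 s r i = inverse ?c \<star> (?c \<star> (absorb2 r s i \<bullet> (bri (ob r) (ob s) \<parallel> one (pow i))))"
    by (rule arg_cong)
  then show ?thesis using k_nz by (auto split: if_splits)
qed

definition deg :: "orient list \<Rightarrow> int" where "deg w = sum_list (map sense w)"

lemma deg_simps [simp]: "deg [] = 0" "deg (s # w) = sense s + deg w" by (simp_all add: deg_def)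

text \<open>The word is absorbed from the right, so that a piece with the strands \<open>v\<close>
  on its right stands next to the single power \<open>pow (deg v)\<close>.\<close>

fun normal :: "orient list \<Rightarrow> 'a" where
  "normal [] = one []"
| "normal (s # w) = absorb s (deg w) \<bullet> (one (ob s) \<parallel> normal w)"

lemma normal_arr [simp]: "arr (normal w)" "dm (normal w) = word ob w" "cd (normal w) = pow (deg w)"
proof -
  have "arr (normal w) \<and> dm (normal w) = word ob w \<and> cd (normal w) = pow (deg w)"
    by (induction w) (simp_all add: add.commute)
  then show "arr (normal w)" "dm (normal w) = word ob w" "cd (normal w) = pow (deg w)" by auto
qed

lemma normal2: "normal (s # r # w) = absorb2 s r (deg w) \<bullet> (one (ob s @ ob r) \<parallel> normal w)"
  by (simp add: absorb2_def whisker add.commute)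

fun factor :: "piece \<Rightarrow> complex" where
  "factor (Cross over s r) = k powi crossing_sign (Cross over s r)"
| "factor g = (t / k) ^ turn_or_crossing g"

text \<open>The constant \<open>t / k\<close> will be \<open>qdim\<close>, since it is the value of
  \<open>ca Fwd \<bullet> cu Fwd\<close>.\<close>

lemma loop: "ni \<bullet> cu Fwd = one []" "e \<bullet> cu Bwd = (t / k) \<star> one []" "ca Fwd = (t / k) \<star> ni"
proof -
  have "e \<bullet> cu Bwd = t \<star> ((e \<bullet> br x x') \<bullet> n)" by (simp add: colouringD(3)[OF C])
  then show "e \<bullet> cu Bwd = (t / k) \<star> one []" unfolding e_br by (simp add: divide_inverse)
  show "ca Fwd = (t / k) \<star> ni"
    unfolding colouringD(4)[OF C] e_br by (simp add: divide_inverse)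
qed simp

lemma normal_piece: "normal (top_word g @ v) \<bullet> (piece_map ob cu ca g \<parallel> one (word ob v))
    = factor g \<star> normal (bottom_word g @ v)"
proof (cases g)
  case (Cup s)
  have "normal (s # flip s # v) \<bullet> (cu s \<parallel> one (word ob v)) = absorb2 s (flip s) (deg v) \<bullet> (cu s \<parallel> one (pow (deg v))) \<bullet> normal v"
    using slices1[of "cu s" "normal v"] slices2[of "cu s" "normal v"] by (simp add: normal2 del: normal.simps)
  also have "\<dots> = (absorb2 s (flip s) (deg v) \<bullet> (cu s \<parallel> one (pow (deg v)))) \<bullet> normal v"
    by (cases s) (simp_all add: algebra_simps)
  also have "absorb2 s (flip s) (deg v) \<bullet> (cu s \<parallel> one (pow (deg v))) = factor (Cup s) \<star> one (pow (deg v))"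
    using loop whisker(2)[of "cu s" ni "pow (deg v)", symmetric] whisker(2)[of "cu s" e "pow (deg v)", symmetric]
    by (cases s) (simp_all add: absorb2_FB absorb2_BF)
  finally show ?thesis by (simp add: Cup del: normal.simps)
next
  case (Cap s)
  have "normal v \<bullet> (ca s \<parallel> one (word ob v)) = (ca s \<parallel> one (pow (deg v))) \<bullet> (one (ob s @ ob (flip s)) \<parallel> normal v)"
    using slices1[of "ca s" "normal v"] slices2[of "ca s" "normal v"] by simp
  also have "ca s \<parallel> one (pow (deg v)) = factor (Cap s) \<star> absorb2 s (flip s) (deg v)"
    using loop(3) by (cases s) (simp_all add: absorb2_FB absorb2_BF)
  finally show ?thesis by (simp add: Cap normal2 del: normal.simps)
next
  case (Cross over s r)
  let ?g = "piece_map ob cu ca (Cross over s r)"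
  have g: "arr ?g" "dm ?g = ob s @ ob r" "cd ?g = ob r @ ob s" by simp_all
  have "normal (r # s # v) \<bullet> (?g \<parallel> one (word ob v)) = (absorb2 r s (deg v) \<bullet> (?g \<parallel> one (pow (deg v)))) \<bullet> (one (ob s @ ob r) \<parallel> normal v)"
    using slices1[of ?g "normal v"] slices2[of ?g "normal v"] by (simp add: normal2 g del: normal.simps piece_map.simps)
  also have "absorb2 r s (deg v) \<bullet> (?g \<parallel> one (pow (deg v))) = factor (Cross over s r) \<star> absorb2 s r (deg v)"
    using absorb2_over[of r s "deg v"] absorb2_under[of r s "deg v"] by (auto simp: power_int_minus)
  finally show ?thesis by (simp add: Cross normal2 del: normal.simps factor.simps)
qed

lemma deg_append [simp]: "deg (u @ v) = deg u + deg v" by (simp add: deg_def)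

lemma deg_piece: "deg (top_word g) = deg (bottom_word g)"
proof -
  have "sense (flip s) = - sense s" for s by (cases s) simp_all
  then show ?thesis by (cases g) simp_all
qed

lemma normal_slice: "normal (slice_top (u, g, v)) \<bullet> slice_map ob cu ca (u, g, v)
    = factor g \<star> normal (slice_bottom (u, g, v))"
proof (induction u)
  case Nil
  then show ?case using normal_piece[of g v] by (simp add: piece_map_arr[OF C])
next
  case (Cons s u)
  have "normal (slice_top (s # u, g, v)) \<bullet> slice_map ob cu ca (s # u, g, v)
     = absorb s (deg (slice_bottom (u, g, v))) \<bullet> (one (ob s) \<parallel> (normal (slice_top (u, g, v)) \<bullet> slice_map ob cu ca (u, g, v)))"
    by (simp add: whisker piece_map_arr[OF C] deg_piece)
  also have "\<dots> = factor g \<star> normal (slice_bottom (s # u, g, v))"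
    unfolding Cons by simp
  finally show ?case .
qed

lemma normal_tangle: "tangle_diagram w L w' \<Longrightarrow> normal w' \<bullet> tangle_map ob cu ca w L
    = (\<Prod>(u, g, v) \<leftarrow> L. factor g) \<star> normal w"
proof (induction L arbitrary: w)
  case (Cons x L)
  obtain u g v where x: "x = (u, g, v)" by (cases x)
  have L: "tangle_diagram (slice_top x) L w'" and w: "slice_bottom x = w" using Cons.prems by simp_all
  note [simp] = slice_map_arr[OF C] conjunct1[OF tangle_map_arr[OF C L]]
    conjunct1[OF conjunct2[OF tangle_map_arr[OF C L]]] conjunct2[OF conjunct2[OF tangle_map_arr[OF C L]]]
  have "normal w' \<bullet> tangle_map ob cu ca w (x # L) = (normal w' \<bullet> tangle_map ob cu ca (slice_top x) L) \<bullet> slice_map ob cu ca x"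
    by (simp del: slice_map.simps slice_top.simps)
  also have "\<dots> = (\<Prod>(u, g, v) \<leftarrow> L. factor g) \<star> (normal (slice_top x) \<bullet> slice_map ob cu ca x)"
    unfolding Cons.IH[OF L] by (simp del: slice_map.simps slice_top.simps)
  also have "normal (slice_top x) \<bullet> slice_map ob cu ca x = factor g \<star> normal w"
    unfolding w[symmetric] x by (rule normal_slice)
  finally show ?case by (simp add: x mult.commute)
qed simp

text \<open>Under the hypothesis \<open>t / k\<close> has square one, so
  \<open>k = t * (t / k)\<close> and \<open>inverse k = inverse t * (t / k)\<close>. This splits off
  the power of \<open>t\<close> that the framing correction cancels from an exponent that matters
  only modulo two.\<close>

lemma prod_factor:
  assumes "t * t = k * k"
  shows "(\<Prod>(u, g, v) \<leftarrow> L. factor g) = t powi writhe L * (t / k) ^ (\<Sum>(u, g, v) \<leftarrow> L. turn_or_crossing g)"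
proof (induction L)
  case (Cons x L)
  obtain u g v where x: "x = (u, g, v)" by (cases x)
  have t: "t \<noteq> 0" by (rule colouringD(1)[OF C])
  have "factor g = t powi crossing_sign g * (t / k) ^ turn_or_crossing g"
    using t k_nz assms by (cases g) (simp_all add: power_int_minus field_simps)
  then show ?case using Cons t k_nz by (simp add: x writhe_def power_int_add power_add)
qed (simp add: writhe_def)

theorem line_link:
  assumes "t * t = k * k" "link_diagram L"
  shows "tangle_map ob cu ca [] L
    = (t powi writhe L * (t / k) ^ (\<Sum>(u, g, v) \<leftarrow> L. turn_or_crossing g)) \<star> one []"
  using normal_tangle[of "[]" L "[]"] tangle_map_arr[OF C, of "[]" L "[]"] assms(2)
  unfolding link_diagram_def prod_factor[OF assms(1)] by simp

end

section \<open>Orbits and inversions of a permutation\<close>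

definition tournament :: "'a set \<Rightarrow> ('a \<Rightarrow> 'a \<Rightarrow> bool) \<Rightarrow> bool" where
  "tournament P l \<longleftrightarrow> (\<forall>p\<in>P. \<not> l p p) \<and> (\<forall>p\<in>P. \<forall>q\<in>P. p \<noteq> q \<longrightarrow> (l p q \<longleftrightarrow> \<not> l q p))"

definition inversions :: "'a set \<Rightarrow> ('a \<Rightarrow> 'a \<Rightarrow> bool) \<Rightarrow> ('a \<Rightarrow> 'a \<Rightarrow> bool) \<Rightarrow> nat" where
  "inversions P l m = (\<Sum>p\<in>P. \<Sum>q\<in>P. of_bool (l p q \<and> m q p))"

lemma tournament_mono: "tournament P l \<Longrightarrow> Q \<subseteq> P \<Longrightarrow> tournament Q l"
  by (auto simp: tournament_def)

lemma tournament_pullback: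
  assumes "tournament P m" "inj_on s Q" "s ` Q \<subseteq> P"
  shows "tournament Q (\<lambda>p q. m (s p) (s q))"
  using assms unfolding tournament_def by (metis image_subset_iff inj_onD)

lemma inversions_cong:
  "(\<And>p q. p \<in> P \<Longrightarrow> q \<in> P \<Longrightarrow> l p q = l' p q) \<Longrightarrow> (\<And>p q. p \<in> P \<Longrightarrow> q \<in> P \<Longrightarrow> m p q = m' p q)
   \<Longrightarrow> inversions P l m = inversions P l' m'"
  unfolding inversions_def by (intro sum.cong) auto

lemma inversions_insert:
  assumes "finite P" "c \<notin> P" "tournament (insert c P) l" "tournament (insert c P) m"
  shows "inversions (insert c P) l m = inversions P l m + (\<Sum>q\<in>P. of_bool (l c q \<noteq> m c q))"
proof -
  have c: "\<not> l c c" using assms(3) by (auto simp: tournament_def)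
  have "of_bool (l c q \<and> m q c) + of_bool (l q c \<and> m c q) = (of_bool (l c q \<noteq> m c q) :: nat)" if "q \<in> P" for q
  proof -
    have "c \<noteq> q" using that assms(2) by auto
    then have "l q c \<longleftrightarrow> \<not> l c q" "m q c \<longleftrightarrow> \<not> m c q"
      using assms(3,4) that unfolding tournament_def by blast+
    then show ?thesis by auto
  qed
  then have "(\<Sum>q\<in>P. of_bool (l c q \<and> m q c)) + (\<Sum>q\<in>P. of_bool (l q c \<and> m c q))
      = (\<Sum>q\<in>P. of_bool (l c q \<noteq> m c q) :: nat)"
    unfolding sum.distrib[symmetric] by (intro sum.cong) auto
  then show ?thesis using assms(1,2) c
    by (simp add: inversions_def sum.distrib del: sum_of_bool_eq)
qed

lemma inversions_swap:
  assumes P: "finite P" "a \<in> P" "b \<in> P" "a \<noteq> b" and t: "tournament P l" "tournament P m"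
    and s: "\<And>x. s x = (if x = a then b else if x = b then a else x)"
  shows "odd (inversions P l m + inversions P l (\<lambda>p q. m (s p) (s q)))"
proof -
  define Q where "Q = P - {a, b}"
  have Q: "finite Q" "a \<notin> insert b Q" "b \<notin> Q" "P = insert a (insert b Q)"
    using P by (auto simp: Q_def)
  define m' where "m' = (\<lambda>p q. m (s p) (s q))"
  have t': "tournament P m'" unfolding m'_def
    by (rule tournament_pullback[OF t(2)]) (use P in \<open>auto simp: inj_on_def s split: if_splits\<close>)
  have ab: "m' a b \<longleftrightarrow> \<not> m a b"
  proof -
    have "m' a b = m b a" using P(4) by (simp add: m'_def s)
    then show ?thesis using t(2) P(2-4) unfolding tournament_def by metis
  qed
  have m': "m' a q = m b q" "m' b q = m a q" if "q \<in> Q" for q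
    using that Q(2,3) by (auto simp: m'_def s)
  have base: "inversions Q l m' = inversions Q l m"
    using Q(2,3) by (intro inversions_cong) (auto simp: m'_def s)
  have split: "inversions P l k = inversions Q l k + of_bool (l a b \<noteq> k a b)
       + ((\<Sum>q\<in>Q. of_bool (l b q \<noteq> k b q)) + (\<Sum>q\<in>Q. of_bool (l a q \<noteq> k a q)))"
    if "tournament P k" for k
  proof -
    have 1: "tournament (insert b Q) l" "tournament (insert b Q) k"
      using t(1) that Q(4) by (blast intro: tournament_mono)+
    show ?thesis
      using inversions_insert[of "insert b Q" a l k] inversions_insert[OF Q(1,3) 1] t(1) that Q
      by simp
  qed
  \<comment> \<open>The contribution of the pairs with one member in \<open>{a, b}\<close>. The swap
    exchanges \<open>m a q\<close> and \<open>m b q\<close>, so each \<open>q\<close> contributes to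
    \<open>D m + D m'\<close> four comparisons in which every truth value occurs twice: an even
    number.\<close>
  define D where "D k = (\<Sum>q\<in>Q. of_bool (l b q \<noteq> k b q)) + (\<Sum>q\<in>Q. of_bool (l a q \<noteq> k a q) :: nat)" for k
  have "D m + D m' = (\<Sum>q\<in>Q. of_bool (l b q \<noteq> m b q) + of_bool (l a q \<noteq> m a q)
      + (of_bool (l b q \<noteq> m a q) + of_bool (l a q \<noteq> m b q)))"
    unfolding D_def sum.distrib using m' by simp
  also have "even \<dots>" by (rule dvd_sum) auto
  finally have "even (D m + D m')" .
  then show ?thesis
    unfolding m'_def[symmetric] split[OF t(2)] split[OF t'] base D_def[symmetric] using ab by auto
qed

section \<open>Orbits of a permutation\<close>

definition successor_rel :: "'a set \<Rightarrow> ('a \<Rightarrow> 'a) \<Rightarrow> ('a \<times> 'a) set" where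
  "successor_rel P f = {(x, f x) | x. x \<in> P}"

text \<open>The same closure as in \<open>num_components\<close>, so that components become orbits
  as soon as the underlying symmetric relations agree.\<close>

definition orbit_rel :: "'a set \<Rightarrow> ('a \<Rightarrow> 'a) \<Rightarrow> ('a \<times> 'a) set" where
  "orbit_rel P f = (successor_rel P f \<union> (successor_rel P f)\<inverse>)\<^sup>*"

lemma orbit_rel_sym: "(x, y) \<in> orbit_rel P f \<Longrightarrow> (y, x) \<in> orbit_rel P f"
  unfolding orbit_rel_def by (metis converse_Un converse_converse rtrancl_converseD sup_commute)

lemma orbit_rel_trans: "(x, y) \<in> orbit_rel P f \<Longrightarrow> (y, z) \<in> orbit_rel P f \<Longrightarrow> (x, z) \<in> orbit_rel P f"
  unfolding orbit_rel_def by (rule rtrancl_trans)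

lemma orbit_rel_refl [simp]: "(x, x) \<in> orbit_rel P f"
  unfolding orbit_rel_def by simp

lemma orbit_rel_step: "x \<in> P \<Longrightarrow> (x, f x) \<in> orbit_rel P f"
  unfolding orbit_rel_def successor_rel_def by auto

lemma orbit_class_eq: "orbit_rel P f `` {x} = orbit_rel P f `` {y} \<longleftrightarrow> (x, y) \<in> orbit_rel P f"
  by (auto intro: orbit_rel_sym orbit_rel_trans)

lemma orbit_rel_induct:
  assumes "(x, y) \<in> orbit_rel P f" and "\<And>x. r x x"
    and "\<And>x y. r x y \<Longrightarrow> r y x" and "\<And>x y z. r x y \<Longrightarrow> r y z \<Longrightarrow> r x z"
    and "\<And>x. x \<in> P \<Longrightarrow> r x (f x)"
  shows "r x y"
  using assms(1) unfolding orbit_rel_def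
proof (induction rule: rtrancl_induct)
  case (step y z)
  then have "r y z" using assms(3,5) by (auto simp: successor_rel_def)
  with step assms(4) show ?case by blast
qed (rule assms)

lemma quotient_image: "P // r = (\<lambda>x. r `` {x}) ` P"
  by (auto simp: quotient_def)

lemma card_image_kernel:
  assumes "\<And>x y. x \<in> A \<Longrightarrow> y \<in> A \<Longrightarrow> f x = f y \<longleftrightarrow> g x = g y"
  shows "card (f ` A) = card (g ` A)"
proof -
  have h: "f (inv_into A g (g x)) = f x" if "x \<in> A" for x
    using assms[OF inv_into_into[of "g x" g A] that] f_inv_into_f[of "g x" g A] that by auto
  have "bij_betw (\<lambda>c. f (inv_into A g c)) (g ` A) (f ` A)"
    unfolding bij_betw_def inj_on_def image_image by (auto simp: h assms)
  then show ?thesis by (metis bij_betw_same_card)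
qed

text \<open>\<open>g\<close> bypasses \<open>p\<close>: the predecessor \<open>a\<close> is sent
  straight to \<open>f p\<close>. The old orbit survives through \<open>a\<close>, and
  \<open>p\<close> forms a new one.\<close>

lemma card_orbits_fix:
  assumes P: "finite P" "inj_on f P" "f ` P \<subseteq> P" and a: "a \<in> P" "f a = p" "a \<noteq> p"
    and g: "\<And>x. g x = (if x = a then f p else if x = p then p else f x)"
  shows "card (P // orbit_rel P g) = Suc (card (P // orbit_rel P f))"
proof -
  have p: "p \<in> P" using P(3) a by auto
  have fp: "f p \<noteq> p" using P(2) a p by (metis inj_onD)
  have other: "f x \<noteq> p" if "x \<in> P" "x \<noteq> a" for x using P(2) a that by (metis inj_onD)
  have sub: "(x, y) \<in> orbit_rel P f" if "(x, y) \<in> orbit_rel P g" for x y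
    using that
  proof (rule orbit_rel_induct)
    fix x assume "x \<in> P"
    then show "(x, g x) \<in> orbit_rel P f"
      using orbit_rel_step[of _ P f] a p by (auto simp: g intro: orbit_rel_trans)
  qed (auto intro: orbit_rel_sym orbit_rel_trans)
  \<comment> \<open>Replaces \<open>p\<close> by its predecessor, which stays in the old orbit;
    steps of \<open>f\<close> thereby become paths of \<open>g\<close>.\<close>
  define c where "c x = (if x = p then a else x)" for x
  have sup: "(c x, c y) \<in> orbit_rel P g" if "(x, y) \<in> orbit_rel P f" for x y
    using that
  proof (rule orbit_rel_induct)
    fix x assume x: "x \<in> P"
    consider "x = a" | "x = p" | "x \<noteq> a" "x \<noteq> p" by blast
    then show "(c x, c (f x)) \<in> orbit_rel P g"
    proof cases
      case 1
      then show ?thesis using a by (simp add: c_def)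
    next
      case 2
      then show ?thesis using orbit_rel_step[OF a(1), of g] fp a(3) by (simp add: c_def g)
    next
      case 3
      then show ?thesis using orbit_rel_step[OF x, of g] other[OF x] by (simp add: c_def g)
    qed
  qed (auto intro: orbit_rel_sym orbit_rel_trans)
  have iso: "y = p \<longleftrightarrow> x = p" if "(x, y) \<in> orbit_rel P g" for x y
    using that by (rule orbit_rel_induct) (use other fp a in \<open>auto simp: g\<close>)
  let ?F = "\<lambda>x. orbit_rel P f `` {x}" and ?G = "\<lambda>x. orbit_rel P g `` {x}"
  have "card (?F ` (P - {p})) = card (?G ` (P - {p}))"
  proof (rule card_image_kernel)
    fix x y assume "x \<in> P - {p}" "y \<in> P - {p}"
    then show "?F x = ?F y \<longleftrightarrow> ?G x = ?G y"
      unfolding orbit_class_eq using sub sup[of x y] by (auto simp: c_def)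
  qed
  moreover have "?F ` (P - {p}) = ?F ` P"
  proof -
    have "?F p = ?F a" unfolding orbit_class_eq using orbit_rel_step[OF a(1), of f] a(2) orbit_rel_sym by metis
    then have "?F p \<in> ?F ` (P - {p})" using a by auto
    moreover have "?F ` P = insert (?F p) (?F ` (P - {p}))" using p by auto
    ultimately show ?thesis by auto
  qed
  moreover have "?G ` P = insert (?G p) (?G ` (P - {p}))" using p by auto
  moreover have "?G p \<notin> ?G ` (P - {p})"
  proof
    assume "?G p \<in> ?G ` (P - {p})"
    then obtain x where "x \<in> P - {p}" "?G p = ?G x" by blast
    then show False using iso[of p x] unfolding orbit_class_eq by auto
  qed
  ultimately show ?thesis using P(1) by (simp add: quotient_image)
qed

text \<open>
  The sign of a permutation is determined both by its inversions and by its number of orbits. Domain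
  and codomain may be ordered differently, at the price of the inversions between the two orders;
  transitivity of the orders plays no role.
\<close>

theorem orbits_parity:
  assumes "finite P" "bij_betw f P P" "tournament P l" "tournament P m"
  shows "even (inversions P l (\<lambda>p q. m (f p) (f q)) + inversions P l m + card P + card (P // orbit_rel P f))"
  using assms(2)
proof (induction "card {x \<in> P. f x \<noteq> x}" arbitrary: f rule: less_induct)
  case less
  show ?case
  proof (cases "\<exists>x\<in>P. f x \<noteq> x")
    case False
    then have id: "f x = x" if "x \<in> P" for x using that by blast
    have "inversions P l (\<lambda>p q. m (f p) (f q)) = inversions P l m"
      using id by (intro inversions_cong) auto
    moreover have "x = y" if "(x, y) \<in> orbit_rel P f" for x y
      using that by (rule orbit_rel_induct) (auto simp: id)
    then have "orbit_rel P f `` {x} = {x}" for x by auto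
    then have "card (P // orbit_rel P f) = card P"
      by (simp add: quotient_image card_image)
    ultimately show ?thesis by simp
  next
    case True
    then obtain p where p: "p \<in> P" "f p \<noteq> p" by blast
    have inj: "inj_on f P" and im: "f ` P = P" using less.prems by (auto simp: bij_betw_def)
    obtain a where a: "a \<in> P" "f a = p" using im p(1) by (metis imageE)
    have ap: "a \<noteq> p" using a p by auto
    define s where "s x = (if x = a then p else if x = p then a else x)" for x
    \<comment> \<open>Composition with the transposition of \<open>a\<close> and \<open>p\<close>
      fixes \<open>p\<close> and moves no point that \<open>f\<close> fixed. It changes both the
      number of orbits and the parity of the inversions.\<close>
    define g where "g = f \<circ> s"
    have g: "g x = (if x = a then f p else if x = p then p else f x)" for x
      using a ap by (simp add: g_def s_def)
    have s: "bij_betw s P P"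
      by (rule bij_betw_byWitness[where f' = s]) (use a p in \<open>auto simp: s_def\<close>)
    have bij: "bij_betw g P P" unfolding g_def by (rule bij_betw_trans[OF s less.prems])
    have "{x \<in> P. g x \<noteq> x} \<subset> {x \<in> P. f x \<noteq> x}"
    proof
      show "{x \<in> P. g x \<noteq> x} \<subseteq> {x \<in> P. f x \<noteq> x}" using a ap by (auto simp: g split: if_splits)
      show "{x \<in> P. g x \<noteq> x} \<noteq> {x \<in> P. f x \<noteq> x}" using p ap by (auto simp: g set_eq_iff intro!: exI[of _ p])
    qed
    then have "card {x \<in> P. g x \<noteq> x} < card {x \<in> P. f x \<noteq> x}"
      using assms(1) by (intro psubset_card_mono) auto
    from less.hyps[OF this bij]
    have "even (inversions P l (\<lambda>p q. m (g p) (g q)) + inversions P l m + card P + card (P // orbit_rel P g))" .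
    moreover have "card (P // orbit_rel P g) = Suc (card (P // orbit_rel P f))"
      using card_orbits_fix[OF assms(1) inj _ a ap g] im by simp
    moreover have "tournament P (\<lambda>p q. m (f p) (f q))"
      using tournament_pullback[OF assms(4) inj] im by simp
    from inversions_swap[OF assms(1) a(1) p(1) ap assms(3) this s_def]
    have "odd (inversions P l (\<lambda>p q. m (f p) (f q)) + inversions P l (\<lambda>p q. m (g p) (g q)))"
      by (simp add: g_def)
    ultimately show ?thesis by auto
  qed
qed

section \<open>Strands of a slice\<close>

datatype strand = Lft nat | Mid nat | Rgt nat

fun through :: "orient \<Rightarrow> nat \<Rightarrow> nat \<Rightarrow> (bool \<times> nat) \<times> (bool \<times> nat)" where
  "through Fwd b t = ((False, b), (True, t))"
| "through Bwd b t = ((True, t), (False, b))"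

text \<open>
  A strand runs from its first to its second end; an end is at the top (\<open>True\<close>) or at the bottom of
  the slice, at the given position.
\<close>

fun piece_ends :: "nat \<Rightarrow> piece \<Rightarrow> nat \<Rightarrow> (bool \<times> nat) \<times> (bool \<times> nat)" where
  "piece_ends a (Cup s) m = (if s = Fwd then ((True, Suc a), (True, a)) else ((True, a), (True, Suc a)))"
| "piece_ends a (Cap s) m = (if s = Fwd then ((False, a), (False, Suc a)) else ((False, Suc a), (False, a)))"
| "piece_ends a (Cross over s t) m = (if m = 0 then through s a (Suc a) else through t (Suc a) a)"

fun mids :: "piece \<Rightarrow> nat set" where
  "mids (Cross over s t) = {0, 1}"
| "mids g = {0}"

fun ends :: "slice \<Rightarrow> strand \<Rightarrow> (bool \<times> nat) \<times> (bool \<times> nat)" where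
  "ends (u, g, v) (Lft k) = through (u ! k) k k"
| "ends (u, g, v) (Mid m) = piece_ends (length u) g m"
| "ends (u, g, v) (Rgt k) = through (v ! k) (length u + length (bottom_word g) + k) (length u + length (top_word g) + k)"

fun strands :: "slice \<Rightarrow> strand set" where
  "strands (u, g, v) = Lft ` {..<length u} \<union> Mid ` mids g \<union> Rgt ` {..<length v}"

abbreviation entry :: "slice \<Rightarrow> strand \<Rightarrow> bool \<times> nat" where "entry x a \<equiv> fst (ends x a)"
abbreviation exit :: "slice \<Rightarrow> strand \<Rightarrow> bool \<times> nat" where "exit x a \<equiv> snd (ends x a)"

lemma finite_strands [simp]: "finite (strands x)"
proof -
  have "finite (mids g)" for g by (cases g) simp_all
  then show ?thesis by (cases x) simp
qed

lemma orient_cases: "(s = Fwd \<Longrightarrow> P) \<Longrightarrow> (s = Bwd \<Longrightarrow> P) \<Longrightarrow> P"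
  by (cases s) auto

lemma through_ends: "fst (through s b t) = (if s = Fwd then (False, b) else (True, t))"
   "snd (through s b t) = (if s = Fwd then (True, t) else (False, b))"
  by (cases s; simp)+

lemma not_Fwd [simp]: "s \<noteq> Fwd \<longleftrightarrow> s = Bwd"
  by (cases s) auto

lemma nth_middle: "(u @ m @ v) ! (length u + j) = (m @ v) ! j" "(u @ m @ v) ! (length u + length m + j) = v ! j"
  by (simp_all add: nth_append)

text \<open>The orientation of a boundary point decides whether the link enters or leaves the slice
  there; on a common level of two slices it selects the one that is entered.\<close>

lemma ends_at:
  assumes "a \<in> strands x"
  shows "entry x a = (False, k) \<Longrightarrow> k < length (slice_bottom x) \<and> slice_bottom x ! k = Fwd"
    "entry x a = (True, k) \<Longrightarrow> k < length (slice_top x) \<and> slice_top x ! k = Bwd"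
    "exit x a = (False, k) \<Longrightarrow> k < length (slice_bottom x) \<and> slice_bottom x ! k = Bwd"
    "exit x a = (True, k) \<Longrightarrow> k < length (slice_top x) \<and> slice_top x ! k = Fwd"
proof -
  obtain u g v where x: "x = (u, g, v)" by (cases x)
  have "(\<forall>k. entry x a = (False, k) \<longrightarrow> k < length (slice_bottom x) \<and> slice_bottom x ! k = Fwd) \<and>
     (\<forall>k. entry x a = (True, k) \<longrightarrow> k < length (slice_top x) \<and> slice_top x ! k = Bwd) \<and>
     (\<forall>k. exit x a = (False, k) \<longrightarrow> k < length (slice_bottom x) \<and> slice_bottom x ! k = Bwd) \<and>
     (\<forall>k. exit x a = (True, k) \<longrightarrow> k < length (slice_top x) \<and> slice_top x ! k = Fwd)"
  proof (cases a)
    case (Lft k)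
    then show ?thesis using assms by (auto simp: x through_ends nth_append)
  next
    case (Rgt k)
    then show ?thesis using assms by (auto simp: x through_ends nth_middle)
  next
    case (Mid m)
    then show ?thesis using assms by (cases g) (auto simp: x through_ends nth_append split: if_splits)
  qed
  then show "entry x a = (False, k) \<Longrightarrow> k < length (slice_bottom x) \<and> slice_bottom x ! k = Fwd"
    "entry x a = (True, k) \<Longrightarrow> k < length (slice_top x) \<and> slice_top x ! k = Bwd"
    "exit x a = (False, k) \<Longrightarrow> k < length (slice_bottom x) \<and> slice_bottom x ! k = Bwd"
    "exit x a = (True, k) \<Longrightarrow> k < length (slice_top x) \<and> slice_top x ! k = Fwd" by blast+
qed

lemma split_index:
  assumes "k < length (u @ m @ v)"
  obtains "k < length u" | j where "j < length m" "k = length u + j" | j where "j < length v" "k = length u + length m + j"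
proof -
  have "k = length u + (k - length u)" if "\<not> k < length u" using that by simp
  moreover have "k = length u + length m + (k - length u - length m)" if "\<not> k < length u + length m" using that by simp
  ultimately show thesis using that assms by (metis add_diff_inverse_nat diff_diff_left length_append nat_add_left_cancel_less add.assoc)
qed

lemma ends_onto:
  "k < length (slice_bottom x) \<Longrightarrow> slice_bottom x ! k = Fwd \<Longrightarrow> (False, k) \<in> entry x ` strands x"
  "k < length (slice_top x) \<Longrightarrow> slice_top x ! k = Bwd \<Longrightarrow> (True, k) \<in> entry x ` strands x"
  "k < length (slice_bottom x) \<Longrightarrow> slice_bottom x ! k = Bwd \<Longrightarrow> (False, k) \<in> exit x ` strands x"
  "k < length (slice_top x) \<Longrightarrow> slice_top x ! k = Fwd \<Longrightarrow> (True, k) \<in> exit x ` strands x"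
proof -
  obtain u g v where x: "x = (u, g, v)" by (cases x)
  let ?b = "slice_bottom x" and ?t = "slice_top x"
  have b: "(?b ! k = Fwd \<longrightarrow> (False, k) \<in> entry x ` strands x) \<and> (?b ! k = Bwd \<longrightarrow> (False, k) \<in> exit x ` strands x)"
    if k: "k < length ?b"
  proof (rule split_index[of k u "bottom_word g" v])
    show "k < length (u @ bottom_word g @ v)" using k x by simp
    show ?thesis if "k < length u"
      using that by (auto simp: x image_iff through_ends nth_append intro!: bexI[of _ "Lft k"])
    show ?thesis if "j < length v" "k = length u + length (bottom_word g) + j" for j
      using that by (auto simp: x image_iff through_ends nth_middle intro!: bexI[of _ "Rgt j"])
    show ?thesis if "j < length (bottom_word g)" "k = length u + j" for j
    proof (cases g)
      case (Cross over s t)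
      then have "j = 0 \<or> j = Suc 0" using that by auto
      then show ?thesis using that
        by (auto simp: x Cross image_iff through_ends nth_append intro!: bexI[of _ "Mid j"])
    next
      case (Cap s)
      then have "j = 0 \<or> j = Suc 0" using that by auto
      then show ?thesis using that
        by (cases s) (auto simp: x Cap image_iff nth_append intro!: bexI[of _ "Mid 0"])
    qed (use that in simp)
  qed
  have t: "(?t ! k = Bwd \<longrightarrow> (True, k) \<in> entry x ` strands x) \<and> (?t ! k = Fwd \<longrightarrow> (True, k) \<in> exit x ` strands x)"
    if k: "k < length ?t"
  proof (rule split_index[of k u "top_word g" v])
    show "k < length (u @ top_word g @ v)" using k x by simp
    show ?thesis if "k < length u"
      using that by (auto simp: x image_iff through_ends nth_append intro!: bexI[of _ "Lft k"])
    show ?thesis if "j < length v" "k = length u + length (top_word g) + j" for j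
      using that by (auto simp: x image_iff through_ends nth_middle intro!: bexI[of _ "Rgt j"])
    show ?thesis if "j < length (top_word g)" "k = length u + j" for j
    proof (cases g)
      case (Cross over s t)
      then have "j = 0 \<or> j = Suc 0" using that by auto
      \<comment> \<open>At the top the two strands have changed places: position \<open>j\<close>
        belongs to the strand whose bottom position is \<open>1 - j\<close>.\<close>
      then show ?thesis using that
        by (auto simp: x Cross image_iff through_ends nth_append intro!: bexI[of _ "Mid (1 - j)"])
    next
      case (Cup s)
      then have "j = 0 \<or> j = Suc 0" using that by auto
      then show ?thesis using that
        by (cases s) (auto simp: x Cup image_iff nth_append intro!: bexI[of _ "Mid 0"])
    qed (use that in simp)
  qed
  show "k < length ?b \<Longrightarrow> ?b ! k = Fwd \<Longrightarrow> (False, k) \<in> entry x ` strands x"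
    "k < length ?t \<Longrightarrow> ?t ! k = Bwd \<Longrightarrow> (True, k) \<in> entry x ` strands x"
    "k < length ?b \<Longrightarrow> ?b ! k = Bwd \<Longrightarrow> (False, k) \<in> exit x ` strands x"
    "k < length ?t \<Longrightarrow> ?t ! k = Fwd \<Longrightarrow> (True, k) \<in> exit x ` strands x"
    using b t by blast+
qed

lemma inj_ends: "inj_on (entry x) (strands x)" "inj_on (exit x) (strands x)"
proof -
  obtain u g v where x: "x = (u, g, v)" by (cases x)
  show "inj_on (entry x) (strands x)" "inj_on (exit x) (strands x)"
    unfolding x inj_on_def by (cases g; auto simp: through_ends split: if_splits)+
qed

definition place :: "nat \<Rightarrow> bool \<times> nat \<Rightarrow> nat \<times> nat" where
  "place i b = (if fst b then Suc i else i, snd b)"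

lemma symmetric_image_cong:
  assumes "\<And>k. k \<in> K \<Longrightarrow> (c k, d k) = (a k, b k) \<or> (c k, d k) = (b k, a k)"
  shows "(\<lambda>k. (a k, b k)) ` K \<union> ((\<lambda>k. (a k, b k)) ` K)\<inverse> = (\<lambda>k. (c k, d k)) ` K \<union> ((\<lambda>k. (c k, d k)) ` K)\<inverse>"
    (is "?l = ?r")
proof (rule set_eqI)
  fix p :: "'b \<times> 'b"
  have "p \<in> ?l \<longleftrightarrow> (\<exists>k\<in>K. p = (a k, b k) \<or> p = (b k, a k))" by (cases p) auto
  also have "\<dots> \<longleftrightarrow> (\<exists>k\<in>K. p = (c k, d k) \<or> p = (d k, c k))"
    using assms by (metis Pair_inject)
  also have "\<dots> \<longleftrightarrow> p \<in> ?r" by (cases p) auto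
  finally show "p \<in> ?l \<longleftrightarrow> p \<in> ?r" .
qed

text \<open>Arcs run upwards or to the right, strands follow the orientation; the two families agree
  only after symmetrisation.\<close>

lemma slice_arcs_strands: "slice_arcs i x \<union> (slice_arcs i x)\<inverse>
    = (\<lambda>a. (place i (entry x a), place i (exit x a))) ` strands x
      \<union> ((\<lambda>a. (place i (entry x a), place i (exit x a))) ` strands x)\<inverse>"
    (is "?l = ?r")
proof -
  obtain u g v where x: "x = (u, g, v)" by (cases x)
  have mid: "piece_arcs i (length u) g \<union> (piece_arcs i (length u) g)\<inverse>
    = (\<lambda>a. (place i (fst (piece_ends (length u) g a)), place i (snd (piece_ends (length u) g a)))) ` mids g
      \<union> ((\<lambda>a. (place i (fst (piece_ends (length u) g a)), place i (snd (piece_ends (length u) g a)))) ` mids g)\<inverse>"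
    by (cases g) (auto simp: place_def through_ends)
  have thr: "{((i, b k), (Suc i, t k)) | k. k < (n :: nat)} \<union> {((i, b k), (Suc i, t k)) | k. k < n}\<inverse>
    = (\<lambda>k. (place i (fst (through (w k) (b k) (t k))), place i (snd (through (w k) (b k) (t k))))) ` {..<n}
     \<union> ((\<lambda>k. (place i (fst (through (w k) (b k) (t k))), place i (snd (through (w k) (b k) (t k))))) ` {..<n})\<inverse>"
    for b t n w
    using symmetric_image_cong[of "{..<n}" "\<lambda>k. place i (fst (through (w k) (b k) (t k)))"
      "\<lambda>k. place i (snd (through (w k) (b k) (t k)))" "\<lambda>k. (i, b k)" "\<lambda>k. (Suc i, t k)"]
    by (simp add: place_def through_ends image_def Bex_def conj_commute)
  have "?l = ({((i, k), (Suc i, k)) | k. k < length u} \<union> {((i, k), (Suc i, k)) | k. k < length u}\<inverse>)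
    \<union> (piece_arcs i (length u) g \<union> (piece_arcs i (length u) g)\<inverse>)
    \<union> ({((i, length u + length (bottom_word g) + k), (Suc i, length u + length (top_word g) + k)) | k. k < length v} \<union>
      {((i, length u + length (bottom_word g) + k), (Suc i, length u + length (top_word g) + k)) | k. k < length v}\<inverse>)"
    unfolding x slice_arcs.simps by blast
  also have "\<dots> = ?r"
    unfolding mid thr[of "\<lambda>k. k" "\<lambda>k. k" "length u" "\<lambda>k. u ! k"]
      thr[of "\<lambda>k. length u + length (bottom_word g) + k" "\<lambda>k. length u + length (top_word g) + k" "length v" "\<lambda>k. v ! k"]
    unfolding x by (simp add: image_Un image_image converse_Un Un_ac)
  finally show ?thesis .
qed

text \<open>Bottom entries and top exits are the \<open>Fwd\<close> ends. So this order and
  \<open>exit_less\<close> both put \<open>Fwd\<close> before \<open>Bwd\<close> and then go from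
  left to right, and vertical strands have no inversions among themselves.\<close>

fun entry_less :: "bool \<times> nat \<Rightarrow> bool \<times> nat \<Rightarrow> bool" where
  "entry_less (b, k) (c, l) \<longleftrightarrow> \<not> b \<and> c \<or> b = c \<and> k < l"

fun exit_less :: "bool \<times> nat \<Rightarrow> bool \<times> nat \<Rightarrow> bool" where
  "exit_less (b, k) (c, l) \<longleftrightarrow> b \<and> \<not> c \<or> b = c \<and> k < l"

definition slice_inversions :: "slice \<Rightarrow> nat" where
  "slice_inversions x = inversions (strands x) (\<lambda>a b. entry_less (entry x a) (entry x b))
     (\<lambda>a b. exit_less (exit x a) (exit x b))"

lemma tournament_less: "tournament UNIV entry_less" "tournament UNIV exit_less"
  by (auto simp: tournament_def)

lemma tournament_ends: "tournament (strands x) (\<lambda>a b. entry_less (entry x a) (entry x b))"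
   "tournament (strands x) (\<lambda>a b. exit_less (exit x a) (exit x b))"
  by (rule tournament_pullback[OF tournament_less(1) inj_ends(1)] tournament_pullback[OF tournament_less(2) inj_ends(2)]; simp)+

lemma count_list_sum: "count_list w s = (\<Sum>k<length w. of_bool (w ! k = s))"
  by (induction w) (simp_all add: sum.lessThan_Suc_shift del: sum.lessThan_Suc sum_of_bool_eq)

text \<open>Both ends of a turn lie on one level, so it is \<open>Fwd\<close> in one order and
  \<open>Bwd\<close> in the other. Comparison with a vertical strand is once by orientation and once
  by position.\<close>

lemma slice_inversions_turn:
  assumes "case g of Cross over s t \<Rightarrow> False | _ \<Rightarrow> True"
  shows "slice_inversions (u, g, v) = count_list u Bwd + count_list v Fwd"
proof -
  let ?x = "(u, g, v)"
  let ?l = "\<lambda>a b. entry_less (entry ?x a) (entry ?x b)" and ?m = "\<lambda>a b. exit_less (exit ?x a) (exit ?x b)"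
  let ?S = "Lft ` {..<length u} \<union> Rgt ` {..<length v}"
  have S: "strands ?x = insert (Mid 0) ?S" using assms by (cases g) auto
  have "inversions ?S ?l ?m = 0"
    unfolding inversions_def by (rule sum.neutral, rule ballI, rule sum.neutral) (auto simp: through_ends split: if_splits)
  then have "slice_inversions ?x = (\<Sum>q\<in>?S. of_bool (?l (Mid 0) q \<noteq> ?m (Mid 0) q))"
    unfolding slice_inversions_def S
    using tournament_ends[of ?x] S by (subst inversions_insert) auto
  also have "\<dots> = (\<Sum>q\<in>Lft ` {..<length u}. of_bool (?l (Mid 0) q \<noteq> ?m (Mid 0) q))
     + (\<Sum>q\<in>Rgt ` {..<length v}. of_bool (?l (Mid 0) q \<noteq> ?m (Mid 0) q))"
    by (rule sum.union_disjoint) auto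
  also have "(\<Sum>q\<in>Lft ` {..<length u}. of_bool (?l (Mid 0) q \<noteq> ?m (Mid 0) q)) = count_list u Bwd"
    unfolding count_list_sum using assms
    by (subst sum.reindex, simp add: inj_on_def, intro sum.cong refl) (cases g; auto simp: through_ends split: if_splits)
  also have "(\<Sum>q\<in>Rgt ` {..<length v}. of_bool (?l (Mid 0) q \<noteq> ?m (Mid 0) q)) = count_list v Fwd"
    unfolding count_list_sum using assms
    by (subst sum.reindex, simp add: inj_on_def, intro sum.cong refl) (cases g; auto simp: through_ends split: if_splits)
  finally show ?thesis .
qed

text \<open>Opposite strands are ordered by orientation on entry and exit alike; parallel ones are
  ordered by position, which the crossing exchanges.\<close>

lemma slice_inversions_cross: "slice_inversions (u, Cross over s t, v) = of_bool (s = t)"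
proof -
  let ?x = "(u, Cross over s t, v)"
  let ?l = "\<lambda>a b. entry_less (entry ?x a) (entry ?x b)" and ?m = "\<lambda>a b. exit_less (exit ?x a) (exit ?x b)"
  let ?S = "Lft ` {..<length u} \<union> Rgt ` {..<length v}"
  have S: "strands ?x = insert (Mid 0) (insert (Mid 1) ?S)" by auto
  have tm: "tournament (insert (Mid 1) ?S) ?l" "tournament (insert (Mid 1) ?S) ?m"
    using tournament_ends[of ?x] unfolding S by (blast intro: tournament_mono)+
  have "inversions ?S ?l ?m = 0"
    unfolding inversions_def by (rule sum.neutral, rule ballI, rule sum.neutral) (auto simp: through_ends split: if_splits)
  moreover have "(\<Sum>q\<in>?S. of_bool (?l (Mid 0) q \<noteq> ?m (Mid 0) q)) = (0 :: nat)"
    by (rule sum.neutral) (auto simp: through_ends split: if_splits)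
  moreover have "(\<Sum>q\<in>?S. of_bool (?l (Mid 1) q \<noteq> ?m (Mid 1) q)) = (0 :: nat)"
    by (rule sum.neutral) (auto simp: through_ends split: if_splits)
  moreover have "inversions (insert (Mid 1) ?S) ?l ?m
      = inversions ?S ?l ?m + (\<Sum>q\<in>?S. of_bool (?l (Mid 1) q \<noteq> ?m (Mid 1) q))"
    by (rule inversions_insert[OF _ _ tm]) auto
  moreover have "slice_inversions ?x = inversions (insert (Mid 1) ?S) ?l ?m
      + (\<Sum>q\<in>insert (Mid 1) ?S. of_bool (?l (Mid 0) q \<noteq> ?m (Mid 0) q))"
    unfolding slice_inversions_def S
    by (rule inversions_insert[OF _ _ tournament_ends[of ?x, unfolded S]]) auto
  moreover have "(\<Sum>q\<in>insert (Mid 1) ?S. of_bool (?l (Mid 0) q \<noteq> ?m (Mid 0) q))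
      = of_bool (?l (Mid 0) (Mid 1) \<noteq> ?m (Mid 0) (Mid 1)) + (\<Sum>q\<in>?S. of_bool (?l (Mid 0) q \<noteq> ?m (Mid 0) q) :: nat)"
    by (rule sum.insert) auto
  ultimately have "slice_inversions ?x = of_bool (?l (Mid 0) (Mid 1) \<noteq> ?m (Mid 0) (Mid 1))"
    by (simp only: add_0_left add_0_right)
  then show ?thesis by (cases s; cases t) simp_all
qed

text \<open>
  The sum of the positions of \<open>Fwd\<close> in a word, whose changes from level to level make up modulo two
  the difference between the inversions and the count of turns and crossings.
\<close>

fun fwd_weight :: "orient list \<Rightarrow> nat" where
  "fwd_weight [] = 0"
| "fwd_weight (s # w) = fwd_weight w + count_list w Fwd"

lemma fwd_weight_append: "fwd_weight (u @ v) = fwd_weight u + fwd_weight v + length u * count_list v Fwd"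
  by (induction u) (simp_all add: algebra_simps)

lemma length_count: "length w = count_list w Fwd + count_list w Bwd"
  by (induction w) (auto intro: orient_cases)

text \<open>The share of one slice in the sum of \<open>orbits_parity\<close>: its own inversions,
  the inversions between the two orders of points, and the number of points on its lower
  level.\<close>

definition slice_parity :: "slice \<Rightarrow> nat" where
  "slice_parity x = slice_inversions x
     + count_list (slice_bottom x) Bwd * (count_list (slice_bottom x) Fwd + count_list (slice_top x) Fwd)
     + length (slice_bottom x)"

text \<open>Each case is a polynomial identity modulo two in the numbers of \<open>Fwd\<close> and
  \<open>Bwd\<close> strands on either side of the piece. Balance supplies the relation
  \<open>p\<close> among them: the strands beside the piece are even in number.\<close>

lemma slice_balance:
  assumes "count_list (slice_bottom (u, g, v)) Fwd = count_list (slice_bottom (u, g, v)) Bwd"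
  shows "count_list (slice_top (u, g, v)) Fwd = count_list (slice_top (u, g, v)) Bwd"
    and "even (slice_parity (u, g, v) + turn_or_crossing g + fwd_weight (slice_bottom (u, g, v)) + fwd_weight (slice_top (u, g, v)))"
proof -
  note c = assms
  show "count_list (slice_top (u, g, v)) Fwd = count_list (slice_top (u, g, v)) Bwd"
  proof (cases g)
    case (Cup s)
    then show ?thesis using c by (cases s) simp_all
  next
    case (Cap s)
    then show ?thesis using c by (cases s) simp_all
  next
    case (Cross over s t)
    then show ?thesis using c by (cases s; cases t) simp_all
  qed
  show "even (slice_parity (u, g, v) + turn_or_crossing g + fwd_weight (slice_bottom (u, g, v)) + fwd_weight (slice_top (u, g, v)))"
  proof -
  have p: "even (count_list u Fwd + count_list v Fwd + count_list u Bwd + count_list v Bwd)"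
  proof -
    have "count_list (bottom_word g) Fwd + count_list (bottom_word g) Bwd = length (bottom_word g)"
      using length_count[of "bottom_word g"] by simp
    moreover have "even (length (bottom_word g))" by (cases g) simp_all
    ultimately show ?thesis using c by simp presburger
  qed
  show ?thesis
  proof (cases g)
    case (Cup s)
    then show ?thesis using p slice_inversions_turn[of g u v]
      by (cases s; simp add: slice_parity_def fwd_weight_append length_count[of u] length_count[of v] algebra_simps; argo)
  next
    case (Cap s)
    then show ?thesis using p slice_inversions_turn[of g u v]
      by (cases s; simp add: slice_parity_def fwd_weight_append length_count[of u] length_count[of v] algebra_simps; argo)
  next
    case (Cross over s t)
    then show ?thesis using p slice_inversions_cross[of u over s t v]
      by (cases s; cases t; simp add: slice_parity_def fwd_weight_append length_count[of u] length_count[of v] algebra_simps; argo)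
  qed
  qed
qed

text \<open>The weights of inner levels occur twice and cancel; those of empty end words
  vanish.\<close>

lemma tangle_parity:
  "tangle_diagram w L w' \<Longrightarrow> count_list w Fwd = count_list w Bwd \<Longrightarrow>
   even (sum_list (map slice_parity L) + (\<Sum>(u, g, v) \<leftarrow> L. turn_or_crossing g) + fwd_weight w + fwd_weight w')"
proof (induction L arbitrary: w)
  case (Cons x L)
  obtain u g v where x: "x = (u, g, v)" by (cases x)
  have "even (sum_list (map slice_parity L) + (\<Sum>(u, g, v) \<leftarrow> L. turn_or_crossing g) + fwd_weight (slice_top x) + fwd_weight w')"
    using Cons.prems slice_balance(1)[of u g v] by (intro Cons.IH) (auto simp: x)
  then show ?case using Cons.prems slice_balance(2)[of u g v] by (auto simp: x)
qed simp

section \<open>The number of components modulo two\<close>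

text \<open>The default \<open>[]\<close> is the level above the last slice of a closed diagram, so
  \<open>slice_top_level\<close> needs no exception there.\<close>

definition level :: "slice list \<Rightarrow> nat \<Rightarrow> orient list" where
  "level L i = (if i < length L then slice_bottom (L ! i) else [])"

lemma level_0: "tangle_diagram w L [] \<Longrightarrow> level L 0 = w"
  by (cases L) (auto simp: level_def)

lemma slice_top_level: "tangle_diagram w L [] \<Longrightarrow> j < length L \<Longrightarrow> slice_top (L ! j) = level L (Suc j)"
proof (induction L arbitrary: w j)
  case (Cons x L)
  have "level (x # L) (Suc i) = level L i" for i by (simp add: level_def)
  then show ?case using Cons by (cases j) (auto simp: level_0)
qed simp

definition orientation :: "slice list \<Rightarrow> nat \<times> nat \<Rightarrow> orient" where
  "orientation L p = level L (fst p) ! snd p"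

lemma points_level: "points L = Sigma {..<length L} (\<lambda>i. {..<length (level L i)})"
  by (auto simp: points_def level_def)

lemma finite_points [simp]: "finite (points L)"
  by (simp add: points_level)

definition link_strands :: "slice list \<Rightarrow> (nat \<times> strand) set" where
  "link_strands L = Sigma {..<length L} (\<lambda>j. strands (L ! j))"

definition source :: "slice list \<Rightarrow> nat \<times> strand \<Rightarrow> nat \<times> nat" where
  "source L a = place (fst a) (entry (L ! fst a) (snd a))"

definition target :: "slice list \<Rightarrow> nat \<times> strand \<Rightarrow> nat \<times> nat" where
  "target L a = place (fst a) (exit (L ! fst a) (snd a))"

lemma source_at:
  assumes "link_diagram L" "(j, x) \<in> link_strands L" "entry (L ! j) x = (b, k)"
  shows "source L (j, x) = (if b then Suc j else j, k)" "source L (j, x) \<in> points L"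
    "orientation L (source L (j, x)) = (if b then Bwd else Fwd)"
proof -
  have t: "tangle_diagram [] L []" using assms(1) by (simp add: link_diagram_def)
  have jx: "j < length L" "x \<in> strands (L ! j)" using assms(2) by (auto simp: link_strands_def)
  show s: "source L (j, x) = (if b then Suc j else j, k)" using assms(3) by (simp add: source_def place_def)
  have b: "slice_bottom (L ! j) = level L j" using jx by (simp add: level_def)
  note e = ends_at(1,2)[OF jx(2), unfolded b slice_top_level[OF t jx(1)]]
  show "source L (j, x) \<in> points L" unfolding s
    using e assms(3) jx by (auto simp: points_level level_def split: if_splits)
  show "orientation L (source L (j, x)) = (if b then Bwd else Fwd)" unfolding s
    using e assms(3) by (auto simp: orientation_def)
qed

lemma target_at:
  assumes "link_diagram L" "(j, x) \<in> link_strands L" "exit (L ! j) x = (b, k)"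
  shows "target L (j, x) = (if b then Suc j else j, k)" "target L (j, x) \<in> points L"
    "orientation L (target L (j, x)) = (if b then Fwd else Bwd)"
proof -
  have t: "tangle_diagram [] L []" using assms(1) by (simp add: link_diagram_def)
  have jx: "j < length L" "x \<in> strands (L ! j)" using assms(2) by (auto simp: link_strands_def)
  show s: "target L (j, x) = (if b then Suc j else j, k)" using assms(3) by (simp add: target_def place_def)
  have b: "slice_bottom (L ! j) = level L j" using jx by (simp add: level_def)
  note e = ends_at(3,4)[OF jx(2), unfolded b slice_top_level[OF t jx(1)]]
  show "target L (j, x) \<in> points L" unfolding s
    using e assms(3) jx by (auto simp: points_level level_def split: if_splits)
  show "orientation L (target L (j, x)) = (if b then Fwd else Bwd)" unfolding s
    using e assms(3) by (auto simp: orientation_def)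
qed

lemma point_slices:
  assumes "link_diagram L" "(i, k) \<in> points L"
  shows "i < length L" "k < length (slice_bottom (L ! i))" "slice_bottom (L ! i) = level L i"
    "\<exists>j. i = Suc j \<and> j < length L \<and> slice_top (L ! j) = level L i"
proof -
  have t: "tangle_diagram [] L []" using assms(1) by (simp add: link_diagram_def)
  show i: "i < length L" "k < length (slice_bottom (L ! i))" using assms(2) by (auto simp: points_def)
  show l: "slice_bottom (L ! i) = level L i" using i by (simp add: level_def)
  with i(2) have "level L i \<noteq> []" by auto
  then have "i \<noteq> 0" using level_0[OF t] by metis
  then show "\<exists>j. i = Suc j \<and> j < length L \<and> slice_top (L ! j) = level L i"
    using i slice_top_level[OF t] by (cases i) auto
qed

lemma bij_source: "link_diagram L \<Longrightarrow> bij_betw (source L) (link_strands L) (points L)"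
proof -
  assume L: "link_diagram L"
  have "inj_on (source L) (link_strands L)"
  proof (rule inj_onI)
    fix a c assume ac: "a \<in> link_strands L" "c \<in> link_strands L" "source L a = source L c"
    obtain j x i y where a: "a = (j, x)" and c: "c = (i, y)" by (metis prod.collapse)
    obtain b k b' k' where e: "entry (L ! j) x = (b, k)" "entry (L ! i) y = (b', k')" by (metis prod.collapse)
    note 1 = source_at[OF L ac(1)[unfolded a] e(1)] and 2 = source_at[OF L ac(2)[unfolded c] e(2)]
    \<comment> \<open>Equal points have equal orientation, which says on which side of its slice the
      strand enters; the slice index follows.\<close>
    have "b = b'" using 1(3) 2(3) ac(3) a c by (auto split: if_splits)
    then have "j = i" "k = k'" using 1(1) 2(1) ac(3) a c by (auto split: if_splits)
    moreover have "x \<in> strands (L ! j)" "y \<in> strands (L ! j)" using ac a c \<open>j = i\<close> by (auto simp: link_strands_def)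
    then have "x = y" using inj_onD[OF inj_ends(1)[of "L ! j"], of x y] e \<open>b = b'\<close> \<open>j = i\<close> \<open>k = k'\<close> by simp
    ultimately show "a = c" by (simp add: a c)
  qed
  moreover have "source L ` link_strands L = points L"
  proof
    show "source L ` link_strands L \<subseteq> points L"
    proof
      fix p assume "p \<in> source L ` link_strands L"
      then obtain j x where jx: "(j, x) \<in> link_strands L" "p = source L (j, x)" by (metis imageE prod.collapse)
      obtain b k where e: "entry (L ! j) x = (b, k)" by (metis prod.collapse)
      show "p \<in> points L" using source_at(2)[OF L jx(1) e] jx(2) by simp
    qed
    show "points L \<subseteq> source L ` link_strands L"
    proof
      fix p assume p: "p \<in> points L"
      obtain i k where ik: "p = (i, k)" by (cases p)
      note s = point_slices[OF L p[unfolded ik]]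
      show "p \<in> source L ` link_strands L"
      proof (rule orient_cases[of "level L i ! k"])
        assume "level L i ! k = Fwd"
        then have "(False, k) \<in> entry (L ! i) ` strands (L ! i)" using s by (intro ends_onto(1)) auto
        then obtain x where x: "x \<in> strands (L ! i)" "entry (L ! i) x = (False, k)" by auto
        then have m: "(i, x) \<in> link_strands L" using s(1) by (simp add: link_strands_def)
        then show ?thesis using source_at(1)[OF L m x(2)] ik by (auto intro!: image_eqI)
      next
        assume o: "level L i ! k = Bwd"
        obtain j where j: "i = Suc j" "j < length L" "slice_top (L ! j) = level L i" using s(4) by blast
        then have "(True, k) \<in> entry (L ! j) ` strands (L ! j)" using s o by (intro ends_onto(2)) auto
        then obtain x where x: "x \<in> strands (L ! j)" "entry (L ! j) x = (True, k)" by auto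
        then have m: "(j, x) \<in> link_strands L" using j by (simp add: link_strands_def)
        then show ?thesis using source_at(1)[OF L m x(2)] ik j by (auto intro!: image_eqI)
      qed
    qed
  qed
  ultimately show ?thesis by (simp add: bij_betw_def)
qed

lemma bij_target: "link_diagram L \<Longrightarrow> bij_betw (target L) (link_strands L) (points L)"
proof -
  assume L: "link_diagram L"
  have "inj_on (target L) (link_strands L)"
  proof (rule inj_onI)
    fix a c assume ac: "a \<in> link_strands L" "c \<in> link_strands L" "target L a = target L c"
    obtain j x i y where a: "a = (j, x)" and c: "c = (i, y)" by (metis prod.collapse)
    obtain b k b' k' where e: "exit (L ! j) x = (b, k)" "exit (L ! i) y = (b', k')" by (metis prod.collapse)
    note 1 = target_at[OF L ac(1)[unfolded a] e(1)] and 2 = target_at[OF L ac(2)[unfolded c] e(2)]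
    have "b = b'" using 1(3) 2(3) ac(3) a c by (auto split: if_splits)
    then have "j = i" "k = k'" using 1(1) 2(1) ac(3) a c by (auto split: if_splits)
    moreover have "x \<in> strands (L ! j)" "y \<in> strands (L ! j)" using ac a c \<open>j = i\<close> by (auto simp: link_strands_def)
    then have "x = y" using inj_onD[OF inj_ends(2)[of "L ! j"], of x y] e \<open>b = b'\<close> \<open>j = i\<close> \<open>k = k'\<close> by simp
    ultimately show "a = c" by (simp add: a c)
  qed
  moreover have "target L ` link_strands L \<subseteq> points L"
  proof
    fix p assume "p \<in> target L ` link_strands L"
    then obtain j x where jx: "(j, x) \<in> link_strands L" "p = target L (j, x)" by (metis imageE prod.collapse)
    obtain b k where e: "exit (L ! j) x = (b, k)" by (metis prod.collapse)
    show "p \<in> points L" using target_at(2)[OF L jx(1) e] jx(2) by simp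
  qed
  \<comment> \<open>Surjectivity by counting: the sources already match strands with points.\<close>
  ultimately show ?thesis
    using bij_betw_same_card[OF bij_source[OF L]] by (simp add: bij_betw_def card_image card_subset_eq)
qed

text \<open>Points of equal key belong to one slice, and their orientation says whether they lie at
  its bottom or top; ties are therefore broken as in \<open>entry_less\<close> and
  \<open>exit_less\<close>.\<close>

definition key_less :: "(nat \<times> nat \<Rightarrow> nat) \<Rightarrow> (nat \<times> nat \<Rightarrow> orient) \<Rightarrow> nat \<times> nat \<Rightarrow> nat \<times> nat \<Rightarrow> bool" where
  "key_less i r p q \<longleftrightarrow> i p < i q \<or> i p = i q \<and> (r p = Fwd \<and> r q = Bwd \<or> r p = r q \<and> snd p < snd q)"

text \<open>
  One plus the index of the slice that the link enters at a point, respectively leaves at it. Ordered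
  by these, points and their successors have no inversions between different slices.
\<close>

definition slice_after :: "slice list \<Rightarrow> nat \<times> nat \<Rightarrow> nat" where
  "slice_after L p = (if orientation L p = Fwd then Suc (fst p) else fst p)"

definition slice_before :: "slice list \<Rightarrow> nat \<times> nat \<Rightarrow> nat" where
  "slice_before L p = (if orientation L p = Fwd then fst p else Suc (fst p))"

abbreviation in_order where "in_order L \<equiv> key_less (slice_after L) (orientation L)"
abbreviation out_order where "out_order L \<equiv> key_less (slice_before L) (orientation L)"

lemma tournament_orders: "tournament P (in_order L)" "tournament P (out_order L)"
proof -
  have "in_order L (i, k) (j, l) \<longleftrightarrow> \<not> in_order L (j, l) (i, k)"
    "out_order L (i, k) (j, l) \<longleftrightarrow> \<not> out_order L (j, l) (i, k)" if "(i, k) \<noteq> (j, l)" for i k j l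
    by (rule orient_cases[of "orientation L (i, k)"]; rule orient_cases[of "orientation L (j, l)"];
        use that in \<open>auto simp: key_less_def slice_after_def slice_before_def\<close>)+
  moreover have "\<not> in_order L p p" "\<not> out_order L p p" for p by (simp_all add: key_less_def)
  ultimately show "tournament P (in_order L)" "tournament P (out_order L)"
    unfolding tournament_def by (metis prod.collapse)+
qed

lemma image_Sigma: "f ` Sigma A B = (\<Union>j\<in>A. (\<lambda>x. f (j, x)) ` B j)"
  by (auto simp: image_iff)

lemma UN_converse: "(\<Union>j\<in>J. A j \<union> (A j)\<inverse>) = (\<Union>j\<in>J. A j) \<union> (\<Union>j\<in>J. A j)\<inverse>"
  by auto

lemma sum_Sigma_twice:
  assumes "finite A" "\<And>i. i \<in> A \<Longrightarrow> finite (B i)"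
  shows "(\<Sum>p\<in>Sigma A B. \<Sum>q\<in>Sigma A B. F p q) = (\<Sum>i\<in>A. \<Sum>x\<in>B i. \<Sum>j\<in>A. \<Sum>y\<in>B j. F (i, x) (j, y))"
proof -
  have S: "(\<Sum>p\<in>Sigma A B. G p) = (\<Sum>i\<in>A. \<Sum>x\<in>B i. G (i, x))" for G
    using assms by (simp add: sum.Sigma)
  show ?thesis by (simp only: S)
qed

lemma in_order_source:
  assumes L: "link_diagram L" and "(j, x) \<in> link_strands L" "(i, y) \<in> link_strands L"
  shows "in_order L (source L (j, x)) (source L (i, y))
    \<longleftrightarrow> j < i \<or> j = i \<and> entry_less (entry (L ! j) x) (entry (L ! i) y)"
proof -
  obtain b k b' k' where e: "entry (L ! j) x = (b, k)" "entry (L ! i) y = (b', k')" by (metis prod.collapse)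
  show ?thesis
    using source_at(1,3)[OF L assms(2) e(1)] source_at(1,3)[OF L assms(3) e(2)] e
    by (auto simp: key_less_def slice_after_def)
qed

lemma out_order_target:
  assumes L: "link_diagram L" and "(j, x) \<in> link_strands L" "(i, y) \<in> link_strands L"
  shows "out_order L (target L (j, x)) (target L (i, y))
    \<longleftrightarrow> j < i \<or> j = i \<and> exit_less (exit (L ! j) x) (exit (L ! i) y)"
proof -
  obtain b k b' k' where e: "exit (L ! j) x = (b, k)" "exit (L ! i) y = (b', k')" by (metis prod.collapse)
  show ?thesis
    using target_at(1,3)[OF L assms(2) e(1)] target_at(1,3)[OF L assms(3) e(2)] e
    by (auto simp: key_less_def slice_before_def)
qed

lemma strand_inversions:
  assumes "link_diagram L"
  shows "inversions (link_strands L) (\<lambda>a b. in_order L (source L a) (source L b)) (\<lambda>a b. out_order L (target L a) (target L b))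
    = (\<Sum>j<length L. slice_inversions (L ! j))"
proof -
  let ?S = "\<lambda>j. strands (L ! j)"
  have "inversions (link_strands L) (\<lambda>a b. in_order L (source L a) (source L b)) (\<lambda>a b. out_order L (target L a) (target L b))
    = (\<Sum>j<length L. \<Sum>x\<in>?S j. \<Sum>i<length L. \<Sum>y\<in>?S i. of_bool (i = j \<and>
        entry_less (entry (L ! j) x) (entry (L ! j) y) \<and> exit_less (exit (L ! j) y) (exit (L ! j) x)))"
    unfolding inversions_def
    unfolding link_strands_def
    by (subst sum_Sigma_twice, simp, simp, intro sum.cong refl)
       (subst in_order_source[OF assms], auto simp: out_order_target[OF assms] link_strands_def)
  also have "\<dots> = (\<Sum>j<length L. \<Sum>x\<in>?S j. \<Sum>y\<in>?S j. of_bool (entry_less (entry (L ! j) x) (entry (L ! j) y) \<and> exit_less (exit (L ! j) y) (exit (L ! j) x)))"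
  proof (intro sum.cong refl)
    fix j x assume j: "j \<in> {..<length L}"
    let ?f = "\<lambda>y. of_bool (entry_less (entry (L ! j) x) (entry (L ! j) y) \<and> exit_less (exit (L ! j) y) (exit (L ! j) x)) :: nat"
    have "(\<Sum>i<length L. \<Sum>y\<in>?S i. of_bool (i = j \<and>
        entry_less (entry (L ! j) x) (entry (L ! j) y) \<and> exit_less (exit (L ! j) y) (exit (L ! j) x)))
       = (\<Sum>i<length L. if i = j then \<Sum>y\<in>?S j. ?f y else 0)"
      by (intro sum.cong refl) auto
    then show "(\<Sum>i<length L. \<Sum>y\<in>?S i. of_bool (i = j \<and>
        entry_less (entry (L ! j) x) (entry (L ! j) y) \<and> exit_less (exit (L ! j) y) (exit (L ! j) x))) = (\<Sum>y\<in>?S j. ?f y)"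
      using j by simp
  qed
  finally show ?thesis by (simp only: slice_inversions_def inversions_def)
qed

text \<open>A \<open>Bwd\<close> point on level \<open>i\<close> has the keys \<open>i\<close> and
  \<open>Suc i\<close> in the two orders, a \<open>Fwd\<close> point on level \<open>j\<close> has
  \<open>Suc j\<close> and \<open>j\<close>. With ties won by \<open>Fwd\<close>, they are inverted
  exactly for \<open>j = i\<close> and \<open>j = Suc i\<close>.\<close>

lemma point_inversions:
  "inversions (points L) (in_order L) (out_order L)
    = (\<Sum>j<length L. count_list (level L j) Bwd * (count_list (level L j) Fwd + count_list (level L (Suc j)) Fwd))"
proof -
  let ?n = "length L" and ?w = "level L"
  have key: "in_order L (i, k) (j, l) \<and> out_order L (j, l) (i, k)
      \<longleftrightarrow> ?w i ! k = Bwd \<and> ?w j ! l = Fwd \<and> (j = i \<or> j = Suc i)" for i k j l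
    by (rule orient_cases[of "?w i ! k"]; rule orient_cases[of "?w j ! l"])
       (auto simp: key_less_def slice_after_def slice_before_def orientation_def)
  have "inversions (points L) (in_order L) (out_order L)
    = (\<Sum>i<?n. \<Sum>k<length (?w i). \<Sum>j<?n. \<Sum>l<length (?w j).
        of_bool (?w i ! k = Bwd) * (of_bool (j = i \<or> j = Suc i) * of_bool (?w j ! l = Fwd)))"
    unfolding inversions_def points_level
    by (subst sum_Sigma_twice, simp, simp, intro sum.cong refl) (auto simp: key)
  also have "\<dots> = (\<Sum>i<?n. count_list (?w i) Bwd * (\<Sum>j<?n. of_bool (j = i \<or> j = Suc i) * count_list (?w j) Fwd))"
    by (simp only: count_list_sum sum_distrib_left[symmetric] sum_distrib_right[symmetric])
  also have "\<dots> = (\<Sum>i<?n. count_list (?w i) Bwd * (count_list (?w i) Fwd + count_list (?w (Suc i)) Fwd))"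
  proof (intro sum.cong refl arg_cong2[of _ _ _ _ "(*)"])
    fix i assume i: "i \<in> {..<?n}"
    have "(\<Sum>j<?n. of_bool (j = i \<or> j = Suc i) * count_list (?w j) Fwd)
        = (\<Sum>j<?n. (if j = i then count_list (?w i) Fwd else 0) + (if j = Suc i then count_list (?w (Suc i)) Fwd else 0))"
      by (intro sum.cong refl) auto
    also have "\<dots> = count_list (?w i) Fwd + (if Suc i < ?n then count_list (?w (Suc i)) Fwd else 0)"
      using i by (simp add: sum.distrib)
    \<comment> \<open>For the last slice the missing term is zero because the level above it is
      \<open>[]\<close> by default.\<close>
    finally show "(\<Sum>j<?n. of_bool (j = i \<or> j = Suc i) * count_list (?w j) Fwd) = count_list (?w i) Fwd + count_list (?w (Suc i)) Fwd"
      by (auto simp: level_def)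
  qed
  finally show ?thesis .
qed

text \<open>A form of Whitney's congruence. A closed diagram has as many cups as caps, so the
  counterclockwise minima (\<open>Cup Bwd\<close>) and clockwise maxima (\<open>Cap Fwd\<close>)
  together have the parity of the rotation number.\<close>

theorem components_parity:
  assumes L: "link_diagram L"
  shows "even (num_components L + (\<Sum>(u, g, v) \<leftarrow> L. turn_or_crossing g))"
proof -
  let ?P = "points L" and ?I = "link_strands L" and ?n = "length L"
  have t: "tangle_diagram [] L []" using L by (simp add: link_diagram_def)
  note S = bij_source[OF L] and T = bij_target[OF L]
  \<comment> \<open>The strand that starts at a point is followed to its end: the next point along
    the orientation.\<close>
  define f where "f = target L \<circ> inv_into ?I (source L)"
  have fS: "f (source L a) = target L a" if "a \<in> ?I" for a
    using that bij_betw_inv_into_left[OF S] by (simp add: f_def)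
  have f: "bij_betw f ?P ?P" unfolding f_def
    by (rule bij_betw_trans[OF bij_betw_inv_into[OF S] T])
  have rel: "arcs L \<union> (arcs L)\<inverse> = successor_rel ?P f \<union> (successor_rel ?P f)\<inverse>"
  proof -
    have "successor_rel ?P f = (\<lambda>p. (p, f p)) ` source L ` ?I"
      using S by (auto simp: successor_rel_def bij_betw_def)
    also have "\<dots> = (\<lambda>a. (source L a, target L a)) ` ?I"
      unfolding image_image by (rule image_cong) (simp_all add: fS)
    also have "\<dots> = (\<Union>j<?n. (\<lambda>a. (place j (entry (L ! j) a), place j (exit (L ! j) a))) ` strands (L ! j))"
      unfolding link_strands_def image_Sigma by (simp add: source_def target_def)
    finally have s: "successor_rel ?P f = (\<Union>j<?n. (\<lambda>a. (place j (entry (L ! j) a), place j (exit (L ! j) a))) ` strands (L ! j))" .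
    have "arcs L \<union> (arcs L)\<inverse> = (\<Union>j<?n. slice_arcs j (L ! j) \<union> (slice_arcs j (L ! j))\<inverse>)"
      unfolding arcs_def by (rule UN_converse[symmetric])
    also have "\<dots> = successor_rel ?P f \<union> (successor_rel ?P f)\<inverse>"
      unfolding slice_arcs_strands s by (rule UN_converse)
    finally show ?thesis .
  qed
  have nc: "num_components L = card (?P // orbit_rel ?P f)"
    unfolding num_components_def rel orbit_rel_def ..
  have inv: "inversions ?P (in_order L) (\<lambda>p q. out_order L (f p) (f q)) = (\<Sum>j<?n. slice_inversions (L ! j))"
  proof -
    have "inversions ?P (in_order L) (\<lambda>p q. out_order L (f p) (f q))
      = inversions ?I (\<lambda>a b. in_order L (source L a) (source L b)) (\<lambda>a b. out_order L (f (source L a)) (f (source L b)))"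
      unfolding inversions_def
      by (subst sum.reindex_bij_betw[OF S, symmetric], subst sum.reindex_bij_betw[OF S, symmetric]) (rule refl)
    also have "\<dots> = inversions ?I (\<lambda>a b. in_order L (source L a) (source L b)) (\<lambda>a b. out_order L (target L a) (target L b))"
      by (rule inversions_cong) (simp_all add: fS)
    finally show ?thesis unfolding strand_inversions[OF L] .
  qed
  have "even ((\<Sum>j<?n. slice_inversions (L ! j)) + inversions ?P (in_order L) (out_order L) + card ?P + num_components L)"
    using orbits_parity[OF finite_points f tournament_orders(1)[of ?P L] tournament_orders(2)[of ?P L]] unfolding inv nc .
  moreover have "(\<Sum>j<?n. slice_inversions (L ! j)) + inversions ?P (in_order L) (out_order L) + card ?P
      = (\<Sum>j<?n. slice_parity (L ! j))"
    unfolding point_inversions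
    by (simp add: points_level sum.distrib[symmetric])
       (intro sum.cong refl, auto simp: slice_parity_def level_def slice_top_level[OF t])
  moreover have "(\<Sum>j<?n. slice_parity (L ! j)) = sum_list (map slice_parity L)"
    by (simp add: sum_list_sum_nth atLeast0LessThan)
  ultimately show ?thesis using tangle_parity[OF t] by simp
qed

section \<open>Ribbon categories\<close>

context strict_braided
begin

definition scalar_ends :: "'o list \<Rightarrow> bool" where
  "scalar_ends a \<longleftrightarrow> (\<forall>f. arr f \<and> dm f = a \<and> cd f = a \<longrightarrow> (\<exists>!c. f = c \<star> one a))"

text \<open>Conjugation by the invertible \<open>n\<close> relates endomorphisms of
  \<open>a @ x @ x'\<close> to those of \<open>a\<close>, so \<open>f \<parallel> one x'\<close> is
  a scalar; a zigzag then recovers \<open>f\<close>.\<close>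

lemma scalar_ends_tensor:
  assumes a: "scalar_ends a" and d: "dual_pair x x' n e"
    and ni: "arr ni" "dm ni = x @ x'" "cd ni = []" "ni \<bullet> n = one []" "n \<bullet> ni = one (x @ x')"
  shows "scalar_ends (a @ x)"
  unfolding scalar_ends_def
proof (intro allI impI)
  fix f assume "arr f \<and> dm f = a @ x \<and> cd f = a @ x"
  then have f [simp]: "arr f" "dm f = a @ x" "cd f = a @ x" by auto
  note [simp] = dual_pairD(1-6)[OF d] ni(1-3)
  \<comment> \<open>Closing with \<open>ni\<close>, the inverse of \<open>n\<close>, makes
    \<open>G\<close> send each scalar to itself, which also gives uniqueness.\<close>
  define G where "G h = (one a \<parallel> ni) \<bullet> (h \<parallel> one x') \<bullet> (one a \<parallel> n)" for h
  have nn: "(one a \<parallel> n) \<bullet> (one a \<parallel> ni) = one (a @ x @ x')" "(one a \<parallel> ni) \<bullet> (one a \<parallel> n) = one a"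
    using whisker(1)[of ni n a] whisker(1)[of n ni a] ni(4,5) by simp_all
  have "arr (G f) \<and> dm (G f) = a \<and> cd (G f) = a" by (simp add: G_def)
  then obtain c where c: "G f = c \<star> one a" and unique: "\<And>c'. G f = c' \<star> one a \<Longrightarrow> c' = c"
    using a unfolding scalar_ends_def by metis
  have "f \<parallel> one x' = ((one a \<parallel> n) \<bullet> (one a \<parallel> ni)) \<bullet> (f \<parallel> one x') \<bullet> ((one a \<parallel> n) \<bullet> (one a \<parallel> ni))"
    unfolding nn by simp
  also have "\<dots> = (one a \<parallel> n) \<bullet> G f \<bullet> (one a \<parallel> ni)" by (simp add: G_def)
  also have "\<dots> = c \<star> one (a @ x @ x')" unfolding c using nn(1) by simp
  finally have fx: "(f \<parallel> one x') \<parallel> one x = c \<star> one (a @ x @ x' @ x)" by (simp del: tns_assoc)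
  have z: "(one (a @ x) \<parallel> e) \<bullet> (one a \<parallel> n \<parallel> one x) = one (a @ x)"
  proof -
    have "(one (a @ x) \<parallel> e) \<bullet> (one a \<parallel> n \<parallel> one x) = one a \<parallel> ((one x \<parallel> e) \<bullet> (n \<parallel> one x))"
      by (simp add: whisker)
    then show ?thesis unfolding dual_pairD(7)[OF d] by simp
  qed
  have "f = f \<bullet> (one (a @ x) \<parallel> e) \<bullet> (one a \<parallel> n \<parallel> one x)" unfolding z by simp
  also have "\<dots> = (one (a @ x) \<parallel> e) \<bullet> (f \<parallel> one (x' @ x)) \<bullet> (one a \<parallel> n \<parallel> one x)"
    using cmp_tail[OF slices1[of f e], of "one a \<parallel> n \<parallel> one x"] cmp_tail[OF slices2[of f e], of "one a \<parallel> n \<parallel> one x"] by simp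
  also have "\<dots> = c \<star> one (a @ x)" using fx z by simp
  finally have "f = c \<star> one (a @ x)" .
  moreover have "c' = c" if "f = c' \<star> one (a @ x)" for c'
    by (rule unique) (use nn(2) in \<open>simp add: G_def that\<close>)
  ultimately show "\<exists>!c. f = c \<star> one (a @ x)" by blast
qed

end

sublocale linear_braided_category \<subseteq> S: strict_braided s_arr s_dm s_cd s_one s_cmp s_tns s_sc s_br s_bri
proof
  show "s_cmp (s_br (s_cd f) (s_cd g)) (s_tns f g) = s_cmp (s_tns g f) (s_br (s_dm f) (s_dm g))"
    if "s_arr f" "s_arr g" for f g by (rule s_br_nat[OF that])
  show "s_br u (v @ w) = s_cmp (s_tns (s_one v) (s_br u w)) (s_tns (s_br u v) (s_one w))" for u v w
    by (rule s_hexagon1)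
  show "s_br (u @ v) w = s_cmp (s_tns (s_br u w) (s_one v)) (s_tns (s_one u) (s_br v w))" for u v w
    by (rule s_hexagon2)
qed (simp_all add: s_br_arr s_br_inverse s_tns_one s_nil_tns s_tns_nil s_tns_assoc s_interchange,
  simp_all add: s_defs comp_assoc_ends prod_eq_iff)

context linear_braided_category
begin

lemma strictify_inject:
  assumes "src C f = tree_obj R" "tgt C f = tree_obj T" "src C g = tree_obj R" "tgt C g = tree_obj T"
    and "strictify R T f = strictify R T g"
  shows "f = g"
proof -
  have "canonical T \<cdot> f \<cdot> inv_arr C (canonical R) = canonical T \<cdot> g \<cdot> inv_arr C (canonical R)"
    using assms(5) by (simp add: strictify_def)
  then have "f \<cdot> inv_arr C (canonical R) = g \<cdot> inv_arr C (canonical R)"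
    by (rule iso_cancel_left[rotated]) (simp_all add: assms)
  then show ?thesis by (rule iso_cancel_right[rotated]) (simp_all add: assms)
qed

lemma strictify_scalar:
  assumes "src C f = tree_obj T" "tgt C f = tree_obj T"
  shows "strictify T T f = s_sc c (s_one (flat T)) \<longleftrightarrow> f = c \<odot> idm C (tree_obj T)"
proof -
  have e: "s_sc c (s_one (flat T)) = strictify T T (c \<odot> idm C (tree_obj T))"
    by (simp add: strictify_scale strictify_id)
  show ?thesis unfolding e using strictify_inject[of f T T "c \<odot> idm C (tree_obj T)"] assms by auto
qed

lemma scalar_endos_strict: "S.scalar_ends (flat T) \<longleftrightarrow> scalar_endos C (tree_obj T)"
proof
  assume S: "S.scalar_ends (flat T)"
  show "scalar_endos C (tree_obj T)" unfolding scalar_endos_def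
  proof
    fix f assume "f \<in> hom C (tree_obj T) (tree_obj T)"
    then have f: "src C f = tree_obj T" "tgt C f = tree_obj T" by (simp_all add: hom_iff)
    then have "\<exists>!c. strictify T T f = s_sc c (s_one (flat T))"
      using S[unfolded S.scalar_ends_def, rule_format, of "strictify T T f"] by simp
    then show "\<exists>!c. f = c \<odot> idm C (tree_obj T)" unfolding strictify_scalar[OF f] .
  qed
next
  assume C: "scalar_endos C (tree_obj T)"
  show "S.scalar_ends (flat T)" unfolding S.scalar_ends_def
  proof (intro allI impI)
    fix g assume g: "s_arr g \<and> s_dm g = flat T \<and> s_cd g = flat T"
    then obtain h where h: "g = (flat T, h, flat T)" "src C h = list_obj (flat T)" "tgt C h = list_obj (flat T)"
      by (cases g) (auto simp: s_defs)
    define f where "f = inv_arr C (canonical T) \<cdot> h \<cdot> canonical T"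
    have f: "src C f = tree_obj T" "tgt C f = tree_obj T" by (simp_all add: f_def h)
    have "strictify T T f = g" by (simp add: strictify_def f_def h comp_assoc_ends)
    moreover have "\<exists>!c. f = c \<odot> idm C (tree_obj T)" using C f unfolding scalar_endos_def by (simp add: hom_iff)
    ultimately show "\<exists>!c. g = s_sc c (s_one (flat T))" using strictify_scalar[OF f] by simp
  qed
qed

lemma scalar_of_eq: "scalar_endos C a \<Longrightarrow> f = c \<odot> idm C a \<Longrightarrow> scalar_of C a f = c"
proof -
  assume a: "scalar_endos C a" and f: "f = c \<odot> idm C a"
  have "f \<in> hom C a a" by (simp add: f hom_iff)
  then have "\<exists>!c. f = c \<odot> idm C a" using a unfolding scalar_endos_def by blast
  then show ?thesis unfolding scalar_of_def by (rule the1_equality) (rule f)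
qed

lemma scalar_of_exists: "scalar_endos C a \<Longrightarrow> src C f = a \<Longrightarrow> tgt C f = a \<Longrightarrow> f = scalar_of C a f \<odot> idm C a"
proof -
  assume a: "scalar_endos C a" and f: "src C f = a" "tgt C f = a"
  then have "\<exists>!c. f = c \<odot> idm C a" unfolding scalar_endos_def by (simp add: hom_iff)
  then obtain c where c: "f = c \<odot> idm C a" by blast
  then show ?thesis unfolding scalar_of_eq[OF a c] .
qed

lemma scalar_endos_inject: "scalar_endos C a \<Longrightarrow> c \<odot> idm C a = c' \<odot> idm C a \<Longrightarrow> c = c'"
  using scalar_of_eq[of a "c \<odot> idm C a" c] scalar_of_eq[of a "c \<odot> idm C a" c'] by simp

text \<open>If \<open>c\<close> were zero, the identity would be both 0 and 1 times itself, against
  the uniqueness of scalars in \<open>scalar_endos\<close>.\<close>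

lemma iso_scalar_nz:
  assumes "scalar_endos C a" "is_iso C (c \<odot> idm C a)"
  shows "c \<noteq> 0"
proof
  assume "c = 0"
  then have i: "is_iso C (0 \<odot> idm C a)" using assms by simp
  let ?g = "inv_arr C (0 \<odot> idm C a)"
  have "?g \<cdot> (0 \<odot> idm C a) = idm C a" using inv_arr_simps(3)[OF i] by simp
  moreover have "src C ?g = a" "tgt C ?g = a" using inv_arr_simps(1,2)[OF i] by simp_all
  ultimately have 0: "0 \<odot> ?g = 1 \<odot> idm C a" by simp
  obtain d where "?g = d \<odot> idm C a" using scalar_of_exists[OF assms(1) \<open>src C ?g = a\<close> \<open>tgt C ?g = a\<close>] by blast
  then have "0 \<odot> idm C a = 1 \<odot> idm C a" using 0 by simp
  then show False using scalar_endos_inject[OF assms(1), of 0 1] by simp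
qed

end

section \<open>Strictification of duals, diagrams and the invariant\<close>

context ribbon_category
begin

lemma ev_ends [simp]: "src C (ev C a) = dual C a \<otimes> a" "tgt C (ev C a) = \<one>"
  "src C (coev C a) = \<one>" "tgt C (coev C a) = a \<otimes> dual C a"
  "src C (twist C a) = a" "tgt C (twist C a) = a"
  using ev_hom[of a] coev_hom[of a] twist_hom[of a] by (simp_all add: hom_iff)

lemma ev'_ends [simp]: "src C (ev' C a) = a \<otimes> dual C a" "tgt C (ev' C a) = \<one>"
  "src C (coev' C a) = \<one>" "tgt C (coev' C a) = dual C a \<otimes> a"
  by (simp_all add: ev'_def coev'_def)

lemma cup_cap_ends [simp]:
  "src C (cup_arr C V s) = \<one>" "tgt C (cup_arr C V s) = label C V s \<otimes> label C V (flip s)"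
  "src C (cap_arr C V s) = label C V s \<otimes> label C V (flip s)" "tgt C (cap_arr C V s) = \<one>"
  by (cases s; simp)+

abbreviation pair :: "'o \<Rightarrow> 'o \<Rightarrow> 'o bracketing" where "pair a b \<equiv> BTensor (BAtom a) (BAtom b)"

definition strict_obj :: "'o \<Rightarrow> orient \<Rightarrow> 'o list" where "strict_obj V s = [label C V s]"

definition strict_cup :: "'o \<Rightarrow> orient \<Rightarrow> 'o list \<times> 'm \<times> 'o list" where
  "strict_cup V s = strictify BUnit (pair (label C V s) (label C V (flip s))) (cup_arr C V s)"

definition strict_cap :: "'o \<Rightarrow> orient \<Rightarrow> 'o list \<times> 'm \<times> 'o list" where
  "strict_cap V s = strictify (pair (label C V s) (label C V (flip s))) BUnit (cap_arr C V s)"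

lemma strictify_inv_lunit: "strictify T (BTensor BUnit T) (inv_arr C (lunit C (tree_obj T))) = s_one (flat T)"
  using strictify_inv[of "lunit C (tree_obj T)" "BTensor BUnit T" T] strictify_lunit[of T] by simp

lemma strictify_inv_runit: "strictify T (BTensor T BUnit) (inv_arr C (runit C (tree_obj T))) = s_one (flat T)"
  using strictify_inv[of "runit C (tree_obj T)" "BTensor T BUnit" T] strictify_runit[of T] by simp

lemma strictify_inv_assoc: "strictify (BTensor R (BTensor S T)) (BTensor (BTensor R S) T)
     (inv_arr C (assoc C (tree_obj R) (tree_obj S) (tree_obj T))) = s_one (flat R @ flat S @ flat T)"
  by (subst strictify_inv) (simp_all add: strictify_assoc)

text \<open>The zigzag axioms are strictified factor by factor; their associators and unit
  constraints become identities.\<close>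

lemma dual_pair_strict: "S.dual_pair [V] [dual C V] (strict_cup V Fwd) (strict_cap V Bwd)"
proof -
  let ?v = "BAtom V" and ?w = "BAtom (dual C V)"
  have 1: "strictify ?v ?v (runit C V \<cdot> (idm C V \<boxtimes> ev C V) \<cdot> assoc C V (dual C V) V
          \<cdot> (coev C V \<boxtimes> idm C V) \<cdot> inv_arr C (lunit C V)) = s_one [V]"
    unfolding zigzag1 using strictify_id[of ?v] by simp
  have z1: "s_cmp (s_tns (s_one [V]) (strict_cap V Bwd)) (s_tns (strict_cup V Fwd) (s_one [V])) = s_one [V]"
    using 1
    apply (subst (asm) strictify_comp[of _ _ "BTensor ?v BUnit"], simp_all)
    apply (subst (asm) strictify_comp[of _ _ "BTensor ?v (BTensor ?w ?v)"], simp_all)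
    apply (subst (asm) strictify_comp[of _ _ "BTensor (BTensor ?v ?w) ?v"], simp_all)
    apply (subst (asm) strictify_comp[of _ _ "BTensor BUnit ?v"], simp_all)
    using strictify_runit[of ?v] strictify_assoc[of ?v ?w ?v] strictify_inv_lunit[of ?v] strictify_id[of ?v]
    by (simp add: strictify_tensor strict_cup_def strict_cap_def)
  have 2: "strictify ?w ?w (lunit C (dual C V) \<cdot> (ev C V \<boxtimes> idm C (dual C V))
          \<cdot> inv_arr C (assoc C (dual C V) V (dual C V))
          \<cdot> (idm C (dual C V) \<boxtimes> coev C V) \<cdot> inv_arr C (runit C (dual C V))) = s_one [dual C V]"
    unfolding zigzag2 using strictify_id[of ?w] by simp
  have z2: "s_cmp (s_tns (strict_cap V Bwd) (s_one [dual C V])) (s_tns (s_one [dual C V]) (strict_cup V Fwd)) = s_one [dual C V]"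
    using 2
    apply (subst (asm) strictify_comp[of _ _ "BTensor BUnit ?w"], simp_all)
    apply (subst (asm) strictify_comp[of _ _ "BTensor (BTensor ?w ?v) ?w"], simp_all)
    apply (subst (asm) strictify_comp[of _ _ "BTensor ?w (BTensor ?v ?w)"], simp_all)
    apply (subst (asm) strictify_comp[of _ _ "BTensor ?w BUnit"], simp_all)
    using strictify_lunit[of ?w] strictify_inv_assoc[of ?w ?v ?w] strictify_inv_runit[of ?w] strictify_id[of ?w]
    by (simp add: strictify_tensor strict_cup_def strict_cap_def)
  show ?thesis unfolding S.dual_pair_def using z1 z2 by (simp add: strict_cup_def strict_cap_def)
qed

lemma colouring_strict:
  assumes t: "twist C V = t \<odot> idm C V" "t \<noteq> 0"
  shows "S.colouring (strict_obj V) (strict_cup V) (strict_cap V) t"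
proof -
  let ?v = "BAtom V" and ?w = "BAtom (dual C V)"
  have "strict_cup V Bwd = s_sc t (strictify BUnit (BTensor ?w ?v) (braid C V (dual C V) \<cdot> coev C V))"
    by (simp add: strict_cup_def coev'_def t strictify_scale)
  also have "strictify BUnit (BTensor ?w ?v) (braid C V (dual C V) \<cdot> coev C V) = s_cmp (s_br [V] [dual C V]) (strict_cup V Fwd)"
    using strictify_braid[of ?v ?w] by (subst strictify_comp[of _ _ "BTensor ?v ?w"]) (simp_all add: strict_cup_def)
  finally have cu: "strict_cup V Bwd = s_sc t (s_cmp (s_br [V] [dual C V]) (strict_cup V Fwd))" .
  have "strict_cap V Fwd = s_sc t (strictify (BTensor ?v ?w) BUnit (ev C V \<cdot> braid C V (dual C V)))"
    by (simp add: strict_cap_def ev'_def t strictify_scale)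
  also have "strictify (BTensor ?v ?w) BUnit (ev C V \<cdot> braid C V (dual C V)) = s_cmp (strict_cap V Bwd) (s_br [V] [dual C V])"
    using strictify_braid[of ?v ?w] by (subst strictify_comp[of _ _ "BTensor ?w ?v"]) (simp_all add: strict_cap_def)
  finally have ca: "strict_cap V Fwd = s_sc t (s_cmp (strict_cap V Bwd) (s_br [V] [dual C V]))" .
  show ?thesis unfolding S.colouring_def using dual_pair_strict[of V] cu ca t(2) by (simp add: strict_obj_def)
qed

lemma word_obj_list: "word_obj C V w = list_obj (map (label C V) w)"
  by (induction w) simp_all

lemma word_strict_obj [simp]: "S.word (strict_obj V) w = map (label C V) w"
  by (induction w) (simp_all add: strict_obj_def)

definition word_tree :: "'o \<Rightarrow> orient list \<Rightarrow> 'o bracketing" where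
  "word_tree V w = word_bracketing (map (label C V) w)"

lemma word_tree_simps [simp]: "word_tree V [] = BUnit"
    "word_tree V (s # w) = BTensor (BAtom (label C V s)) (word_tree V w)"
    "flat (word_tree V w) = map (label C V) w" "tree_obj (word_tree V w) = word_obj C V w"
  by (simp_all add: word_tree_def word_obj_list)

lemma cross_ends [simp]: "src C (cross_arr C V over s t) = label C V s \<otimes> label C V t"
   "tgt C (cross_arr C V over s t) = label C V t \<otimes> label C V s"
  by (simp_all add: cross_arr_def)

text \<open>The reassociations built into \<open>piece_arr\<close> vanish, leaving the bare piece
  beside the strands \<open>v\<close>.\<close>

lemma piece_strict: "src C (piece_arr C V g v) = word_obj C V (bottom_word g @ v)
   \<and> tgt C (piece_arr C V g v) = word_obj C V (top_word g @ v)
   \<and> strictify (word_tree V (bottom_word g @ v)) (word_tree V (top_word g @ v)) (piece_arr C V g v)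
     = s_tns (S.piece_map (strict_obj V) (strict_cup V) (strict_cap V) g) (s_one (map (label C V) v))"
proof (cases g)
  case (Cup s)
  let ?s = "BAtom (label C V s)" and ?t = "BAtom (label C V (flip s))" and ?v = "word_tree V v"
  have "strictify ?v (BTensor ?s (BTensor ?t ?v)) (piece_arr C V g v)
     = s_cmp (s_one (flat ?s @ flat ?t @ flat ?v)) (s_cmp (s_tns (strict_cup V s) (s_one (flat ?v))) (s_one (flat ?v)))"
    using strictify_assoc[of ?s ?t ?v] strictify_inv_lunit[of ?v] strictify_id[of ?v] unfolding Cup
    by (simp, subst strictify_comp[of _ _ "BTensor (BTensor ?s ?t) ?v"], simp_all)
       (subst strictify_comp[of _ _ "BTensor BUnit ?v"], simp_all add: strictify_tensor strict_cup_def)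
  then show ?thesis using Cup by (simp add: strict_cup_def)
next
  case (Cap s)
  let ?s = "BAtom (label C V s)" and ?t = "BAtom (label C V (flip s))" and ?v = "word_tree V v"
  have "strictify (BTensor ?s (BTensor ?t ?v)) ?v (piece_arr C V g v)
     = s_cmp (s_one (flat ?v)) (s_cmp (s_tns (strict_cap V s) (s_one (flat ?v))) (s_one (flat ?s @ flat ?t @ flat ?v)))"
    using strictify_inv_assoc[of ?s ?t ?v] strictify_lunit[of ?v] strictify_id[of ?v] unfolding Cap
    by (simp, subst strictify_comp[of _ _ "BTensor BUnit ?v"], simp_all)
       (subst strictify_comp[of _ _ "BTensor (BTensor ?s ?t) ?v"], simp_all add: strictify_tensor strict_cap_def)
  then show ?thesis using Cap by (simp add: strict_cap_def)
next
  case (Cross over s t)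
  let ?s = "BAtom (label C V s)" and ?t = "BAtom (label C V t)" and ?v = "word_tree V v"
  have c: "strictify (BTensor ?s ?t) (BTensor ?t ?s) (cross_arr C V over s t) = S.piece_map (strict_obj V) (strict_cup V) (strict_cap V) g"
    using strictify_braid[of ?s ?t] strictify_inv_braid[of ?s ?t] strictify_inv_braid[of ?t ?s] by (simp add: Cross cross_arr_def strict_obj_def)
  have "strictify (BTensor ?s (BTensor ?t ?v)) (BTensor ?t (BTensor ?s ?v)) (piece_arr C V g v)
     = s_cmp (s_one (flat ?t @ flat ?s @ flat ?v)) (s_cmp (s_tns (S.piece_map (strict_obj V) (strict_cup V) (strict_cap V) g) (s_one (flat ?v)))
        (s_one (flat ?s @ flat ?t @ flat ?v)))"
    unfolding c[symmetric]
    using strictify_inv_assoc[of ?s ?t ?v] strictify_assoc[of ?t ?s ?v] strictify_id[of ?v] unfolding Cross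
    by (simp, subst strictify_comp[of _ _ "BTensor (BTensor ?t ?s) ?v"], simp_all)
       (subst strictify_comp[of _ _ "BTensor (BTensor ?s ?t) ?v"], simp_all add: strictify_tensor)
  then show ?thesis using Cross by (simp add: strict_obj_def)
qed

lemma slice_strict: "src C (slice_arr C V (u, g, v)) = word_obj C V (slice_bottom (u, g, v))
   \<and> tgt C (slice_arr C V (u, g, v)) = word_obj C V (slice_top (u, g, v))
   \<and> strictify (word_tree V (slice_bottom (u, g, v))) (word_tree V (slice_top (u, g, v))) (slice_arr C V (u, g, v))
     = s_tns (s_one (map (label C V) u)) (s_tns (S.piece_map (strict_obj V) (strict_cup V) (strict_cap V) g) (s_one (map (label C V) v)))"
proof (induction u)
  case Nil
  have "s_arr (s_tns (S.piece_map (strict_obj V) (strict_cup V) (strict_cap V) g) (s_one (map (label C V) v)))"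
    using piece_strict[of V g v] strictify_arr by (metis word_tree_simps(4))
  then show ?case using piece_strict[of V g v] by simp
next
  case (Cons s u)
  let ?p = "s_tns (S.piece_map (strict_obj V) (strict_cup V) (strict_cap V) g) (s_one (map (label C V) v))"
  have p: "s_arr ?p" using piece_strict[of V g v] strictify_arr by (metis word_tree_simps(4))
  have "strictify (word_tree V (s # slice_bottom (u, g, v))) (word_tree V (s # slice_top (u, g, v))) (slice_arr C V (s # u, g, v))
      = s_tns (s_one [label C V s]) (s_tns (s_one (map (label C V) u)) ?p)"
    using Cons strictify_id[of "BAtom (label C V s)"] by (simp add: strictify_tensor)
  also have "\<dots> = s_tns (s_one (map (label C V) (s # u))) ?p"
    using S.one_one_tns[OF p] by simp
  finally show ?case using Cons by simp
qed

lemma tangle_strict: "tangle_diagram w L w' \<Longrightarrow> src C (tangle_arr C V w L) = word_obj C V w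
   \<and> tgt C (tangle_arr C V w L) = word_obj C V w'
   \<and> strictify (word_tree V w) (word_tree V w') (tangle_arr C V w L) = S.tangle_map (strict_obj V) (strict_cup V) (strict_cap V) w L"
proof (induction L arbitrary: w)
  case Nil
  then show ?case using strictify_id[of "word_tree V w'"] by simp
next
  case (Cons x L)
  obtain u g v where x: "x = (u, g, v)" by (cases x)
  have w: "w = slice_bottom x" and L: "tangle_diagram (slice_top x) L w'" using Cons.prems by simp_all
  note IH = Cons.IH[OF L] and sl = slice_strict[of V u g v, folded x]
  have "strictify (word_tree V w) (word_tree V w') (tangle_arr C V w (x # L))
     = s_cmp (S.tangle_map (strict_obj V) (strict_cup V) (strict_cap V) (slice_top x) L) (S.slice_map (strict_obj V) (strict_cup V) (strict_cap V) x)"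
    using IH sl unfolding w tangle_arr.simps
    by (subst strictify_comp[of _ _ "word_tree V (slice_top x)"]) (simp_all add: x)
  then show ?case using IH sl by (simp add: w)
qed

lemma RT_framed_strict:
  assumes "link_diagram L" "S.tangle_map (strict_obj V) (strict_cup V) (strict_cap V) [] L = s_sc c (s_one [])"
  shows "RT_framed C V L = c"
proof -
  note T = tangle_strict[OF assms(1)[unfolded link_diagram_def], of V]
  have "tangle_arr C V [] L = c \<odot> idm C \<one>"
    using strictify_scalar[of "tangle_arr C V [] L" BUnit c] T assms(2) by simp
  then show ?thesis unfolding RT_framed_def by (rule scalar_of_eq[OF unit_endos])
qed

lemma tangle_scalar:
  assumes "link_diagram L"
  shows "S.tangle_map (strict_obj V) (strict_cup V) (strict_cap V) [] L = s_sc (RT_framed C V L) (s_one [])"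
proof -
  note T = tangle_strict[OF assms(1)[unfolded link_diagram_def], of V]
  have "tangle_arr C V [] L = RT_framed C V L \<odot> idm C \<one>"
    unfolding RT_framed_def by (rule scalar_of_exists[OF unit_endos]) (use T in simp_all)
  then show ?thesis using strictify_scalar[of "tangle_arr C V [] L" BUnit "RT_framed C V L"] T by simp
qed

lemma twist_scalar:
  assumes "scalar_endos C V"
  shows "twist C V = twist_factor C V \<odot> idm C V" "twist_factor C V \<noteq> 0"
proof -
  show t: "twist C V = twist_factor C V \<odot> idm C V"
    unfolding twist_factor_def by (rule scalar_of_exists[OF assms]) simp_all
  show "twist_factor C V \<noteq> 0" using iso_scalar_nz[OF assms] twist_iso[of V] t by metis
qed

lemma braid_unit: "braid C \<one> \<one> = idm C (\<one> \<otimes> \<one>)"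
  by (rule strictify_inject[of _ "BTensor BUnit BUnit" "BTensor BUnit BUnit"])
     (use strictify_braid[of BUnit BUnit] strictify_id[of "BTensor BUnit BUnit"] in simp_all)

text \<open>The unit braids trivially with itself, so the twist of
  \<open>\<one> \<otimes> \<one>\<close> is \<open>t * t\<close>; naturality along
  \<open>lunit\<close> equates this with \<open>t\<close>.\<close>

lemma twist_unit: "twist C \<one> = idm C \<one>"
proof -
  define t where "t = twist_factor C \<one>"
  have t: "twist C \<one> = t \<odot> idm C \<one>" "t \<noteq> 0" using twist_scalar[OF unit_endos] by (simp_all add: t_def)
  have "twist C (\<one> \<otimes> \<one>) = (t * t) \<odot> idm C (\<one> \<otimes> \<one>)"
    unfolding twist_tensor by (simp add: braid_unit t)
  moreover have "twist C \<one> \<cdot> lunit C \<one> = lunit C \<one> \<cdot> twist C (\<one> \<otimes> \<one>)"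
    by (rule twist_natural) (simp add: hom_iff)
  ultimately have "t \<odot> lunit C \<one> = (t * t) \<odot> lunit C \<one>" by (simp add: t)
  then have "(t \<odot> idm C \<one>) \<cdot> lunit C \<one> = ((t * t) \<odot> idm C \<one>) \<cdot> lunit C \<one>" by simp
  then have "t \<odot> idm C \<one> = (t * t) \<odot> idm C \<one>"
    by (rule iso_cancel_right[rotated]) simp_all
  then have "t = t * t" by (rule scalar_endos_inject[OF unit_endos])
  then have "t = 1" using t(2) by simp
  then show ?thesis using t by simp
qed

text \<open>Naturality of the twist at the coevaluation, with trivial twist on the unit. The twist
  of the dual is moved to \<open>V\<close> by \<open>twist_dual\<close>, whence the square.\<close>

lemma twist_coev:
  assumes t: "twist C V = t \<odot> idm C V"
  shows "s_sc (t * t) (s_cmp (s_br [dual C V] [V]) (s_cmp (s_br [V] [dual C V]) (strict_cup V Fwd))) = strict_cup V Fwd"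
proof -
  let ?v = "BAtom V" and ?w = "BAtom (dual C V)" and ?m = "braid C (dual C V) V \<cdot> braid C V (dual C V)"
  have "coev C V = twist C (V \<otimes> dual C V) \<cdot> coev C V"
    using twist_natural[of "coev C V" \<one> "V \<otimes> dual C V"] by (simp add: hom_iff twist_unit)
  also have "\<dots> = ?m \<cdot> (twist C V \<boxtimes> twist C (dual C V)) \<cdot> coev C V"
    unfolding twist_tensor by (simp add: comp_assoc_ends)
  also have "(twist C V \<boxtimes> twist C (dual C V)) \<cdot> coev C V
      = (twist C V \<boxtimes> idm C (dual C V)) \<cdot> (idm C V \<boxtimes> twist C (dual C V)) \<cdot> coev C V"
    by (simp add: tensor_comp_assoc)
  also have "\<dots> = (t * t) \<odot> coev C V"
    unfolding twist_dual[symmetric] t by simp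
  finally have "coev C V = (t * t) \<odot> (braid C (dual C V) V \<cdot> braid C V (dual C V) \<cdot> coev C V)"
    by (simp add: comp_assoc_ends)
  then have "strict_cup V Fwd = s_sc (t * t) (strictify BUnit (BTensor ?v ?w) (braid C (dual C V) V \<cdot> braid C V (dual C V) \<cdot> coev C V))"
    using strictify_scale[of "braid C (dual C V) V \<cdot> braid C V (dual C V) \<cdot> coev C V" BUnit "BTensor ?v ?w" "t * t"]
    by (simp add: strict_cup_def)
  also have "strictify BUnit (BTensor ?v ?w) (braid C (dual C V) V \<cdot> braid C V (dual C V) \<cdot> coev C V)
      = s_cmp (s_br [dual C V] [V]) (s_cmp (s_br [V] [dual C V]) (strict_cup V Fwd))"
    using strictify_braid[of ?v ?w] strictify_braid[of ?w ?v]
    by (subst strictify_comp[of _ _ "BTensor ?w ?v"], simp_all)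
       (subst strictify_comp[of _ _ "BTensor ?v ?w"], simp_all add: strict_cup_def)
  finally show ?thesis ..
qed

text \<open>Invertibility provides only some isomorphism \<open>f\<close>; because
  \<open>\<one>\<close> has scalar endomorphisms, the coevaluation is a multiple of its
  inverse.\<close>

lemma invertible_coev:
  assumes X: "scalar_endos C X" "invertible C X"
  obtains ni where "s_arr ni" "s_dm ni = [X, dual C X]" "s_cd ni = []"
    "s_cmp ni (strict_cup X Fwd) = s_one []" "s_cmp (strict_cup X Fwd) ni = s_one [X, dual C X]"
proof -
  obtain f where f: "src C f = X \<otimes> dual C X" "tgt C f = \<one>" "is_iso C f"
    using X(2) unfolding invertible_def isomorphic_def by (auto simp: hom_iff)
  obtain c where c: "f \<cdot> coev C X = c \<odot> idm C \<one>"
    using scalar_of_exists[OF unit_endos, of "f \<cdot> coev C X"] f by auto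
  have coev: "coev C X = c \<odot> inv_arr C f"
  proof -
    have "coev C X = inv_arr C f \<cdot> (f \<cdot> coev C X)" using f by simp
    then show ?thesis unfolding c using f by simp
  qed
  \<comment> \<open>Otherwise the zigzag exhibits the identity of \<open>X\<close> as 0 times an
    endomorphism.\<close>
  have "c \<noteq> 0"
  proof
    assume "c = 0"
    let ?g = "runit C X \<cdot> (idm C X \<boxtimes> ev C X) \<cdot> assoc C X (dual C X) X
          \<cdot> (inv_arr C f \<boxtimes> idm C X) \<cdot> inv_arr C (lunit C X)"
    have g: "src C ?g = X" "tgt C ?g = X" using f by simp_all
    have "idm C X = 0 \<odot> ?g"
      using zigzag1[of X] f unfolding coev \<open>c = 0\<close> by simp
    also have "?g = scalar_of C X ?g \<odot> idm C X" by (rule scalar_of_exists[OF X(1) g])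
    finally have "1 \<odot> idm C X = 0 \<odot> idm C X" by simp
    then show False using scalar_endos_inject[OF X(1), of 0 1] by simp
  qed
  let ?T = "BTensor (BAtom X) (BAtom (dual C X))"
  define ni where "ni = strictify ?T BUnit (inverse c \<odot> f)"
  have "s_cmp ni (strict_cup X Fwd) = strictify BUnit BUnit (inverse c \<odot> f \<cdot> coev C X)"
    unfolding ni_def strict_cup_def using f by (simp add: strictify_comp[of _ _ ?T, symmetric])
  moreover have "s_cmp (strict_cup X Fwd) ni = strictify ?T ?T (coev C X \<cdot> (inverse c \<odot> f))"
    unfolding ni_def strict_cup_def using f by (subst strictify_comp[of _ _ BUnit]) simp_all
  ultimately show thesis
    using that[of ni] f c \<open>c \<noteq> 0\<close> strictify_id[of BUnit] strictify_id[of ?T]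
    by (simp add: ni_def coev)
qed

lemma scalar_endos_tensor:
  assumes "scalar_endos C A" "scalar_endos C X" "invertible C X"
  shows "scalar_endos C (A \<otimes> X)"
proof -
  obtain ni where ni: "s_arr ni" "s_dm ni = [X, dual C X]" "s_cd ni = []"
    "s_cmp ni (strict_cup X Fwd) = s_one []" "s_cmp (strict_cup X Fwd) ni = s_one [X, dual C X]"
    using invertible_coev assms(2,3) by blast
  have "S.scalar_ends ([A] @ [X])"
    by (rule S.scalar_ends_tensor[OF _ dual_pair_strict[of X], of _ ni])
       (use scalar_endos_strict[of "BAtom A"] assms(1) ni in simp_all)
  then show ?thesis using scalar_endos_strict[of "BTensor (BAtom A) (BAtom X)"] by simp
qed

lemma strict_cmp_braid: "s_cmp (s_br [b] [a]) (s_br [a] [b])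
    = strictify (pair a b) (pair a b) (braid C b a \<cdot> braid C a b)"
  using strictify_braid[of "BAtom a" "BAtom b"] strictify_braid[of "BAtom b" "BAtom a"]
  by (subst strictify_comp[of _ _ "pair b a"]) simp_all

lemma RT_tensor:
  assumes A: "scalar_endos C A" and X: "scalar_endos C X" and AX: "scalar_endos C (A \<otimes> X)"
    and L: "link_diagram L"
  shows "RT_invariant C (A \<otimes> X) L = RT_invariant C A L * RT_invariant C X L"
proof -
  define tA tX where "tA = twist_factor C A" and "tX = twist_factor C X"
  define m where "m = scalar_of C (A \<otimes> X) (braid C X A \<cdot> braid C A X)"
  have m: "braid C X A \<cdot> braid C A X = m \<odot> idm C (A \<otimes> X)"
    unfolding m_def by (rule scalar_of_exists[OF AX]) simp_all
  note tw = twist_scalar[OF A, folded tA_def] twist_scalar[OF X, folded tX_def]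
  have V: "twist C (A \<otimes> X) = (m * tA * tX) \<odot> idm C (A \<otimes> X)"
    unfolding twist_tensor tw comp_assoc_ends[symmetric] by (simp add: comp_assoc_ends[symmetric] m mult_ac)
  then have tV: "twist_factor C (A \<otimes> X) = m * tA * tX"
    unfolding twist_factor_def by (rule scalar_of_eq[OF AX])
  have nz: "m * tA * tX \<noteq> 0" using twist_scalar(2)[OF AX] tV by simp
  have mono: "s_cmp (s_br [X] [A]) (s_br [A] [X]) = s_sc m (s_one [A, X])"
    unfolding strict_cmp_braid m using strictify_scale[of "idm C (A \<otimes> X)" "pair A X" "pair A X" m] strictify_id[of "pair A X"]
    by simp
  \<comment> \<open>The identity of \<open>A \<otimes> X\<close>, read as an arrow from a one-letter
    word to a two-letter word.\<close>
  let ?p = "strictify (BAtom (A \<otimes> X)) (pair A X) (idm C (A \<otimes> X))"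
  let ?q = "strictify (pair A X) (BAtom (A \<otimes> X)) (idm C (A \<otimes> X))"
  have "s_cmp ?q ?p = s_one [A \<otimes> X]" "s_cmp ?p ?q = s_one [A, X]"
    using strictify_comp[of "idm C (A \<otimes> X)" "BAtom (A \<otimes> X)" "pair A X" "idm C (A \<otimes> X)" "BAtom (A \<otimes> X)"]
      strictify_comp[of "idm C (A \<otimes> X)" "pair A X" "BAtom (A \<otimes> X)" "idm C (A \<otimes> X)" "pair A X"]
      strictify_id[of "BAtom (A \<otimes> X)"] strictify_id[of "pair A X"] by simp_all
  then interpret cable s_arr s_dm s_cd s_one s_cmp s_tns s_sc s_br s_bri "strict_obj A" "strict_obj X" "strict_obj (A \<otimes> X)"
    "strict_cup A" "strict_cup X" "strict_cup (A \<otimes> X)" "strict_cap A" "strict_cap X" "strict_cap (A \<otimes> X)" tA tX "m * tA * tX" ?p ?q m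
    by unfold_locales
       (use colouring_strict[OF tw(1,2)] colouring_strict[OF tw(3,4)] colouring_strict[OF V nz] mono in \<open>simp_all add: strict_obj_def\<close>)
  have "S.tangle_map (strict_obj (A \<otimes> X)) (strict_cup (A \<otimes> X)) (strict_cap (A \<otimes> X)) [] L
      = s_sc (m powi writhe L * (RT_framed C A L * RT_framed C X L)) (s_one [])"
    unfolding cable_link[OF L] tangle_scalar[OF L, of A] tangle_scalar[OF L, of X] by (simp add: mult.commute)
  then have "RT_framed C (A \<otimes> X) L = m powi writhe L * (RT_framed C A L * RT_framed C X L)"
    by (rule RT_framed_strict[OF L])
  \<comment> \<open>The twist factor \<open>m * tA * tX\<close> of the product brings
    \<open>m powi (- writhe L)\<close>, which cancels the cost of lifting \<open>X\<close> off
    \<open>A\<close>.\<close>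
  then show ?thesis
    using nz unfolding RT_invariant_def tV tA_def[symmetric] tX_def[symmetric]
    by (simp add: power_int_mult_distrib power_int_minus field_simps)
qed

lemma RT_invertible:
  assumes X: "scalar_endos C X" "invertible C X" and L: "link_diagram L"
  shows "RT_invariant C X L = qdim C X ^ num_components L"
proof -
  define t where "t = twist_factor C X"
  note t = twist_scalar[OF X(1), folded t_def]
  have XX: "scalar_endos C (X \<otimes> X)" by (rule scalar_endos_tensor[OF X(1) X])
  define k where "k = scalar_of C (X \<otimes> X) (braid C X X)"
  have k: "braid C X X = k \<odot> idm C (X \<otimes> X)"
    unfolding k_def by (rule scalar_of_exists[OF XX]) simp_all
  have k0: "k \<noteq> 0" using iso_scalar_nz[OF XX] braid_iso[of X X] k by metis
  have brXX: "s_br [X] [X] = s_sc k (s_one [X, X])"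
    using strictify_braid[of "BAtom X" "BAtom X"] strictify_scale[of "idm C (X \<otimes> X)" "pair X X" "pair X X" k]
      strictify_id[of "pair X X"] by (simp add: k)
  obtain ni where ni: "s_arr ni" "s_dm ni = [X, dual C X]" "s_cd ni = []"
    "s_cmp ni (strict_cup X Fwd) = s_one []" "s_cmp (strict_cup X Fwd) ni = s_one [X, dual C X]"
    using invertible_coev[OF X] .
  interpret line s_arr s_dm s_cd s_one s_cmp s_tns s_sc s_br s_bri "strict_obj X" "strict_cup X" "strict_cap X" t ni k
    by unfold_locales (use colouring_strict[OF t] ni brXX k0 in \<open>simp_all add: strict_obj_def\<close>)
  have strict_one_inject: "c = c'" if "s_sc c (s_one []) = s_sc c' (s_one [])" for c c'
    using that scalar_endos_inject[OF unit_endos] by (simp add: s_defs)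
  \<comment> \<open>The double braiding on the coevaluation, computed from the twist by
    \<open>twist_coev\<close> and from the self-braiding by \<open>balance\<close>.\<close>
  have "s_sc (t * t * inverse (k * k)) (strict_cup X Fwd) = strict_cup X Fwd"
    using twist_coev[OF t(1)] balance by (simp add: strict_obj_def)
  then have "s_cmp ni (s_sc (t * t * inverse (k * k)) (strict_cup X Fwd)) = s_cmp ni (strict_cup X Fwd)" by simp
  then have "s_sc (t * t * inverse (k * k)) (s_one []) = s_sc 1 (s_one [])"
    using ni by (simp add: strict_cup_def strict_obj_def)
  then have "t * t * inverse (k * k) = 1" by (rule strict_one_inject)
  then have tk: "t * t = k * k" using k0 by (simp add: field_simps)
  have "strictify BUnit BUnit (ev' C X \<cdot> coev C X) = s_cmp (strict_cap X Fwd) (strict_cup X Fwd)"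
    by (subst strictify_comp[of _ _ "pair X (dual C X)"]) (simp_all add: strict_cap_def strict_cup_def)
  also have "\<dots> = s_sc (t / k) (s_one [])"
    unfolding loop(3) using ni by (simp add: strict_cup_def strict_obj_def)
  finally have "ev' C X \<cdot> coev C X = (t / k) \<odot> idm C \<one>"
    using strictify_scalar[of "ev' C X \<cdot> coev C X" BUnit "t / k"] by simp
  then have d: "qdim C X = t / k" unfolding qdim_def by (rule scalar_of_eq[OF unit_endos])
  have F: "RT_framed C X L = t powi writhe L * (t / k) ^ (\<Sum>(u, g, v) \<leftarrow> L. turn_or_crossing g)"
    by (rule RT_framed_strict[OF L line_link[OF tk L]])
  \<comment> \<open>\<open>t / k\<close> has square one, so only the parity of the exponent
    counts.\<close>
  have "(t / k) ^ (\<Sum>(u, g, v) \<leftarrow> L. turn_or_crossing g) = (t / k) ^ num_components L"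
  proof -
    have sq: "(t / k) * (t / k) = 1" using tk k0 by simp
    have pow: "(t / k) ^ n = (if even n then 1 else t / k)" for n
      by (induction n) (use sq in auto)
    show ?thesis unfolding pow using components_parity[OF L] by simp
  qed
  then show ?thesis
    unfolding RT_invariant_def t_def[symmetric] d F using t(2) by (simp add: power_int_minus)
qed

end

theorem theorem4p4:
  fixes C :: "('o, 'm) ribbon_data" (structure)
    and A X :: 'o
    and L :: "slice list"
  assumes "semisimple_ribbon_category C"
    and "simple C A"
    and "simple C X"
    and "invertible C X"
    and "link_diagram L"
  shows "RT_invariant C (A \<otimes> X) L = RT_invariant C A L * RT_invariant C X L
       \<and> RT_invariant C A L * RT_invariant C X L = qdim C X ^ num_components L * RT_invariant C A L"
proof -
  interpret semisimple_ribbon_category C by (rule assms(1))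
  have A: "scalar_endos C A" and X: "scalar_endos C X" using simple_endos assms(2,3) by blast+
  show ?thesis
    using RT_tensor[OF A X scalar_endos_tensor[OF A X assms(4)] assms(5)] RT_invertible[OF X assms(4,5)]
    by simp
qed

end
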